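(* Consider all pairs $(M_2,T)$ where $M_2\subseteq\mathbb{Z}$ and $T$ is an admissible triangulation of the infinite strip $\mathbb{V}(\mathbb{Z},M_2)$ having no special marked points on the upper boundary. Identify two such triangulations if they correspond under an order-preserving bijection between their sets of upper marked points, and, when the set of upper marked points is $\mathbb{Z}$, identify moreover triangulations that are Dehn twist equivalent. Then $T\mapsto\Phi(T)$ induces a bijection between the resulting equivalence classes of such triangulations and the set of all infinite friezes.
   Context: An infinite frieze is a map $t:\mathbb{Z}\times\mathbb{Z}\to\mathbb{Z}$ such that $t(i,i)=0$; $t(i,j)\ge 1$ if $i<j$ and $t(i,i+1)=1$; $t(i,j)=-t(j,i)$ for all $i,j$; and $t(i,j)t(i+1,j+1)-t(i,j+1)t(i+1,j)=1$ for all $i,j$. Its quiddity sequence is $(a_i)_{i\in\mathbb{Z}}$ with $a_i=t(i-1,i+1)$; an infinite frieze is uniquely determined by its quiddity sequence. For $M_2\subseteq\mathbb{Z}$, $\mathbb{V}(\mathbb{Z},M_2)$ is the strip $\mathbb{R}\times[0,1]$ with marked points $(i,0)$, $i\in\mathbb{Z}$, on the lower boundary and $(i,1)$, $i\in M_2$, on the upper boundary. An arc is a non-contractible curve in the strip whose endpoints are marked points, up to isotopy fixing endpoints; boundary segments between consecutive marked points of the same boundary are not arcs. An arc is bridging if its endpoints lie on different boundaries and peripheral if on the same boundary. Two arcs are compatible if they have representatives not crossing except possibly at endpoints. A triangulation is a maximal collection of pairwise compatible arcs. A marked point is a left-fountain (resp. right-fountain) of $T$ if it is incident with infinitely many arcs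 of $T$ whose other endpoints go arbitrarily far to the left (resp. right). $T$ is admissible if every marked point on the lower boundary is incident with only finitely many arcs of $T$ (no lower marked point is a fountain). A marked point is special if it is incident with no arc of $T$. For an admissible triangulation $T$, let $a_i$ be the number of triangles of $T$ incident with $(i,0)$; then $(a_i)$ is the quiddity sequence of an infinite frieze, denoted $\Phi(T)$. Dehn twist (for $M_2=\mathbb{Z}$, $T$ with no special upper marked point): $D(T)$ is obtained from $T$ by replacing every bridging arc from $(u,1)$ to $(j,0)$ by a bridging arc from $(u+1,1)$ to $(j,0)$ and keeping the peripheral arcs on the lower boundary; $D^{-1}$ is defined with $u-1$, and $D^n$ is the $n$-fold iterate ($n\in\mathbb{Z}$). $T,T'$ are Dehn twist equivalent if $T'=D^n(T)$ for some $n\in\mathbb{Z}$. *)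

theory Defs
  imports "HOL-Analysis.Analysis"
begin

definition infinite_frieze :: "(int \<Rightarrow> int \<Rightarrow> int) \<Rightarrow> bool" where
  "infinite_frieze t \<longleftrightarrow>
     (\<forall>i. t i i = 0) \<and>
     (\<forall>i j. i < j \<longrightarrow> t i j \<ge> 1) \<and>
     (\<forall>i. t i (i + 1) = 1) \<and>
     (\<forall>i j. t i j = - t j i) \<and>
     (\<forall>i j. t i j * t (i + 1) (j + 1) - t i (j + 1) * t (i + 1) j = 1)"

definition quiddity :: "(int \<Rightarrow> int \<Rightarrow> int) \<Rightarrow> int \<Rightarrow> int" where
  "quiddity t i = t (i - 1) (i + 1)"

definition strip :: "(real \<times> real) set" where
  "strip = UNIV \<times> {0..1}"

datatype mpoint = Lower int | Upper int

fun pos :: "mpoint \<Rightarrow> real \<times> real" where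
  "pos (Lower i) = (of_int i, 0)"
| "pos (Upper u) = (of_int u, 1)"

definition marked :: "int set \<Rightarrow> mpoint set" where
  "marked M = range Lower \<union> Upper ` M"

definition consecutive :: "int set \<Rightarrow> mpoint \<Rightarrow> mpoint \<Rightarrow> bool" where
  "consecutive M p q \<longleftrightarrow>
     (\<exists>i. p = Lower i \<and> q = Lower (i + 1)) \<or>
     (\<exists>u\<in>M. \<exists>v\<in>M. p = Upper u \<and> q = Upper v \<and> u < v \<and> \<not> (\<exists>w\<in>M. u < w \<and> w < v))"

text \<open>As usual for arcs in a marked surface, curves are simple and meet the boundary only in
  their endpoints.\<close>

definition curve :: "int set \<Rightarrow> (real \<Rightarrow> real \<times> real) \<Rightarrow> bool" where
  "curve M g \<longleftrightarrow>
     simple_path g \<and> path_image g \<subseteq> strip \<and> g ` {0<..<1} \<subseteq> UNIV \<times> {0<..<1} \<and>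
     pathstart g \<in> pos ` marked M \<and> pathfinish g \<in> pos ` marked M"

text \<open>Isotopy of curves fixing endpoints is taken as homotopy relative to the endpoints (the two
  notions agree for simple curves in a surface). Curves are not oriented.\<close>

definition isotopic :: "(real \<Rightarrow> real \<times> real) \<Rightarrow> (real \<Rightarrow> real \<times> real) \<Rightarrow> bool" where
  "isotopic g h \<longleftrightarrow> homotopic_paths strip g h \<or> homotopic_paths strip g (reversepath h)"

definition contractible_curve :: "(real \<Rightarrow> real \<times> real) \<Rightarrow> bool" where
  "contractible_curve g \<longleftrightarrow> homotopic_paths strip g (\<lambda>_. pathstart g)"

definition boundary_segment :: "int set \<Rightarrow> (real \<Rightarrow> real \<times> real) \<Rightarrow> bool" where
  "boundary_segment M g \<longleftrightarrow>
     (\<exists>p q. consecutive M p q \<and> isotopic g (linepath (pos p) (pos q)))"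

type_synonym strip_arc = "(real \<Rightarrow> real \<times> real) set"

definition arcs :: "int set \<Rightarrow> strip_arc set" where
  "arcs M = {{h. curve M h \<and> isotopic g h} | g.
     curve M g \<and> \<not> contractible_curve g \<and> \<not> boundary_segment M g}"

definition ends :: "strip_arc \<Rightarrow> mpoint set" where
  "ends \<alpha> = {p. \<exists>g\<in>\<alpha>. pos p = pathstart g \<or> pos p = pathfinish g}"

text \<open>The strip is simply connected, so arcs are determined by their endpoints. Below, arcs are
  therefore described by their endpoints whenever only these matter.\<close>

lemma isotopicI:
  assumes "curve M g" "curve M h"
    and "{pathstart g, pathfinish g} = {pathstart h, pathfinish h}"
  shows "isotopic g h"
proof -
  have sc: "simply_connected strip"
    unfolding strip_def by (intro convex_imp_simply_connected convex_Times) auto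
  have *: "homotopic_paths strip g k"
    if "path k" "path_image k \<subseteq> strip" "pathstart k = pathstart g" "pathfinish k = pathfinish g"
    for k
    using sc that assms(1) simple_path_imp_path[of g]
    unfolding simply_connected_eq_homotopic_paths curve_def by metis
  have h: "path h" "path_image h \<subseteq> strip"
    using assms(2) by (auto simp: curve_def simple_path_imp_path)
  from assms(3) consider
    "pathstart h = pathstart g" "pathfinish h = pathfinish g" |
    "pathstart h = pathfinish g" "pathfinish h = pathstart g"
    by (auto simp: doubleton_eq_iff)
  then show ?thesis
    unfolding isotopic_def using h *[of h] *[of "reversepath h"] by cases auto
qed

lemma isotopic_endpoints:
  "isotopic g h \<Longrightarrow> {pathstart g, pathfinish g} = {pathstart h, pathfinish h}"
  by (auto simp: isotopic_def dest: homotopic_paths_imp_pathstart homotopic_paths_imp_pathfinish)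

lemma inj_pos: "inj pos"
proof (rule injI)
  fix p q assume "pos p = pos q" then show "p = q" by (cases p; cases q) auto
qed

lemma arc_eqI:
  assumes "\<alpha> \<in> arcs M" "\<beta> \<in> arcs M'" "ends \<alpha> = ends \<beta>"
  shows "\<alpha> = \<beta>"
proof -
  have class_eq: "{h. curve N h \<and> isotopic g h} =
      {h. simple_path h \<and> path_image h \<subseteq> strip \<and> h ` {0<..<1} \<subseteq> UNIV \<times> {0<..<1} \<and>
          {pathstart h, pathfinish h} = pos ` ends {h. curve N h \<and> isotopic g h}}"
    if g: "curve N g" for N g
  proof -
    have "curve N h \<and> isotopic g h \<longleftrightarrow> simple_path h \<and> path_image h \<subseteq> strip \<and>
        h ` {0<..<1} \<subseteq> UNIV \<times> {0<..<1} \<and> {pathstart h, pathfinish h} = {pathstart g, pathfinish g}"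
      for h
    proof (intro iffI)
      assume "curve N h \<and> isotopic g h"
      then show "simple_path h \<and> path_image h \<subseteq> strip \<and> h ` {0<..<1} \<subseteq> UNIV \<times> {0<..<1} \<and>
          {pathstart h, pathfinish h} = {pathstart g, pathfinish g}"
        using isotopic_endpoints[of g h] by (simp add: curve_def)
    next
      assume h: "simple_path h \<and> path_image h \<subseteq> strip \<and>
        h ` {0<..<1} \<subseteq> UNIV \<times> {0<..<1} \<and> {pathstart h, pathfinish h} = {pathstart g, pathfinish g}"
      then have "pathstart h \<in> {pathstart g, pathfinish g}" "pathfinish h \<in> {pathstart g, pathfinish g}"
        by blast+
      with h g have "curve N h" by (auto simp: curve_def)
      with g h show "curve N h \<and> isotopic g h" using isotopicI[of N g h] by simp
    qed
    moreover have "pos ` ends {h. curve N h \<and> isotopic g h} = {pathstart g, pathfinish g}"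
    proof
      show "pos ` ends {h. curve N h \<and> isotopic g h} \<subseteq> {pathstart g, pathfinish g}"
        using isotopic_endpoints by (fastforce simp: ends_def)
      have "curve N g \<and> isotopic g g" using g isotopicI by blast
      moreover obtain p q where "pathstart g = pos p" "pathfinish g = pos q"
        using g by (auto simp: curve_def)
      ultimately have "p \<in> ends {h. curve N h \<and> isotopic g h}" "q \<in> ends {h. curve N h \<and> isotopic g h}"
        unfolding ends_def by force+
      then show "{pathstart g, pathfinish g} \<subseteq> pos ` ends {h. curve N h \<and> isotopic g h}"
        using \<open>pathstart g = pos p\<close> \<open>pathfinish g = pos q\<close> by blast
    qed
    ultimately show ?thesis by simp
  qed
  obtain g where g: "\<alpha> = {h. curve M h \<and> isotopic g h}" "curve M g"
    using assms(1) by (auto simp: arcs_def)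
  obtain g' where g': "\<beta> = {h. curve M' h \<and> isotopic g' h}" "curve M' g'"
    using assms(2) by (auto simp: arcs_def)
  show ?thesis
    using class_eq[OF g(2), folded g(1)] class_eq[OF g'(2), folded g'(1)] assms(3) by simp
qed

definition compatible :: "strip_arc \<Rightarrow> strip_arc \<Rightarrow> bool" where
  "compatible \<alpha> \<beta> \<longleftrightarrow>
     (\<exists>g\<in>\<alpha>. \<exists>h\<in>\<beta>. path_image g \<inter> path_image h
        \<subseteq> {pathstart g, pathfinish g} \<inter> {pathstart h, pathfinish h})"

definition triangulation :: "int set \<Rightarrow> strip_arc set \<Rightarrow> bool" where
  "triangulation M T \<longleftrightarrow>
     T \<subseteq> arcs M \<and> pairwise compatible T \<and>
     (\<forall>T'. T \<subseteq> T' \<and> T' \<subseteq> arcs M \<and> pairwise compatible T' \<longrightarrow> T' = T)"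

definition admissible :: "strip_arc set \<Rightarrow> bool" where
  "admissible T \<longleftrightarrow> (\<forall>i. finite {\<alpha> \<in> T. Lower i \<in> ends \<alpha>})"

definition special :: "strip_arc set \<Rightarrow> mpoint \<Rightarrow> bool" where
  "special T p \<longleftrightarrow> (\<forall>\<alpha>\<in>T. p \<notin> ends \<alpha>)"

text \<open>A triangle is given by its vertices. Since all marked points lie on the boundary of the strip,
  any three marked points that are pairwise joined by an arc of \<open>T\<close> or a boundary segment bound a
  region containing no further arc.\<close>

definition joined :: "int set \<Rightarrow> strip_arc set \<Rightarrow> mpoint \<Rightarrow> mpoint \<Rightarrow> bool" where
  "joined M T p q \<longleftrightarrow>
     consecutive M p q \<or> consecutive M q p \<or> (\<exists>\<alpha>\<in>T. ends \<alpha> = {p, q})"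

definition triangles :: "int set \<Rightarrow> strip_arc set \<Rightarrow> mpoint set set" where
  "triangles M T =
     {S. S \<subseteq> marked M \<and> card S = 3 \<and> (\<forall>p\<in>S. \<forall>q\<in>S. p \<noteq> q \<longrightarrow> joined M T p q)}"

definition Phi :: "int set \<times> strip_arc set \<Rightarrow> int \<Rightarrow> int \<Rightarrow> int" where
  "Phi = (\<lambda>(M, T). THE t. infinite_frieze t \<and>
     (\<forall>i. quiddity t i = int (card {S \<in> triangles M T. Lower i \<in> S})))"

definition Tri :: "(int set \<times> strip_arc set) set" where
  "Tri = {(M, T). triangulation M T \<and> admissible T \<and> (\<forall>u\<in>M. \<not> special T (Upper u))}"

fun relabel :: "(int \<Rightarrow> int) \<Rightarrow> mpoint \<Rightarrow> mpoint" where
  "relabel f (Lower i) = Lower i"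
| "relabel f (Upper u) = Upper (f u)"

definition order_iso :: "int set \<times> strip_arc set \<Rightarrow> int set \<times> strip_arc set \<Rightarrow> bool" where
  "order_iso = (\<lambda>(M, T) (M', T').
     \<exists>f. bij_betw f M M' \<and> mono_on M f \<and>
         T' = {\<beta> \<in> arcs M'. \<exists>\<alpha>\<in>T. ends \<beta> = relabel f ` ends \<alpha>})"

text \<open>The Dehn twist (\<open>k = 1\<close>) and its inverse (\<open>k = -1\<close>), for upper marked points
  \<open>\<int>\<close>. An admissible triangulation without special upper marked points has no peripheral arc
  on the upper boundary.\<close>

definition shift_bridging :: "int \<Rightarrow> strip_arc set \<Rightarrow> strip_arc set" where
  "shift_bridging k T =
     {\<beta> \<in> arcs UNIV. \<exists>\<alpha>\<in>T. \<exists>u j. ends \<alpha> = {Upper u, Lower j} \<and> ends \<beta> = {Upper (u + k), Lower j}}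
     \<union> {\<alpha> \<in> T. ends \<alpha> \<subseteq> range Lower}"

definition dehn_power :: "int \<Rightarrow> strip_arc set \<Rightarrow> strip_arc set" where
  "dehn_power n = (if n \<ge> 0 then shift_bridging 1 ^^ nat n else shift_bridging (-1) ^^ nat (- n))"

definition dehn_equiv :: "int set \<times> strip_arc set \<Rightarrow> int set \<times> strip_arc set \<Rightarrow> bool" where
  "dehn_equiv = (\<lambda>(M, T) (M', T'). M = UNIV \<and> M' = UNIV \<and> (\<exists>n. T' = dehn_power n T))"

text \<open>The equivalence relation on \<open>Tri\<close> generated by the two identifications.\<close>

definition Tri_equiv :: "((int set \<times> strip_arc set) \<times> (int set \<times> strip_arc set)) set" where
  "Tri_equiv = {(x, y). x \<in> Tri \<and> y \<in> Tri \<and>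
     equivclp (\<lambda>x y. x \<in> Tri \<and> y \<in> Tri \<and> (order_iso x y \<or> dehn_equiv x y)) x y}"

lemma equiv_Tri: "equiv Tri Tri_equiv"
  unfolding Tri_equiv_def
  by (auto intro!: equivI refl_onI symI transI elim: equivclp_sym equivclp_trans)

end

theory Submission imports Defs begin

text \<open>Arcs are encoded by their endpoints, and two arcs are compatible iff their endpoints do not
  interlace on the boundary. An infinite frieze \<open>t\<close> satisfies the Pluecker relations, so its entries
  \<open>t i j = 1\<close> with \<open>i + 2 \<le> j\<close> form a noncrossing family, and they turn out to be exactly the
  peripheral arcs of any triangulation \<open>T\<close> with \<open>Phi T = t\<close>. The remaining data of \<open>T\<close> are the fans
  of bridging arcs at the outer lower points, those not below a peripheral arc. A fan with \<open>d\<close> arcs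
  contributes \<open>d + 1\<close> triangles, so the quiddity sequence determines all fan sizes; neighbouring
  fans share one upper point, so the upper points and bridging arcs are determined up to an
  order-preserving relabelling. Conversely, positivity of \<open>Phi T\<close> follows by comparison with a
  positive supersolution of the recurrence that equals 1 at the outer points.\<close>

subsection \<open>Arcs as pairs of marked points\<close>

text \<open>Topology is confined to \<open>arc_ends\<close>, \<open>arc_exists\<close> and
  \<open>compatible_iff\<close>; afterwards a face is just three pairwise joined points, and
  \<open>joined_successive\<close> does the work of walking around faces. The obstacle is that
  \<open>Phi\<close> is a definite description. An array with prescribed quiddity always exists by
  linear algebra, but its positivity depends on the whole infinite triangulation. Two regimes occur.
  If no lower point is outer, every finite interval lies below a peripheral arc and a finite polygon
  decides. If some lower point is outer, the comparison function exists because each outer point has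
  a nonempty fan: d >= 1 bridging arcs give d + 1 >= 2 triangles beyond \<open>deg k\<close>, which
  is the bound \<open>deg k + 2\<close>, whereas a covered point has exactly one triangle beyond
  \<open>deg k\<close>. The same comparison gives entries at least 2 across an outer point, so
  entries 1 never cross a bridging arc. For the converse, the nontrivial fact about a frieze is
  \<open>frieze_apex\<close>: the region below an entry 1 is itself triangulated by entries 1.
  Injectivity compares each triangulation with one normal form built from its frieze; a Dehn twist
  is a relabelling by a translation.\<close>

definition half_plane :: "real \<times> real \<Rightarrow> real \<times> real" where
  "half_plane p = (exp (pi * fst p) * cos (pi * snd p), exp (pi * fst p) * sin (pi * snd p))"

text \<open>Polar coordinates: logarithm of the modulus and argument, both divided by pi. The origin
  stands for the left end of the strip, hence the hypotheses \<open>z \<noteq> (0, 0)\<close>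
  below.\<close>

definition half_plane_inv :: "real \<times> real \<Rightarrow> real \<times> real" where
  "half_plane_inv z =
     (ln (sqrt ((fst z)\<^sup>2 + (snd z)\<^sup>2)) / pi, arccos (fst z / sqrt ((fst z)\<^sup>2 + (snd z)\<^sup>2)) / pi)"

text \<open>The coordinate of a marked point on the real line bounding the half plane. Increasing
  keys run through the upper points from right to left and then through the lower points from left
  to right, so they list the boundary in cyclic order.\<close>

fun key :: "mpoint \<Rightarrow> real" where
  "key (Lower i) = exp (pi * of_int i)"
| "key (Upper u) = - exp (pi * of_int u)"

lemma key_less [simp]:
  "key (Lower i) < key (Lower j) \<longleftrightarrow> i < j"
  "key (Upper u) < key (Upper v) \<longleftrightarrow> v < u"
  "key (Upper u) < key (Lower i)"
  "\<not> key (Lower i) < key (Upper u)"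
proof -
  show "key (Upper u) < key (Lower i)"
    using exp_gt_zero[of "pi * of_int u"] exp_gt_zero[of "pi * of_int i"] by (simp del: exp_gt_zero)
  then show "\<not> key (Lower i) < key (Upper u)" by simp
qed auto

lemma key_le [simp]:
  "key (Lower i) \<le> key (Lower j) \<longleftrightarrow> i \<le> j"
  "key (Upper u) \<le> key (Upper v) \<longleftrightarrow> v \<le> u"
  "key (Upper u) \<le> key (Lower i)"
  "\<not> key (Lower i) \<le> key (Upper u)"
  by (simp_all add: not_less[symmetric] less_imp_le del: key.simps)

lemma key_inject [simp]: "key p = key q \<longleftrightarrow> p = q"
proof
  assume "key p = key q"
  then have "\<not> key p < key q" "\<not> key q < key p" by auto
  then show "p = q" by (cases p; cases q) (auto simp del: key.simps)
qed simp

lemma key_nonzero [simp]: "key p \<noteq> 0"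
  by (cases p) auto

lemma half_plane_pos [simp]: "half_plane (pos p) = (key p, 0)"
  by (cases p) (auto simp: half_plane_def)

lemma half_plane_inv_half_plane:
  assumes "p \<in> strip" shows "half_plane_inv (half_plane p) = p"
proof -
  have "(exp (pi * fst p) * cos (pi * snd p))\<^sup>2 + (exp (pi * fst p) * sin (pi * snd p))\<^sup>2
      = (exp (pi * fst p))\<^sup>2 * ((cos (pi * snd p))\<^sup>2 + (sin (pi * snd p))\<^sup>2)"
    by (simp only: power_mult_distrib distrib_left)
  then have *: "sqrt ((exp (pi * fst p) * cos (pi * snd p))\<^sup>2 + (exp (pi * fst p) * sin (pi * snd p))\<^sup>2)
      = exp (pi * fst p)" by simp
  have "0 \<le> snd p" "snd p \<le> 1" using assms by (auto simp: strip_def)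
  then have "arccos (cos (pi * snd p)) = pi * snd p"
    by (intro arccos_cos) (auto simp: mult_le_cancel_left1)
  then show ?thesis
    unfolding half_plane_inv_def half_plane_def fst_conv snd_conv * by (cases p) simp
qed

lemma half_plane_half_plane_inv:
  assumes "snd z \<ge> 0" "z \<noteq> (0, 0)" shows "half_plane (half_plane_inv z) = z"
proof -
  obtain x y where z: "z = (x, y)" by (cases z)
  define r where "r = sqrt (x\<^sup>2 + y\<^sup>2)"
  have r: "r > 0" "r\<^sup>2 = x\<^sup>2 + y\<^sup>2"
    using assms(2) unfolding r_def z by (auto simp: sum_power2_gt_zero_iff)
  have "\<bar>x\<bar> \<le> r" unfolding r_def by (simp add: real_le_rsqrt)
  then have x: "-1 \<le> x / r" "x / r \<le> 1" using r by (auto simp: field_simps abs_le_iff)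
  have "(x/r)\<^sup>2 + (y/r)\<^sup>2 = r\<^sup>2 / r\<^sup>2"
    by (simp only: r(2) power_divide add_divide_distrib)
  then have "1 - (x/r)\<^sup>2 = (y/r)\<^sup>2" using r(1) by simp
  then have "sqrt (1 - (x/r)\<^sup>2) = y / r" using assms(1) r by (simp add: z)
  then show ?thesis
    using r x by (simp add: half_plane_def half_plane_inv_def z flip: r_def)
      (simp add: sin_arccos)
qed

lemma pos_in_strip [simp]: "pos p \<in> strip"
  by (cases p) (auto simp: strip_def)

lemma half_plane_inv_key [simp]: "half_plane_inv (key p, 0) = pos p"
  by (metis half_plane_inv_half_plane half_plane_pos pos_in_strip)

lemma continuous_on_half_plane: "continuous_on S half_plane"
  unfolding half_plane_def by (intro continuous_intros)

lemma abs_fst_le_norm: "\<bar>fst z\<bar> \<le> sqrt ((fst z)\<^sup>2 + (snd z)\<^sup>2)" for z :: "real \<times> real"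
  by (simp add: real_le_rsqrt)

lemma continuous_on_half_plane_inv: "continuous_on (- {(0, 0)}) half_plane_inv"
proof -
  have "(fst z)\<^sup>2 + (snd z)\<^sup>2 > 0" if "z \<in> - {(0, 0)}" for z :: "real \<times> real"
    using that by (cases z) (auto simp: sum_power2_gt_zero_iff)
  moreover from this have "- 1 \<le> fst z / sqrt ((fst z)\<^sup>2 + (snd z)\<^sup>2) \<and> fst z / sqrt ((fst z)\<^sup>2 + (snd z)\<^sup>2) \<le> 1"
    if "z \<in> - {(0, 0)}" for z :: "real \<times> real"
    using that abs_fst_le_norm[of z] by (auto simp: abs_le_iff field_simps)
  ultimately show ?thesis
    unfolding half_plane_inv_def by (intro continuous_intros) (auto simp: less_imp_neq[symmetric])
qed

lemma half_plane_inv_in_strip: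
  assumes "z \<noteq> (0, 0)" shows "half_plane_inv z \<in> strip"
proof -
  have "(fst z)\<^sup>2 + (snd z)\<^sup>2 > 0"
    using assms by (cases z) (auto simp: sum_power2_gt_zero_iff)
  then have "- 1 \<le> fst z / sqrt ((fst z)\<^sup>2 + (snd z)\<^sup>2)" "fst z / sqrt ((fst z)\<^sup>2 + (snd z)\<^sup>2) \<le> 1"
    using abs_fst_le_norm[of z] by (auto simp: abs_le_iff field_simps)
  then show ?thesis
    using arccos_lbound arccos_ubound by (auto simp: half_plane_inv_def strip_def)
qed

lemma half_plane_inv_interior:
  assumes "snd z > 0" shows "half_plane_inv z \<in> UNIV \<times> {0<..<1}"
proof -
  define w where "w = half_plane_inv z"
  have z: "z \<noteq> (0, 0)" using assms by auto
  have "half_plane w = z" unfolding w_def using assms z by (intro half_plane_half_plane_inv) auto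
  then have "snd w \<noteq> 0" "snd w \<noteq> 1" using assms by (auto simp: half_plane_def)
  moreover have "w \<in> strip" unfolding w_def by (rule half_plane_inv_in_strip[OF z])
  ultimately show ?thesis unfolding w_def by (cases "half_plane_inv z") (auto simp: strip_def)
qed

text \<open>The conformal map \<open>z \<mapsto> exp (\<pi> z)\<close> carries the strip to the closed upper half plane and all
  marked points to the real line, where crossing arcs have interlaced endpoints.\<close>

lemma interlaced_paths_meet:
  assumes g: "path g" "path_image g \<subseteq> strip" and h: "path h" "path_image h \<subseteq> strip"
    and "pathstart g = pos p" "pathfinish g = pos q" "pathstart h = pos r" "pathfinish h = pos s"
    and "key p < key r" "key r < key q" "key q < key s"
  shows "path_image g \<inter> path_image h \<noteq> {}"
proof -
  define \<phi> :: "real \<times> real \<Rightarrow> real^2"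
    where "\<phi> z = (\<chi> i. if i = 1 then fst (half_plane z) else snd (half_plane z))" for z
  have \<phi>1: "\<phi> z $ 1 = fst (half_plane z)" and \<phi>2: "\<phi> z $ 2 = snd (half_plane z)" for z
    by (auto simp: \<phi>_def)
  have comp: "continuous_on S (\<lambda>z. if i = 1 then fst (half_plane z) else snd (half_plane z))"
    for S and i :: 2
    by (cases "i = 1") (auto intro!: continuous_intros continuous_on_half_plane)
  have cont: "continuous_on S \<phi>" for S
    unfolding \<phi>_def by (intro continuous_on_vec_lambda comp)
  have paths: "path (\<phi> \<circ> g)" "path (\<phi> \<circ> h)"
    using g(1) h(1) cont by (auto intro: path_continuous_image)
  have "bounded (path_image (\<phi> \<circ> g) \<union> path_image (\<phi> \<circ> h))"
    using paths by (auto intro: bounded_path_image)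
  then obtain b where b: "path_image (\<phi> \<circ> g) \<union> path_image (\<phi> \<circ> h) \<subseteq> cbox (- b) b"
    using bounded_subset_cbox_symmetric by blast
  \<comment> \<open>The box is cut off at height 0, so that the four endpoints lie on its bottom
    edge as \<open>fashoda_interlace\<close> requires.\<close>
  define a :: "real^2" where "a = (\<chi> i. if i = 1 then (- b) $ 1 else 0)"
  have nn: "snd (half_plane z) \<ge> 0" if "z \<in> strip" for z
    using that by (auto simp: half_plane_def strip_def sin_ge_zero mult_le_cancel_left1)
  have sub: "path_image (\<phi> \<circ> k) \<subseteq> cbox a b"
    if "path_image (\<phi> \<circ> k) \<subseteq> cbox (-b) b" "path_image k \<subseteq> strip" for k
  proof
    fix w assume w: "w \<in> path_image (\<phi> \<circ> k)"
    then have "w \<in> cbox (- b) b" using that by blast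
    moreover have "w $ 2 \<ge> 0" using w that(2) nn by (auto simp: path_image_compose \<phi>2)
    ultimately show "w \<in> cbox a b" by (auto simp: mem_box_cart a_def forall_2)
  qed
  obtain w where "w \<in> path_image (\<phi> \<circ> g)" "w \<in> path_image (\<phi> \<circ> h)"
  proof (rule fashoda_interlace[OF paths, of a b])
    show "path_image (\<phi> \<circ> g) \<subseteq> cbox a b" "path_image (\<phi> \<circ> h) \<subseteq> cbox a b"
      using sub b g h by auto
  qed (use assms in \<open>auto simp: pathstart_compose pathfinish_compose \<phi>1 \<phi>2 a_def\<close>)
  then obtain x y where xy: "x \<in> path_image g" "y \<in> path_image h" "\<phi> x = \<phi> y"
    by (auto simp: path_image_compose)
  then have "half_plane x = half_plane y"
    by (metis \<phi>1 \<phi>2 prod_eqI)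
  moreover have "x \<in> strip" "y \<in> strip" using xy g h by auto
  ultimately have "x = y" by (metis half_plane_inv_half_plane)
  then show ?thesis using xy by auto
qed

text \<open>The minimum and maximum make the notion independent of the order within each pair. The
  strict inequalities keep pairs with a common endpoint noncrossing, as in
  \<open>compatible\<close>.\<close>

definition crossing :: "mpoint \<Rightarrow> mpoint \<Rightarrow> mpoint \<Rightarrow> mpoint \<Rightarrow> bool" where
  "crossing p q r s \<longleftrightarrow>
     (let a = min (key p) (key q); b = max (key p) (key q) in
       a < key r \<and> key r < b \<and> (key s < a \<or> b < key s) \<or>
       a < key s \<and> key s < b \<and> (key r < a \<or> b < key r))"

lemma crossing_swap:
  "crossing q p r s \<longleftrightarrow> crossing p q r s"
  "crossing p q s r \<longleftrightarrow> crossing p q r s"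
  by (auto simp: crossing_def min.commute max.commute Let_def)

lemma crossing_commute: "crossing r s p q \<longleftrightarrow> crossing p q r s"
  by (auto simp: crossing_def Let_def min_def max_def)

lemma crossing_wlog:
  assumes "crossing p q r s"
  obtains p' q' r' s' where "{p, q} = {p', q'}" "{r, s} = {r', s'}"
    "key p' < key r'" "key r' < key q'" "key q' < key s'"
  | p' q' r' s' where "{p, q} = {p', q'}" "{r, s} = {r', s'}"
    "key r' < key p'" "key p' < key s'" "key s' < key q'"
proof -
  define p' q' where "p' = (if key p < key q then p else q)" "q' = (if key p < key q then q else p)"
  define r' s' where "r' = (if key r < key s then r else s)" "s' = (if key r < key s then s else r)"
  have sets: "{p, q} = {p', q'}" "{r, s} = {r', s'}" by (auto simp: p'_q'_def r'_s'_def)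
  have "(key p' < key r' \<and> key r' < key q' \<and> key q' < key s') \<or>
        (key r' < key p' \<and> key p' < key s' \<and> key s' < key q')"
    using assms unfolding crossing_def Let_def p'_q'_def r'_s'_def
    by (cases "key p < key q"; cases "key r < key s"; simp add: min_def max_def not_less; linarith)
  then show ?thesis using that sets by blast
qed

lemma crossing_distinct: "crossing p q r s \<Longrightarrow> {p, q} \<inter> {r, s} = {}"
  by (auto simp: crossing_def Let_def min_def max_def split: if_splits)

lemma path_oriented:
  assumes "{pathstart g, pathfinish g} = {a, b}" "path g"
  obtains g' where "path g'" "path_image g' = path_image g" "pathstart g' = a" "pathfinish g' = b"
proof -
  from assms(1) consider "pathstart g = a" "pathfinish g = b" | "pathstart g = b" "pathfinish g = a"
    by (auto simp: doubleton_eq_iff)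
  then show ?thesis
  proof cases
    case 1 then show ?thesis using that[of g] assms(2) by auto
  next
    case 2 then show ?thesis using that[of "reversepath g"] assms(2) by auto
  qed
qed

lemma crossing_paths_meet:
  assumes "path g" "path_image g \<subseteq> strip" "path h" "path_image h \<subseteq> strip"
    and "{pathstart g, pathfinish g} = pos ` {p, q}" "{pathstart h, pathfinish h} = pos ` {r, s}"
    and "crossing p q r s"
  shows "path_image g \<inter> path_image h \<noteq> {}"
proof -
  have main: "path_image g \<inter> path_image h \<noteq> {}"
    if H: "path g" "path_image g \<subseteq> strip" "path h" "path_image h \<subseteq> strip"
      "{pathstart g, pathfinish g} = pos ` {p, q}" "{pathstart h, pathfinish h} = pos ` {r, s}"
      "key p < key r" "key r < key q" "key q < key s" for g h p q r s
  proof -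
    obtain g' where g': "path g'" "path_image g' = path_image g" "pathstart g' = pos p" "pathfinish g' = pos q"
      by (rule path_oriented[of g "pos p" "pos q"]) (use H in auto)
    obtain h' where h': "path h'" "path_image h' = path_image h" "pathstart h' = pos r" "pathfinish h' = pos s"
      by (rule path_oriented[of h "pos r" "pos s"]) (use H in auto)
    show ?thesis using interlaced_paths_meet[OF g'(1) _ h'(1) _ g'(3,4) h'(3,4)] H g'(2) h'(2) by simp
  qed
  from assms(7) show ?thesis
  proof (cases rule: crossing_wlog)
    case (1 p' q' r' s')
    then show ?thesis using main[of g h p' q' r' s'] assms by simp
  next
    case (2 p' q' r' s')
    then show ?thesis using main[of h g r' s' p' q'] assms by (simp add: Int_commute)
  qed
qed

text \<open>In the half plane this is the parabola y = (x - key p) * (key q - x). All these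
  parabolas have the same quadratic term, so two of them differ by a linear function and their
  intersections are easy to control.\<close>

definition chord_path :: "mpoint \<Rightarrow> mpoint \<Rightarrow> real \<Rightarrow> real \<times> real" where
  "chord_path p q t = half_plane_inv (key p + t * (key q - key p), (key q - key p)\<^sup>2 * (t * (1 - t)))"

text \<open>Height 0 occurs only for t = 0 and t = 1, where the first coordinate is a key and hence
  nonzero. The curve thus stays where \<open>half_plane_inv\<close> is continuous.\<close>

lemma chord_path_nonzero:
  assumes "p \<noteq> q" shows "(key p + t * (key q - key p), (key q - key p)\<^sup>2 * (t * (1 - t))) \<noteq> (0, 0)"
proof
  assume *: "(key p + t * (key q - key p), (key q - key p)\<^sup>2 * (t * (1 - t))) = (0, 0)"
  then have "t = 0 \<or> t = 1" using assms by auto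
  then show False using * by auto
qed

lemma half_plane_chord_path:
  assumes "p \<noteq> q" "t \<in> {0..1}"
  shows "half_plane (chord_path p q t) = (key p + t * (key q - key p), (key q - key p)\<^sup>2 * (t * (1 - t)))"
  unfolding chord_path_def
  using assms by (intro half_plane_half_plane_inv chord_path_nonzero) auto

lemma chord_path_ends [simp]:
  "pathstart (chord_path p q) = pos p" "pathfinish (chord_path p q) = pos q"
  by (auto simp: chord_path_def pathstart_def pathfinish_def)

lemma curve_chord_path:
  assumes "p \<in> marked M" "q \<in> marked M" "p \<noteq> q"
  shows "curve M (chord_path p q)"
proof -
  have "path (chord_path p q)"
    unfolding path_def chord_path_def
    by (rule continuous_on_compose2[OF continuous_on_half_plane_inv])
      (use chord_path_nonzero[OF assms(3)] in \<open>auto intro!: continuous_intros\<close>)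
  moreover have "inj_on (chord_path p q) {0..1}"
  proof (rule inj_onI)
    fix s t :: real assume "s \<in> {0..1}" "t \<in> {0..1}" "chord_path p q s = chord_path p q t"
    then have "key p + s * (key q - key p) = key p + t * (key q - key p)"
      using half_plane_chord_path[OF assms(3)] by (metis prod.inject)
    then show "s = t" using assms(3) by simp
  qed
  ultimately have "arc (chord_path p q)" by (simp add: arc_def)
  moreover have "path_image (chord_path p q) \<subseteq> strip"
    unfolding path_image_def chord_path_def
    using half_plane_inv_in_strip[OF chord_path_nonzero[OF assms(3)]] by auto
  moreover have "chord_path p q ` {0<..<1} \<subseteq> UNIV \<times> {0<..<1}"
  proof (rule image_subsetI)
    fix t :: real assume "t \<in> {0<..<1}"
    then show "chord_path p q t \<in> UNIV \<times> {0<..<1}"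
      unfolding chord_path_def using assms(3) by (intro half_plane_inv_interior) auto
  qed
  ultimately show ?thesis
    using assms(1,2) by (auto simp: curve_def arc_imp_simple_path)
qed

lemma half_plane_chord_path_image:
  assumes "p \<noteq> q" "z \<in> path_image (chord_path p q)" "(x, y) = half_plane z"
  shows "y = (x - key p) * (key q - x)" "y \<ge> 0"
proof -
  obtain t where t: "t \<in> {0..1}" "z = chord_path p q t" using assms(2) by (auto simp: path_image_def)
  have xy: "x = key p + t * (key q - key p)" "y = (key q - key p)\<^sup>2 * (t * (1 - t))"
    using assms(3) half_plane_chord_path[OF assms(1) t(1)] unfolding t(2) by simp_all
  show "y = (x - key p) * (key q - x)"
    unfolding xy power2_eq_square by (simp add: algebra_simps)
  show "y \<ge> 0" unfolding xy(2) using t(1) by auto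
qed

text \<open>Nonnegative height puts x into both intervals. For intervals side by side this leaves
  one point; for nested ones the outer parabola exceeds the inner one by (c - a) * (b - x) + (x - c)
  * (b - d), a sum of nonnegative terms that cannot both vanish strictly inside the inner
  interval.\<close>

lemma parabolas_meet:
  fixes a b c d x :: real
  assumes "a < b" "c < d" "(x - a) * (b - x) = (x - c) * (d - x)" "(x - a) * (b - x) \<ge> 0"
    and "b \<le> c \<or> a \<le> c \<and> d \<le> b" "a \<noteq> c \<or> b \<noteq> d"
  shows "x \<in> {a, b} \<inter> {c, d}"
proof -
  have in1: "a \<le> x \<and> x \<le> b" 
    using assms(1) zero_le_mult_iff[THEN iffD1, OF assms(4)] by linarith
  have in2: "c \<le> x \<and> x \<le> d"
    using assms(2) zero_le_mult_iff[THEN iffD1, OF assms(4)[unfolded assms(3)]] by linarith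
  show ?thesis
  proof (cases "b \<le> c")
    case True then show ?thesis using in1 in2 by auto
  next
    case False
    then have nest: "a \<le> c" "d \<le> b" using assms(5) by auto
    show ?thesis
    proof (cases "x = c \<or> x = d")
      case True
      then have "(x - c) * (d - x) = 0" by auto
      then have "(x - a) * (b - x) = 0" using assms(3) by (rule trans[rotated])
      then have "x = a \<or> x = b" by auto
      then show ?thesis using True by auto
    next
      case False
      then have "c < x" "x < d" using in2 by auto
      moreover have "(x - a) * (b - x) = (x - c) * (d - x) + (c - a) * (b - x) + (x - c) * (b - d)"
        by (simp add: algebra_simps)
      ultimately have "(c - a) * (b - x) + (x - c) * (b - d) = 0" using assms(3) by linarith
      moreover have "(c - a) * (b - x) \<ge> 0" "(x - c) * (b - d) \<ge> 0" using nest in1 in2 by auto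
      ultimately have "(c - a) * (b - x) = 0" "(x - c) * (b - d) = 0" by linarith+
      then show ?thesis using \<open>c < x\<close> \<open>x < d\<close> nest assms(6) by auto
    qed
  qed
qed

lemma noncrossing_chord_paths:
  assumes "p \<noteq> q" "r \<noteq> s" "{p, q} \<noteq> {r, s}" "\<not> crossing p q r s"
  shows "path_image (chord_path p q) \<inter> path_image (chord_path r s) \<subseteq> pos ` {p, q} \<inter> pos ` {r, s}"
proof
  fix z assume z: "z \<in> path_image (chord_path p q) \<inter> path_image (chord_path r s)"
  obtain x y where xy: "half_plane z = (x, y)" by fastforce
  have eq: "y = (x - key p) * (key q - x)" "y = (x - key r) * (key s - x)" "y \<ge> 0"
    using half_plane_chord_path_image[OF assms(1) _ xy[symmetric]]
      half_plane_chord_path_image[OF assms(2) _ xy[symmetric]] z by blast+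
  define a b where "a = min (key p) (key q)" "b = max (key p) (key q)"
  define c d where "c = min (key r) (key s)" "d = max (key r) (key s)"
  note defs = a_b_def c_d_def
  have lt: "a < b" "c < d" using assms(1,2) by (auto simp: defs min_def max_def less_le)
  have swap: "(x - v) * (u - x) = (x - u) * (v - x)" for u v :: real by (simp add: algebra_simps)
  have "(x - a) * (b - x) = (x - key p) * (key q - x)" "(x - c) * (d - x) = (x - key r) * (key s - x)"
    unfolding defs min_def max_def by (auto intro: swap)
  then have eq': "(x - a) * (b - x) = y" "(x - c) * (d - x) = y"
    using eq by simp_all
  have ne: "a \<noteq> c \<or> b \<noteq> d"
    using assms(3) by (auto simp: defs min_def max_def doubleton_eq_iff split: if_splits)
  have nc: "\<not> (a < c \<and> c < b \<and> b < d)" "\<not> (c < a \<and> a < d \<and> d < b)"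
    using assms(4) unfolding crossing_def Let_def defs
    by (cases "key p < key q"; cases "key r < key s"; simp add: min_def max_def not_less; linarith)+
  \<comment> \<open>Noncrossing intervals lie side by side or are nested; the second alternative is
    the first with the two pairs exchanged.\<close>
  consider "b \<le> c \<or> a \<le> c \<and> d \<le> b" | "d \<le> a \<or> c \<le> a \<and> b \<le> d"
    using lt nc by linarith
  then have "x \<in> {a, b} \<inter> {c, d}"
  proof cases
    case 1
    show ?thesis
      by (rule parabolas_meet) (use 1 lt eq' eq(3) ne in simp_all)
  next
    case 2
    have "x \<in> {c, d} \<inter> {a, b}"
      by (rule parabolas_meet) (use 2 lt eq' eq(3) ne in auto)
    then show ?thesis by simp
  qed
  then have x: "x \<in> key ` {p, q}" "x \<in> key ` {r, s}"
    by (auto simp: defs min_def max_def split: if_splits)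
  have "y = 0" unfolding eq(1) using x(1) by auto
  have "z \<in> strip"
    using z curve_chord_path[of p "UNIV" q] half_plane_inv_in_strip[OF chord_path_nonzero[OF assms(1)]]
    by (auto simp: path_image_def chord_path_def)
  then have "z = half_plane_inv (x, 0)"
    using half_plane_inv_half_plane xy \<open>y = 0\<close> by metis
  then show "z \<in> pos ` {p, q} \<inter> pos ` {r, s}" using x by auto
qed

section \<open>Arcs of the strip as pairs of endpoints\<close>

definition chord :: "int set \<Rightarrow> mpoint \<Rightarrow> mpoint \<Rightarrow> bool" where
  "chord M p q \<longleftrightarrow> p \<in> marked M \<and> q \<in> marked M \<and> p \<noteq> q \<and> \<not> consecutive M p q \<and> \<not> consecutive M q p"

lemma pos_inject [simp]: "pos p = pos q \<longleftrightarrow> p = q"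
  using inj_pos by (auto simp: inj_def)

lemma isotopic_class_ends:
  assumes "curve M g" "pathstart g = pos p" "pathfinish g = pos q"
  shows "ends {h. curve M h \<and> isotopic g h} = {p, q}"
proof
  show "ends {h. curve M h \<and> isotopic g h} \<subseteq> {p, q}"
    using isotopic_endpoints assms by (fastforce simp: ends_def doubleton_eq_iff)
  have "isotopic g g" using isotopicI[OF assms(1,1)] by simp
  then show "{p, q} \<subseteq> ends {h. curve M h \<and> isotopic g h}"
    using assms by (auto simp: ends_def)
qed

lemma simply_connected_strip: "simply_connected strip"
  unfolding strip_def by (intro convex_imp_simply_connected convex_Times) auto

lemma strip_linepath: "a \<in> strip \<Longrightarrow> b \<in> strip \<Longrightarrow> path_image (linepath a b) \<subseteq> strip"
  unfolding path_image_linepath strip_def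
  by (intro closed_segment_subset) (auto intro!: convex_Times)

text \<open>Simple connectedness makes a loop contractible and identifies a curve between
  consecutive marked points with the boundary segment, so both exclusions in \<open>arcs\<close>
  become conditions on endpoints.\<close>

lemma arc_ends:
  assumes "\<alpha> \<in> arcs M"
  obtains p q where "chord M p q" "ends \<alpha> = {p, q}"
proof -
  obtain g where g: "\<alpha> = {h. curve M h \<and> isotopic g h}" "curve M g"
      "\<not> contractible_curve g" "\<not> boundary_segment M g"
    using assms by (auto simp: arcs_def)
  then obtain p q where pq: "p \<in> marked M" "q \<in> marked M" "pathstart g = pos p" "pathfinish g = pos q"
    by (auto simp: curve_def)
  have path: "path g" "path_image g \<subseteq> strip" using g(2) by (auto simp: curve_def simple_path_imp_path)
  have hom: "homotopic_paths strip g h"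
    if "path h" "path_image h \<subseteq> strip" "pathstart h = pos p" "pathfinish h = pos q" for h
    using simply_connected_strip that path pq
    unfolding simply_connected_eq_homotopic_paths by metis
  have "p \<noteq> q"
  proof
    assume "p = q"
    then have "contractible_curve g"
      unfolding contractible_curve_def pq
      by (intro hom) (auto simp: path_def pathstart_def pathfinish_def path_image_def)
    then show False using g by simp
  qed
  moreover have "\<not> consecutive M p q"
  proof
    assume "consecutive M p q"
    moreover have "isotopic g (linepath (pos p) (pos q))"
      unfolding isotopic_def by (intro disjI1 hom) (use strip_linepath in simp_all)
    ultimately show False using g(4) by (auto simp: boundary_segment_def)
  qed
  moreover have "\<not> consecutive M q p"
  proof
    assume "consecutive M q p"
    moreover have "isotopic g (linepath (pos q) (pos p))"
      unfolding isotopic_def by (intro disjI2 hom) (use strip_linepath in simp_all)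
    ultimately show False using g(4) by (auto simp: boundary_segment_def)
  qed
  ultimately have "chord M p q" using pq by (simp add: chord_def)
  moreover have "ends \<alpha> = {p, q}" using isotopic_class_ends g pq by simp
  ultimately show ?thesis using that by blast
qed

text \<open>With \<open>arc_ends\<close> and \<open>arc_eqI\<close> this identifies arcs with
  unordered chords. The explicit representative is kept for the compatibility proof.\<close>

lemma arc_exists:
  assumes "chord M p q"
  obtains \<alpha> where "\<alpha> \<in> arcs M" "ends \<alpha> = {p, q}" "chord_path p q \<in> \<alpha>"
proof
  let ?g = "chord_path p q"
  have c: "curve M ?g" using assms by (intro curve_chord_path) (auto simp: chord_def)
  have "\<not> contractible_curve ?g"
    using assms homotopic_paths_imp_pathfinish[of strip ?g "\<lambda>_. pos p"]
    by (auto simp: contractible_curve_def chord_def) (simp add: pathfinish_def)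
  moreover have "\<not> boundary_segment M ?g"
  proof
    assume "boundary_segment M ?g"
    then obtain r s where "consecutive M r s" "{pos p, pos q} = {pos r, pos s}"
      by (auto simp: boundary_segment_def dest!: isotopic_endpoints)
    then show False using assms by (auto simp: chord_def doubleton_eq_iff)
  qed
  ultimately show "{h. curve M h \<and> isotopic ?g h} \<in> arcs M" using c by (auto simp: arcs_def)
  show "ends {h. curve M h \<and> isotopic ?g h} = {p, q}" by (rule isotopic_class_ends[OF c]) auto
  show "?g \<in> {h. curve M h \<and> isotopic ?g h}" using c isotopicI[OF c c] by simp
qed

text \<open>Crossing pairs have four distinct endpoints, so compatible representatives would be
  disjoint, against \<open>crossing_paths_meet\<close>. Noncrossing pairs are realised by their
  parabolas, which are two different curves because
  \<open>\<alpha> \<noteq> \<beta>\<close>.\<close>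

lemma compatible_iff:
  assumes "\<alpha> \<in> arcs M" "\<beta> \<in> arcs M" "ends \<alpha> = {p, q}" "ends \<beta> = {r, s}" "\<alpha> \<noteq> \<beta>"
  shows "compatible \<alpha> \<beta> \<longleftrightarrow> \<not> crossing p q r s"
proof
  have rep: "path g \<and> path_image g \<subseteq> strip \<and> {pathstart g, pathfinish g} = pos ` ends \<alpha>"
    if A: "\<alpha> \<in> arcs M" "g \<in> \<alpha>" for g \<alpha>
  proof -
    obtain g0 where g0: "\<alpha> = {h. curve M h \<and> isotopic g0 h}" "curve M g0"
      using A by (auto simp: arcs_def)
    then obtain p q where pq: "pathstart g0 = pos p" "pathfinish g0 = pos q" by (auto simp: curve_def)
    then have "ends \<alpha> = {p, q}" using isotopic_class_ends g0 by simp
    then show ?thesis using that g0 pq isotopic_endpoints[of g0 g]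
      by (auto simp: curve_def simple_path_imp_path)
  qed
  assume "compatible \<alpha> \<beta>"
  then obtain g h where gh: "g \<in> \<alpha>" "h \<in> \<beta>" "path_image g \<inter> path_image h
        \<subseteq> {pathstart g, pathfinish g} \<inter> {pathstart h, pathfinish h}"
    by (auto simp: compatible_def)
  have g: "path g" "path_image g \<subseteq> strip" "{pathstart g, pathfinish g} = pos ` {p, q}"
    and h: "path h" "path_image h \<subseteq> strip" "{pathstart h, pathfinish h} = pos ` {r, s}"
    using rep[OF assms(1) gh(1)] rep[OF assms(2) gh(2)] assms by auto
  show "\<not> crossing p q r s"
  proof
    assume cr: "crossing p q r s"
    then have "pos ` {p, q} \<inter> pos ` {r, s} = {}" using crossing_distinct[OF cr] by auto
    then have "path_image g \<inter> path_image h = {}" using gh(3) g(3) h(3) by simp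
    then show False using crossing_paths_meet[OF g(1,2) h(1,2) g(3) h(3) cr] by simp
  qed
next
  have mem: "chord_path p q \<in> \<alpha> \<and> p \<noteq> q" if A: "\<alpha> \<in> arcs M" "ends \<alpha> = {p, q}" for \<alpha> p q
  proof -
    obtain p' q' where "chord M p' q'" "ends \<alpha> = {p', q'}" using A arc_ends by metis
    then have "chord M p q" using A by (auto simp: chord_def doubleton_eq_iff)
    moreover obtain \<alpha>' where "\<alpha>' \<in> arcs M" "ends \<alpha>' = {p, q}" "chord_path p q \<in> \<alpha>'"
      using arc_exists[OF \<open>chord M p q\<close>] by blast
    ultimately show ?thesis using arc_eqI A by (metis chord_def)
  qed
  assume nc: "\<not> crossing p q r s"
  have "{p, q} \<noteq> {r, s}" using assms arc_eqI by metis
  moreover have "chord_path p q \<in> \<alpha>" "p \<noteq> q" "chord_path r s \<in> \<beta>" "r \<noteq> s"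
    using mem assms by blast+
  ultimately have "path_image (chord_path p q) \<inter> path_image (chord_path r s)
      \<subseteq> pos ` {p, q} \<inter> pos ` {r, s}"
    using noncrossing_chord_paths nc by blast
  then show "compatible \<alpha> \<beta>"
    unfolding compatible_def using \<open>chord_path p q \<in> \<alpha>\<close> \<open>chord_path r s \<in> \<beta>\<close>
    by (intro bexI[of _ "chord_path p q"] bexI[of _ "chord_path r s"]) auto
qed

subsection \<open>Friezes and the Pluecker relations\<close>

text \<open>These are the relations between the 2x2 minors of a matrix with two rows and columns
  indexed by the integers (Ptolemy's relation for the diagonals of a quadrilateral). Positivity is
  kept apart: such an array exists for every quiddity sequence.\<close>

definition pluecker :: "(int \<Rightarrow> int \<Rightarrow> int) \<Rightarrow> bool" where
  "pluecker t \<longleftrightarrow> (\<forall>i j. t i j = - t j i) \<and> (\<forall>i. t i (i + 1) = 1) \<and>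
     (\<forall>i j k l. t i k * t j l = t i j * t k l + t j k * t i l)"

lemma plueckerD:
  assumes "pluecker t"
  shows "t i j = - t j i" "t i (i + 1) = 1" "t i i = 0" "t (i - 1) i = 1"
    "t i k * t j l = t i j * t k l + t j k * t i l"
proof -
  have anti: "t i j = - t j i" for i j using assms unfolding pluecker_def by blast
  then show "t i j = - t j i" .
  show "t i i = 0" using anti[of i i] by simp
  have succ: "t i (i + 1) = 1" for i using assms unfolding pluecker_def by blast
  show "t i (i + 1) = 1" by (fact succ)
  show "t (i - 1) i = 1" using succ[of "i - 1"] by simp
  show "t i k * t j l = t i j * t k l + t j k * t i l" using assms unfolding pluecker_def by blast
qed

text \<open>Pluecker relation for the four indices i, j - 1, j, j + 1, where adjacent entries are
  1.\<close>

lemma pluecker_recurrence: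
  assumes "pluecker t"
  shows "t i (j + 1) + t i (j - 1) = t (j - 1) (j + 1) * t i j"
  using plueckerD(5)[OF assms, of i j "j - 1" "j + 1"] plueckerD(2,4)[OF assms, of j]
  by (simp add: algebra_simps)

lemma recurrence_zero:
  fixes x a :: "int \<Rightarrow> int"
  assumes rec: "\<And>j. x (j + 1) + x (j - 1) = a j * x j" and "x c = 0" "x (c + 1) = 0"
  shows "x j = 0"
proof -
  have "x j = 0 \<and> x (j + 1) = 0" for j
  proof (induction j rule: int_induct[of _ c])
    case base then show ?case using assms by simp
  next
    case (step1 i)
    then show ?case using rec[of "i + 1"] by simp
  next
    case (step2 i)
    then show ?case using rec[of i] by simp
  qed
  then show ?thesis by simp
qed

lemma pluecker_unique:
  assumes t: "pluecker t" and t': "pluecker t'" and "\<And>k. quiddity t k = quiddity t' k"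
  shows "t = t'"
proof (intro ext)
  fix i j
  have "(t i j - t' i j) = 0"
  proof (rule recurrence_zero[of "\<lambda>j. t i j - t' i j" "quiddity t" i])
    fix j show "t i (j + 1) - t' i (j + 1) + (t i (j - 1) - t' i (j - 1)) = quiddity t j * (t i j - t' i j)"
      using pluecker_recurrence[OF t, of i j] pluecker_recurrence[OF t', of i j] assms(3)[of j]
      unfolding quiddity_def by (simp add: algebra_simps)
  qed (simp_all add: plueckerD(2,3)[OF t] plueckerD(2,3)[OF t'])
  then show "t i j = t' i j" by simp
qed

fun two_term :: "(nat \<Rightarrow> int) \<Rightarrow> int \<Rightarrow> int \<Rightarrow> nat \<Rightarrow> int" where
  "two_term a x y 0 = x"
| "two_term a x y (Suc 0) = y"
| "two_term a x y (Suc (Suc n)) = a (Suc n) * two_term a x y (Suc n) - two_term a x y n"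

lemma recurrence_exists:
  fixes a :: "int \<Rightarrow> int"
  obtains x where "\<And>k. x (k + 1) + x (k - 1) = a k * x k" "x 0 = x0" "x 1 = x1"
proof
  define u where "u = two_term (\<lambda>n. a (int n)) x0 x1"
  \<comment> \<open>The solution to the left of 0: the recurrence is symmetric under reflection, and
    \<open>a 0 * x0 - x1\<close> is the value that it forces at -1.\<close>
  define v where "v = two_term (\<lambda>n. a (- int n)) x0 (a 0 * x0 - x1)"
  define x where "x k = (if k \<ge> 0 then u (nat k) else v (nat (- k)))" for k
  show "x 0 = x0" "x 1 = x1" by (auto simp: x_def u_def)
  have u: "x (int n) = u n" and v: "x (- int n) = v n" for n
    by (auto simp: x_def u_def v_def)
  fix k :: int
  consider n where "k = int (Suc n)" | "k = 0" | n where "k = - int (Suc n)"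
  proof (cases k "0::int" rule: linorder_cases)
    case less
    then have "k = - int (Suc (nat (- k) - 1))" by simp
    then show ?thesis by (rule that(3))
  next
    case greater
    then have "k = int (Suc (nat k - 1))" by simp
    then show ?thesis by (rule that(1))
  qed (rule that(2))
  then show "x (k + 1) + x (k - 1) = a k * x k"
  proof cases
    case (1 n)
    then have "k + 1 = int (Suc (Suc n))" "k - 1 = int n" by auto
    then show ?thesis unfolding u 1 by (simp only: u) (simp add: u_def)
  next
    case 2
    then show ?thesis using u[of 1] v[of 1] u[of 0] by (simp add: u_def v_def)
  next
    case (3 n)
    then have "k - 1 = - int (Suc (Suc n))" "k + 1 = - int n" by auto
    then show ?thesis unfolding v 3 by (simp only: v) (simp add: v_def)
  qed
qed

text \<open>The recurrence with coefficients \<open>a\<close> has a two-dimensional solution space;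
  t is the array of minors of a basis x, y. Its minors of adjacent columns are constant along the
  recurrence, and the initial values normalise them to 1.\<close>

lemma pluecker_exists:
  obtains t where "pluecker t" "\<And>k. quiddity t k = a k"
proof -
  obtain x where x: "\<And>k. x (k + 1) + x (k - 1) = a k * x k" "x 0 = 1" "x 1 = 0"
    using recurrence_exists by metis
  obtain y where y: "\<And>k. y (k + 1) + y (k - 1) = a k * y k" "y 0 = 0" "y 1 = 1"
    using recurrence_exists by metis
  define t where "t i j = x i * y j - x j * y i" for i j
  have step: "t i (i + 1) = t (i - 1) i" for i
  proof -
    have eqs: "y (i + 1) = a i * y i - y (i - 1)" "x (i + 1) = a i * x i - x (i - 1)"
      using x(1)[of i] y(1)[of i] by linarith+
    show ?thesis unfolding t_def eqs by (simp add: algebra_simps)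
  qed
  have one: "t i (i + 1) = 1" for i
  proof (induction i rule: int_induct[of _ 0])
    case base show ?case using x y by (simp add: t_def)
  next
    case (step1 i) then show ?case using step[of "i + 1"] by simp
  next
    case (step2 i) then show ?case using step[of i] by simp
  qed
  have "pluecker t"
    unfolding pluecker_def using one by (auto simp: t_def algebra_simps)
  moreover have "quiddity t k = a k" for k
  proof -
    have eqs: "y (k + 1) = a k * y k - y (k - 1)" "x (k + 1) = a k * x k - x (k - 1)"
      using x(1)[of k] y(1)[of k] by linarith+
    have "t (k - 1) (k + 1) = a k * t (k - 1) k" unfolding t_def eqs by (simp add: algebra_simps)
    then show ?thesis using one[of "k - 1"] by (simp add: quiddity_def)
  qed
  ultimately show ?thesis using that by blast
qed

lemma infinite_friezeI:
  assumes "pluecker t" "\<And>i j. i < j \<Longrightarrow> t i j \<ge> 1"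
  shows "infinite_frieze t"
proof -
  have "t i j * t (i + 1) (j + 1) - t i (j + 1) * t (i + 1) j = 1" for i j
    using plueckerD(5)[OF assms(1), of i "i + 1" j "j + 1", unfolded plueckerD(2)[OF assms(1)]]
      plueckerD(1)[OF assms(1), of j "i + 1"]
    by (simp add: mult.commute)
  then show ?thesis
    unfolding infinite_frieze_def using assms(2) plueckerD(1,2,3)[OF assms(1)] by blast
qed

lemma infinite_friezeD:
  assumes "infinite_frieze t"
  shows "t i i = 0" "i < j \<Longrightarrow> t i j \<ge> 1" "t i (i + 1) = 1" "t i j = - t j i"
    "t i j * t (i + 1) (j + 1) - t i (j + 1) * t (i + 1) j = 1"
  using assms unfolding infinite_frieze_def by blast+

text \<open>Subtracting the frieze rules at j and j - 1 shows that (t i (j + 1) + t i (j - 1)) / t i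
  j does not change from i to i + 1. As t j j = 0 blocks this passage, the value is computed
  separately at i = j - 1, j and j + 1 and then carried outwards.\<close>

lemma infinite_frieze_recurrence:
  assumes t: "infinite_frieze t"
  shows "t i (j + 1) + t i (j - 1) = quiddity t j * t i j"
proof -
  have ratio: "t (i + 1) j * (t i (j + 1) + t i (j - 1)) = t i j * (t (i + 1) (j + 1) + t (i + 1) (j - 1))" for i
    using infinite_friezeD(5)[OF t, of i j] infinite_friezeD(5)[OF t, of i "j - 1"]
    by (simp add: algebra_simps)
  have nz: "t i j \<noteq> 0" if "i \<noteq> j" for i j
    using that infinite_friezeD(2)[OF t, of i j] infinite_friezeD(2)[OF t, of j i]
      infinite_friezeD(4)[OF t, of i j] by linarith
  have last: "t (j - 1) j = 1" "t (j - 1) (j - 1) = 0" "t (j + 1) j = -1" "t (j + 1) (j + 1) = 0"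
    "t (j + 1) (j - 1) = - quiddity t j" "t j (j + 1) = 1" "t j (j - 1) = -1" "t j j = 0"
    using infinite_friezeD(3)[OF t, of "j - 1"] infinite_friezeD(3)[OF t, of j]
      infinite_friezeD(1)[OF t] infinite_friezeD(4)[OF t, of "j + 1" j]
      infinite_friezeD(4)[OF t, of j "j - 1"] infinite_friezeD(4)[OF t, of "j + 1" "j - 1"]
    by (auto simp: quiddity_def)
  consider "i \<le> j - 1" | "i = j" | "i \<ge> j + 1" by linarith
  then show ?thesis
  proof cases
    case 1
    then show ?thesis
    proof (induction rule: int_le_induct)
      case base then show ?case by (simp add: last) (simp add: quiddity_def)
    next
      case (step i)
      have "t i j * (t (i - 1) (j + 1) + t (i - 1) (j - 1)) = t i j * (quiddity t j * t (i - 1) j)"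
        using ratio[of "i - 1"] step.IH by (simp add: ac_simps)
      then show ?case using nz[of i j] step.hyps by simp
    qed
  next
    case 2 then show ?thesis by (simp add: last)
  next
    case 3
    then show ?thesis
    proof (induction rule: int_ge_induct)
      case base then show ?case by (simp add: last)
    next
      case (step i)
      have "t i j * (t (i + 1) (j + 1) + t (i + 1) (j - 1)) = t i j * (quiddity t j * t (i + 1) j)"
        using ratio[of i, symmetric] unfolding step.IH by (simp only: ac_simps)
      then show ?case using nz[of i j] step.hyps by simp
    qed
  qed
qed

text \<open>As functions of j, t i j and the minor formed from rows 0 and 1 solve the same
  recurrence and agree at j = 0 and j = 1. Minors satisfy the Pluecker relations
  identically.\<close>

lemma infinite_frieze_pluecker:
  assumes t: "infinite_frieze t"
  shows "pluecker t"
proof -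
  have last: "t 1 0 = -1" "t 0 1 = 1" "t 0 0 = 0" "t 1 1 = 0"
    using infinite_friezeD(1)[OF t] infinite_friezeD(3)[OF t, of 0] infinite_friezeD(4)[OF t, of 1 0] by auto
  have "t i j - (t 0 i * t 1 j - t 0 j * t 1 i) = 0" for i j
  proof (rule recurrence_zero[of "\<lambda>j. t i j - (t 0 i * t 1 j - t 0 j * t 1 i)" "quiddity t" 0])
    fix j show "t i (j + 1) - (t 0 i * t 1 (j + 1) - t 0 (j + 1) * t 1 i) +
         (t i (j - 1) - (t 0 i * t 1 (j - 1) - t 0 (j - 1) * t 1 i)) =
         quiddity t j * (t i j - (t 0 i * t 1 j - t 0 j * t 1 i))"
    proof -
      have eq: "t i (j + 1) = quiddity t j * t i j - t i (j - 1)" for i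
        using infinite_frieze_recurrence[OF t, of i j] by linarith
      show ?thesis unfolding eq by (simp add: algebra_simps)
    qed
  qed (use last infinite_friezeD(4)[OF t, of i 0] infinite_friezeD(4)[OF t, of i 1] in auto)
  then have det: "t i j = t 0 i * t 1 j - t 0 j * t 1 i" for i j
    by (rule iffD2[OF eq_iff_diff_eq_0])
  have "t i k * t j l = t i j * t k l + t j k * t i l" for i j k l
    unfolding det[of i k] det[of j l] det[of i j] det[of k l] det[of j k] det[of i l]
    by (simp add: algebra_simps)
  then show ?thesis
    using infinite_friezeD[OF t] unfolding pluecker_def by blast
qed

text \<open>Comparison of \<open>t i\<close> with a positive supersolution \<open>F\<close> of the recurrence: the Casoratian
  \<open>t i (m + 1) * F m - t i m * F (m + 1)\<close> does not decrease.\<close>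

lemma
  fixes F :: "int \<Rightarrow> int"
  assumes t: "pluecker t" and F: "\<And>k. F k \<ge> 1"
    and super: "\<And>k. F (k - 1) + F (k + 1) \<le> quiddity t k * F k"
  shows supersolution_pos: "i < j \<Longrightarrow> t i j \<ge> 1"
    and supersolution_gt_1: "i < k \<Longrightarrow> k < j \<Longrightarrow> F k = 1 \<Longrightarrow> t i j \<ge> 2"
proof -
  \<comment> \<open>The Casoratian starts at m = i with the value F i, which is at least 1; this
    initial value is the \<open>+ 1\<close>.\<close>
  have cas: "t i m \<ge> 0 \<and> t i (m + 1) \<ge> 1 \<and> t i (m + 1) * F m \<ge> t i m * F (m + 1) + 1" if "i \<le> m" for m
    using that
  proof (induction rule: int_ge_induct)
    case base then show ?case using F[of i] by (simp add: plueckerD(2,3)[OF t])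
  next
    case (step m)
    have rec: "t i (m + 2) = quiddity t (m + 1) * t i (m + 1) - t i m"
      using pluecker_recurrence[OF t, of i "m + 1"] by (simp add: quiddity_def add.commute[of 2])
    have "t i (m + 1) * (F m + F (m + 2)) \<le> t i (m + 1) * (quiddity t (m + 1) * F (m + 1))"
      using super[of "m + 1"] step.IH by (intro mult_left_mono) (auto simp: add.commute[of 2])
    then have cas: "t i (m + 2) * F (m + 1) \<ge> t i (m + 1) * F (m + 2) + 1"
      using step.IH unfolding rec by (simp add: algebra_simps)
    moreover have "t i (m + 1) * F (m + 2) \<ge> 0" using step.IH F[of "m + 2"] by simp
    ultimately have "t i (m + 2) * F (m + 1) > 0" by linarith
    then have "t i (m + 2) > 0" using F[of "m + 1"] by (simp add: zero_less_mult_iff)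
    then show ?case using cas step.IH by (simp add: add.assoc)
  qed
  show pos: "t i j \<ge> 1" if "i < j" for j using cas[of "j - 1"] that by simp
  show "t i j \<ge> 2" if k: "i < k" "k < j" "F k = 1"
  proof -
    \<comment> \<open>The ratio t i n / F n strictly increases with n. Since F k = 1 the claim reads
      t i n >= t i k * F n + 1, and both factors are at least 1.\<close>
    have cmp: "t i n * F k \<ge> t i k * F n + 1" if "k + 1 \<le> n" for n
      using that
    proof (induction rule: int_ge_induct)
      case base then show ?case using cas[of k] k by simp
    next
      case (step n)
      have n: "t i (n + 1) * F n \<ge> t i n * F (n + 1) + 1" using cas[of n] step.hyps k by simp
      have "t i n * F (n + 1) \<ge> (t i k * F n + 1) * F (n + 1)"
        using step.IH k F[of "n + 1"] by (intro mult_right_mono) auto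
      then have "F n * (t i (n + 1) - t i k * F (n + 1)) > 0"
        using n F[of "n + 1"] by (simp add: algebra_simps)
      then show ?case using F[of n] k by (simp add: zero_less_mult_iff)
    qed
    have "t i k * F j \<ge> 1" using mult_mono[OF pos[OF k(1)] F[of j]] pos[OF k(1)] by simp
    then show ?thesis using cmp[of j] k by simp
  qed
qed

subsection \<open>Laminations of the half-plane\<close>

text \<open>Common ground of the two families to be compared: the lower peripheral arcs of a
  triangulation and the entries 1 of a frieze. The axiom \<open>apex\<close> provides the triangle
  just below each arc, so that the polygon cut off by an arc is triangulated.\<close>

locale lamination =
  fixes P :: "int \<Rightarrow> int \<Rightarrow> bool"
  assumes arc_ge: "P i j \<Longrightarrow> i + 2 \<le> j"
    and noncrossing: "P i k \<Longrightarrow> P j l \<Longrightarrow> i < j \<Longrightarrow> j < k \<Longrightarrow> k < l \<Longrightarrow> False"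
    and finite_right: "finite {j. P i j}"
    and finite_left: "finite {i. P i j}"
    and apex: "P i j \<Longrightarrow> \<exists>k. i < k \<and> k < j \<and> (P i k \<or> k = i + 1) \<and> (P k j \<or> j = k + 1)"
begin

definition side :: "int \<Rightarrow> int \<Rightarrow> bool" where
  "side i j \<longleftrightarrow> P i j \<or> j = i + 1"

definition outer :: "int \<Rightarrow> bool" where
  "outer k \<longleftrightarrow> (\<forall>i j. P i j \<longrightarrow> \<not> (i < k \<and> k < j))"

text \<open>For an outer point this is the next outer point to the right. The boundary neighbour
  \<open>k + 1\<close> serves when no arc leaves \<open>k\<close> to the right.\<close>

definition nxt :: "int \<Rightarrow> int" where
  "nxt k = Max (insert (k + 1) {j. P k j})"

definition prv :: "int \<Rightarrow> int" where
  "prv k = Min (insert (k - 1) {i. P i k})"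

text \<open>For a side (i, j), \<open>rdeg i j\<close> and \<open>ldeg i j\<close> count the arcs at
  its left and right end inside the polygon that it cuts off, the side included if it is an arc.
  They turn out to be the frieze entries t (i + 1) j and t i (j - 1).\<close>

definition rdeg :: "int \<Rightarrow> int \<Rightarrow> int" where
  "rdeg i j = int (card {m. P i m \<and> m \<le> j})"

definition ldeg :: "int \<Rightarrow> int \<Rightarrow> int" where
  "ldeg i j = int (card {m. P m j \<and> i \<le> m})"

definition deg :: "int \<Rightarrow> int" where
  "deg k = int (card {j. P k j}) + int (card {i. P i k})"

section \<open>Sides and the chain of outer points\<close>

lemma side_less: "side i j \<Longrightarrow> i < j"
  using arc_ge by (force simp: side_def)

lemma side_apex:
  assumes "P i j"
  obtains k where "i < k" "k < j" "side i k" "side k j"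
  using apex[OF assms] unfolding side_def by blast

lemma side_nxt: "side k (nxt k)"
proof -
  have "nxt k \<in> insert (k + 1) {j. P k j}"
    unfolding nxt_def using finite_right by (intro Max_in) auto
  then show ?thesis by (auto simp: side_def)
qed

lemma side_prv: "side (prv k) k"
proof -
  have "prv k \<in> insert (k - 1) {i. P i k}"
    unfolding prv_def using finite_left by (intro Min_in) auto
  then show ?thesis by (auto simp: side_def)
qed

lemma le_nxt: "side k j \<Longrightarrow> j \<le> nxt k"
  unfolding nxt_def using finite_right by (intro Max_ge) (auto simp: side_def)

lemma prv_le: "side i k \<Longrightarrow> prv k \<le> i"
  unfolding prv_def using finite_left by (intro Min_le) (auto simp: side_def)

lemma nxt_gt: "k < nxt k" and prv_lt: "prv k < k"
  using side_nxt side_prv side_less by blast+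

lemma outer_not_inside: "outer m \<Longrightarrow> side i j \<Longrightarrow> \<not> (i < m \<and> m < j)"
  by (auto simp: outer_def side_def)

text \<open>An arc above nxt k would start before k and cover k, start at k and be longer than nxt k
  allows, or start after k and cross the arc from k to nxt k.\<close>

lemma outer_nxt:
  assumes "outer k" shows "outer (nxt k)"
  unfolding outer_def
proof (intro allI impI notI)
  fix i j assume ij: "P i j" "i < nxt k \<and> nxt k < j"
  then have "i \<noteq> k" using le_nxt[of k j] by (auto simp: side_def)
  moreover have "\<not> i < k" using assms ij nxt_gt[of k] unfolding outer_def by fastforce
  ultimately have "k < i" by simp
  moreover have "P k (nxt k)" using side_nxt[of k] ij \<open>k < i\<close> by (auto simp: side_def)
  ultimately show False using noncrossing[of k "nxt k" i j] ij by blast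
qed

lemma outer_prv:
  assumes "outer k" shows "outer (prv k)"
  unfolding outer_def
proof (intro allI impI notI)
  fix i j assume ij: "P i j" "i < prv k \<and> prv k < j"
  then have "j \<noteq> k" using prv_le[of i k] by (auto simp: side_def)
  moreover have "\<not> k < j" using assms ij prv_lt[of k] unfolding outer_def by fastforce
  ultimately have "j < k" by simp
  moreover have "P (prv k) k" using side_prv[of k] ij \<open>j < k\<close> by (auto simp: side_def)
  ultimately show False using noncrossing[of i j "prv k" k] ij by blast
qed

lemma outer_eq_nxt:
  assumes "outer m" "k < m" "side k j" "m \<le> j" shows "m = j"
  using assms outer_not_inside[of m k j] by fastforce

lemma nxt_prv:
  assumes "outer k" shows "nxt (prv k) = k"
proof -
  have "k \<le> nxt (prv k)" by (intro le_nxt side_prv)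
  then show ?thesis using outer_eq_nxt[OF assms prv_lt side_nxt] by simp
qed

lemma prv_nxt:
  assumes "outer k" shows "prv (nxt k) = k"
proof -
  have "prv (nxt k) \<le> k" by (intro prv_le side_nxt)
  moreover have "\<not> prv (nxt k) < k"
    using outer_not_inside[OF assms side_prv[of "nxt k"]] nxt_gt[of k] by auto
  ultimately show ?thesis by simp
qed

text \<open>Iterating \<open>prv\<close> shows that the outer points are unbounded to the left as
  soon as there is one. The largest one not exceeding k does it.\<close>

lemma exists_outer_below:
  assumes "outer p0"
  obtains p where "outer p" "p \<le> k" "k < nxt p"
proof -
  have "\<exists>p. outer p \<and> p \<le> p0 - int n" for n
  proof (induction n)
    case 0 then show ?case using assms by auto
  next
    case (Suc n)
    then obtain p where "outer p" "p \<le> p0 - int n" by blast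
    then show ?case using outer_prv[of p] prv_lt[of p] by (intro exI[of _ "prv p"]) auto
  qed
  from this[of "nat (p0 - k)"] obtain q where "outer q" "q \<le> p0 - int (nat (p0 - k))" by blast
  then have q: "outer q" "q \<le> k" by (auto split: if_splits)
  define A where "A = {p \<in> {q..k}. outer p}"
  have "A \<subseteq> {q..k}" by (auto simp: A_def)
  then have A: "finite A" "A \<noteq> {}" using q finite_subset by (auto simp: A_def)
  define p where "p = Max A"
  have "p \<in> A" using A by (simp add: p_def)
  then have p: "outer p" "p \<le> k" "q \<le> p" by (auto simp: A_def)
  have "k < nxt p"
  proof (rule ccontr)
    assume "\<not> k < nxt p"
    then have "nxt p \<in> A" using p outer_nxt[of p] nxt_gt[of p] by (auto simp: A_def)
    then have "nxt p \<le> p" using A by (simp add: p_def)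
    then show False using nxt_gt[of p] by simp
  qed
  then show ?thesis using that p by blast
qed

text \<open>The maps \<open>nxt\<close> and \<open>prv\<close> never jump over an outer point, so
  the outer points form a single chain; the induction is on the distance to k0.\<close>

lemma outer_induct [consumes 2, case_names base nxt prv]:
  assumes "outer k" "outer k0" "Q k0"
    and nxt: "\<And>k. outer k \<Longrightarrow> Q k \<Longrightarrow> Q (nxt k)"
    and prv: "\<And>k. outer k \<Longrightarrow> Q k \<Longrightarrow> Q (prv k)"
  shows "Q k"
  using assms(1)
proof (induction "nat \<bar>k - k0\<bar>" arbitrary: k rule: less_induct)
  case less
  consider "k = k0" | "k0 < k" | "k < k0" by linarith
  then show ?case
  proof cases
    case 1 then show ?thesis using assms(3) by simp
  next
    case 2
    have "k0 \<le> prv k" using outer_not_inside[OF assms(2) side_prv[of k]] 2 by auto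
    then have "Q (prv k)" using less.hyps[of "prv k"] outer_prv[OF less.prems] prv_lt[of k] 2 by auto
    then show ?thesis using nxt[of "prv k"] nxt_prv outer_prv less.prems by metis
  next
    case 3
    have "nxt k \<le> k0" using outer_not_inside[OF assms(2) side_nxt[of k]] 3 by auto
    then have "Q (nxt k)" using less.hyps[of "nxt k"] outer_nxt[OF less.prems] nxt_gt[of k] 3 by auto
    then show ?thesis using prv[of "nxt k"] prv_nxt outer_nxt less.prems by metis
  qed
qed

text \<open>Descent: the apex of a covering arc is k itself, or k lies below one of the two sides at
  the apex, which is then a shorter arc.\<close>

lemma covered_apex:
  assumes "P i j" "i < k" "k < j"
  shows "\<exists>i j. P i j \<and> i < k \<and> k < j \<and> side i k \<and> side k j"
  using assms
proof (induction "nat (j - i)" arbitrary: i j rule: less_induct)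
  case less
  obtain m where m: "i < m" "m < j" "side i m" "side m j" using side_apex[OF less.prems(1)] by blast
  consider "k = m" | "k < m" | "m < k" by linarith
  then show ?case
  proof cases
    case 1 then show ?thesis using less.prems m by blast
  next
    case 2
    then have "P i m" using m less.prems by (auto simp: side_def)
    then show ?thesis using less.hyps[of m i] 2 m less.prems by simp
  next
    case 3
    then have "P m j" using m less.prems by (auto simp: side_def)
    then show ?thesis using less.hyps[of j m] 3 m less.prems by simp
  qed
qed

lemma not_outer_apex:
  assumes "\<not> outer k"
  obtains i j where "P i j" "i < k" "k < j" "side i k" "side k j"
  using assms covered_apex unfolding outer_def by metis

section \<open>Degrees and frieze entries along the sides\<close>

lemma rdeg_succ [simp]: "rdeg i (i + 1) = 0"
proof -
  have "{m. P i m \<and> m \<le> i + 1} = {}" using arc_ge[of i] by force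
  then have "card {m. P i m \<and> m \<le> i + 1} = 0" by (simp only: card.empty)
  then show ?thesis unfolding rdeg_def by simp
qed

lemma ldeg_pred [simp]: "ldeg (j - 1) j = 0"
proof -
  have "{m. P m j \<and> j - 1 \<le> m} = {}" using arc_ge[of _ j] by force
  then have "card {m. P m j \<and> j - 1 \<le> m} = 0" by (simp only: card.empty)
  then show ?thesis unfolding ldeg_def by simp
qed

text \<open>An arc from i ending strictly between k and j would cross the side (k, j), so passing
  from k to j only adds the arc (i, j) itself.\<close>

lemma rdeg_apex:
  assumes "P i j" "i < k" "k < j" "side k j"
  shows "rdeg i j = rdeg i k + 1"
proof -
  have "m \<le> k" if "P i m" "m \<noteq> j" "m \<le> j" for m
    using noncrossing[of i m k j] that assms by (force simp: side_def)
  then have "{m. P i m \<and> m \<le> j} = insert j {m. P i m \<and> m \<le> k}" using assms by force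
  moreover have "finite {m. P i m \<and> m \<le> k}" using finite_right[of i] by simp
  ultimately show ?thesis using assms by (simp add: rdeg_def)
qed

lemma ldeg_apex:
  assumes "P i j" "i < k" "k < j" "side i k"
  shows "ldeg i j = ldeg k j + 1"
proof -
  have "k \<le> m" if "P m j" "m \<noteq> i" "i \<le> m" for m
    using noncrossing[of i k m j] that assms by (force simp: side_def)
  then have "{m. P m j \<and> i \<le> m} = insert i {m. P m j \<and> k \<le> m}" using assms by force
  moreover have "finite {m. P m j \<and> k \<le> m}" using finite_left[of j] by simp
  ultimately show ?thesis using assms by (simp add: ldeg_def)
qed

text \<open>No arc at k can leave the region below (i, j) without crossing that arc.\<close>

lemma deg_apex:
  assumes "P i j" "i < k" "k < j"
  shows "deg k = rdeg k j + ldeg i k"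
proof -
  have "{m. P k m \<and> m \<le> j} = {m. P k m}" "{m. P m k \<and> i \<le> m} = {m. P m k}"
    using noncrossing[of i j k] noncrossing[of _ k i j] assms by force+
  then show ?thesis by (simp add: deg_def rdeg_def ldeg_def)
qed

lemma deg_outer: "deg k = rdeg k (nxt k) + ldeg (prv k) k"
proof -
  have "{m. P k m \<and> m \<le> nxt k} = {m. P k m}" "{m. P m k \<and> prv k \<le> m} = {m. P m k}"
    using le_nxt[of k] prv_le[of _ k] by (auto simp: side_def)
  then show ?thesis by (simp add: deg_def rdeg_def ldeg_def)
qed

text \<open>The entry t p (k + 1) is computed twice: by the recurrence at k as quiddity t k - l, and
  by the Pluecker relation for p, k, k + 1, q as r + t p q.\<close>

lemma quiddity_split:
  assumes t: "pluecker t" and "t p k = 1" "t k q = 1" "t (k + 1) q = r" "t p (k - 1) = l"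
  shows "quiddity t k = l + r + t p q"
proof -
  have "t p (k + 1) = quiddity t k - l"
    using pluecker_recurrence[OF t, of p k] assms by (simp add: quiddity_def)
  then show ?thesis
    using plueckerD(5)[OF t, of p "k + 1" k q] plueckerD(2)[OF t, of k] assms by simp
qed

text \<open>Pluecker relations for i, i + 1, k, j and for i, k, j - 1, j; each adds 1, as do
  \<open>rdeg_apex\<close> and \<open>ldeg_apex\<close>.\<close>

lemma side_step:
  assumes t: "pluecker t" and P: "P i j" "i < k" "k < j" "side i k" "side k j"
    and ik: "t i k = 1" "t (i + 1) k = rdeg i k" and kj: "t k j = 1" "t k (j - 1) = ldeg k j"
    and ij: "t i j = 1"
  shows "t (i + 1) j = rdeg i j" "t i (j - 1) = ldeg i j"
proof -
  show "t (i + 1) j = rdeg i j"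
    using plueckerD(5)[OF t, of i k "i + 1" j] plueckerD(2)[OF t, of i] rdeg_apex[OF P(1,2,3,5)] assms
    by simp
  have "t (j - 1) j = 1" by (rule plueckerD(4)[OF t])
  then show "t i (j - 1) = ldeg i j"
    using plueckerD(5)[OF t, of i "j - 1" k j] ldeg_apex[OF P(1,2,3,4)] assms by simp
qed

text \<open>From triangle counts to entries 1: at the apex k of (i, j) the quiddity deg k + 1 is
  ldeg i k + rdeg k j + 1, and \<open>quiddity_split\<close> leaves t i j = 1.\<close>

lemma side_from_quiddity:
  assumes t: "pluecker t" and q: "\<And>k. \<not> outer k \<Longrightarrow> quiddity t k = deg k + 1"
  shows "side i j \<Longrightarrow> t i j = 1 \<and> t (i + 1) j = rdeg i j \<and> t i (j - 1) = ldeg i j"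
proof (induction "nat (j - i)" arbitrary: i j rule: less_induct)
  case less
  show ?case
  proof (cases "j = i + 1")
    case True
    then show ?thesis using plueckerD(2,3)[OF t] ldeg_pred[of j] by simp
  next
    case False
    then have P: "P i j" using less.prems by (simp add: side_def)
    then obtain k where k: "i < k" "k < j" "side i k" "side k j" using side_apex by blast
    have ik: "t i k = 1 \<and> t (i + 1) k = rdeg i k \<and> t i (k - 1) = ldeg i k"
      and kj: "t k j = 1 \<and> t (k + 1) j = rdeg k j \<and> t k (j - 1) = ldeg k j"
      using less.hyps k by auto
    have "\<not> outer k" using P k by (auto simp: outer_def)
    then have "quiddity t k = rdeg k j + ldeg i k + 1" using q deg_apex[OF P k(1,2)] by simp
    then have "t i j = 1" using quiddity_split[OF t, of i k j] ik kj by simp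
    then show ?thesis using side_step[OF t P k] ik kj by blast
  qed
qed

text \<open>The same induction started from known entries 1 on the arcs; the quiddity is then a
  consequence (\<open>quiddity_outer\<close>, \<open>quiddity_not_outer\<close>).\<close>

lemma side_from_one:
  assumes t: "pluecker t" and one: "\<And>i j. P i j \<Longrightarrow> t i j = 1"
  shows "side i j \<Longrightarrow> t i j = 1 \<and> t (i + 1) j = rdeg i j \<and> t i (j - 1) = ldeg i j"
proof (induction "nat (j - i)" arbitrary: i j rule: less_induct)
  case less
  show ?case
  proof (cases "j = i + 1")
    case True
    then show ?thesis using plueckerD(2,3)[OF t] ldeg_pred[of j] by simp
  next
    case False
    then have P: "P i j" using less.prems by (simp add: side_def)
    then obtain k where k: "i < k" "k < j" "side i k" "side k j" using side_apex by blast
    have "t i k = 1 \<and> t (i + 1) k = rdeg i k \<and> t i (k - 1) = ldeg i k"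
      and "t k j = 1 \<and> t (k + 1) j = rdeg k j \<and> t k (j - 1) = ldeg k j"
      using less.hyps k by auto
    then show ?thesis using side_step[OF t P k] one[OF P] by blast
  qed
qed

lemma quiddity_outer:
  assumes t: "pluecker t" and one: "\<And>i j. P i j \<Longrightarrow> t i j = 1"
  shows "quiddity t k = deg k + t (prv k) (nxt k)"
  using quiddity_split[OF t, of "prv k" k "nxt k"] side_from_one[OF t one side_prv[of k]]
    side_from_one[OF t one side_nxt[of k]] deg_outer[of k] by simp

lemma quiddity_not_outer:
  assumes t: "pluecker t" and one: "\<And>i j. P i j \<Longrightarrow> t i j = 1" and "\<not> outer k"
  shows "quiddity t k = deg k + 1"
proof -
  obtain i j where ij: "P i j" "i < k" "k < j" "side i k" "side k j"
    using not_outer_apex assms by blast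
  show ?thesis
    using quiddity_split[OF t, of i k j] side_from_one[OF t one ij(4)] side_from_one[OF t one ij(5)]
      one[OF ij(1)] deg_apex[OF ij(1,2,3)] by simp
qed

text \<open>Positivity inside a triangulated polygon, by splitting at the apex k. If k separates i
  and j, the relation for p, i, k, q gives t i q = t p i + t i k, and the one for i, k, j, q then
  writes t i j as a sum of a nonnegative and a positive term.\<close>

lemma side_positive:
  assumes t: "pluecker t" and one: "\<And>i j. P i j \<Longrightarrow> t i j = 1"
  shows "side p q \<Longrightarrow> p \<le> i \<Longrightarrow> i < j \<Longrightarrow> j \<le> q \<Longrightarrow> t i j \<ge> 1"
proof (induction "nat (q - p)" arbitrary: p q i j rule: less_induct)
  case less
  show ?case
  proof (cases "q = p + 1")
    case True
    then have "i = p" "j = p + 1" using less.prems by auto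
    then show ?thesis using plueckerD(2)[OF t] by simp
  next
    case False
    then have P: "P p q" using less.prems by (simp add: side_def)
    then obtain k where k: "p < k" "k < q" "side p k" "side k q" using side_apex by blast
    have dec: "nat (k - p) < nat (q - p)" "nat (q - k) < nat (q - p)" using k by auto
    consider "j \<le> k" | "k \<le> i" | "i < k" "k < j" by linarith
    then show ?thesis
    proof cases
      case 1 then show ?thesis using less.hyps[OF dec(1) k(3)] less.prems by simp
    next
      case 2 then show ?thesis using less.hyps[OF dec(2) k(4)] less.prems by simp
    next
      case 3
      have ones: "t p k = 1" "t k q = 1" "t p q = 1"
        using side_from_one[OF t one] k less.prems(1) by auto
      have ik: "t i k \<ge> 1" using less.hyps[OF dec(1) k(3)] less.prems 3 by simp
      have kj: "t k j \<ge> 1" using less.hyps[OF dec(2) k(4)] less.prems 3 by simp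
      have jq: "t j q \<ge> 0"
        using less.hyps[OF dec(2) k(4), of j q] less.prems 3 plueckerD(3)[OF t, of q]
        by (cases "j = q") auto
      have pi: "t p i \<ge> 0"
        using less.hyps[OF dec(1) k(3), of p i] less.prems 3 plueckerD(3)[OF t, of p]
        by (cases "p = i") auto
      have "t i q = t p i + t i k"
        using plueckerD(5)[OF t, of p k i q] ones by simp
      then have "t i q \<ge> 1" using ik pi by simp
      then have "t i k * t j q \<ge> 0" "t k j * t i q \<ge> 1"
        using ik kj jq mult_mono[of 1 "t k j" 1 "t i q"] by auto
      then show ?thesis using plueckerD(5)[OF t, of i j k q] ones by simp
    qed
  qed
qed

text \<open>Below a side \<open>(p, nxt p)\<close> with outer endpoints, \<open>k \<mapsto> t p k + t k (nxt p)\<close> solves the recurrence and is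
  1 at both ends. Gluing these functions leaves slack only at the outer points.\<close>

lemma outer_supersolution:
  assumes t: "pluecker t" and one: "\<And>i j. P i j \<Longrightarrow> t i j = 1"
    and p0: "outer p0" and q: "\<And>k. outer k \<Longrightarrow> quiddity t k \<ge> deg k + 2"
  obtains F where "\<And>k. F k \<ge> 1" "\<And>k. F (k - 1) + F (k + 1) \<le> quiddity t k * F k"
    "\<And>k. outer k \<Longrightarrow> F k = 1"
proof -
  obtain lam where lam: "\<And>k. outer (lam k) \<and> lam k \<le> k \<and> k < nxt (lam k)"
  proof -
    have "\<exists>p. outer p \<and> p \<le> k \<and> k < nxt p" for k
      using exists_outer_below[OF p0, of k] by blast
    then show ?thesis using that by metis
  qed
  define F where "F k = t (lam k) k + t k (nxt (lam k))" for k
  have uniq: "lam k = p" if "outer p" "p \<le> k" "k < nxt p" for p k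
    using that lam[of k] outer_not_inside[OF that(1) side_nxt[of "lam k"]]
      outer_not_inside[OF _ side_nxt[of p], of "lam k"] by force
  have nxt1: "t k (nxt k) = 1" for k using side_from_one[OF t one side_nxt] by blast
  \<comment> \<open>The formula extends to the right end k = nxt p, where \<open>lam\<close> already
    points to the next piece: both pieces give 1 there. Hence k - 1, k, k + 1 are covered by one
    formula for every k strictly inside a piece.\<close>
  have F: "F k = t p k + t k (nxt p)" if "outer p" "p \<le> k" "k \<le> nxt p" for p k
  proof (cases "k = nxt p")
    case True
    then have "lam k = k" using uniq[of k k] outer_nxt[OF that(1)] nxt_gt[of k] by simp
    then show ?thesis unfolding F_def using True nxt1[of k] nxt1[of p] plueckerD(3)[OF t] by simp
  next
    case False
    then show ?thesis unfolding F_def using uniq[of p k] that by simp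
  qed
  have Fo: "F k = 1" if "outer k" for k
    using F[of k k] that nxt_gt[of k] nxt1[of k] plueckerD(3)[OF t] by simp
  have "F k \<ge> 1" for k
  proof (cases "lam k = k")
    case True then show ?thesis using Fo lam[of k] by simp
  next
    case False
    then have "lam k < k" "k < nxt (lam k)" using lam[of k] by auto
    then show ?thesis
      using side_positive[OF t one side_nxt[of "lam k"], of "lam k" k]
        side_positive[OF t one side_nxt[of "lam k"], of k "nxt (lam k)"] by (simp add: F_def)
  qed
  moreover have "F (k - 1) + F (k + 1) \<le> quiddity t k * F k" for k
  proof (cases "lam k = k")
    case True
    then have k: "outer k" using lam[of k] by simp
    \<comment> \<open>At an outer point the two neighbours contribute 1 + rdeg and ldeg + 1,
      together deg k + 2, which is the lower bound assumed for the quiddity.\<close>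
    have "F (k + 1) = 1 + rdeg k (nxt k)"
      using F[OF k, of "k + 1"] nxt_gt[of k] side_from_one[OF t one side_nxt[of k]]
        plueckerD(2)[OF t, of k] by simp
    moreover have "F (k - 1) = ldeg (prv k) k + 1"
      using F[OF outer_prv[OF k], of "k - 1"] prv_lt[of k] side_from_one[OF t one side_prv[of k]]
        plueckerD(4)[OF t, of k] nxt_prv[OF k] by simp
    ultimately show ?thesis using q[OF k] deg_outer[of k] Fo[OF k] by simp
  next
    case False
    define p where "p = lam k"
    have p: "outer p" "p < k" "k < nxt p" using False lam[of k] by (auto simp: p_def)
    \<comment> \<open>Antisymmetry rewrites t k (nxt p) as - t (nxt p) k, so both summands solve the
      recurrence in their second index.\<close>
    have "F (k - 1) + F (k + 1) = (t p (k + 1) + t p (k - 1)) - (t (nxt p) (k + 1) + t (nxt p) (k - 1))"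
      using F[of p "k - 1"] F[of p "k + 1"] p plueckerD(1)[OF t, of "k - 1" "nxt p"]
        plueckerD(1)[OF t, of "k + 1" "nxt p"] by simp
    also have "\<dots> = quiddity t k * (t p k - t (nxt p) k)"
      unfolding pluecker_recurrence[OF t] quiddity_def by (simp add: algebra_simps)
    also have "t p k - t (nxt p) k = F k"
      using F[of p k] p plueckerD(1)[OF t, of k "nxt p"] by simp
    finally show ?thesis by simp
  qed
  ultimately show ?thesis using that Fo by blast
qed

end

subsection \<open>Triangles at a lower marked point\<close>

definition conn :: "strip_arc set \<Rightarrow> mpoint \<Rightarrow> mpoint \<Rightarrow> bool" where
  "conn T p q \<longleftrightarrow> (\<exists>\<alpha>\<in>T. ends \<alpha> = {p, q})"

text \<open>The points x, p, q are met in this cyclic order on the boundary; the three disjuncts are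
  the rotations of increasing keys.\<close>

definition after :: "mpoint \<Rightarrow> mpoint \<Rightarrow> mpoint \<Rightarrow> bool" where
  "after x p q \<longleftrightarrow> key x < key p \<and> key p < key q \<or> key p < key q \<and> key q < key x \<or>
     key q < key x \<and> key x < key p"

text \<open>The Moebius transformation \<open>rank x\<close> sends \<open>x\<close> to infinity, so it turns the cyclic order of the
  boundary, cut at \<open>x\<close>, into the order of the reals.\<close>

definition rank :: "mpoint \<Rightarrow> mpoint \<Rightarrow> real" where
  "rank x p = - inverse (key p - key x)"

lemma rank_less_iff:
  assumes "p \<noteq> x" "q \<noteq> x" shows "rank x p < rank x q \<longleftrightarrow> after x p q"
proof -
  have *: "- inverse a < - inverse b \<longleftrightarrow> (0 < a \<and> a < b \<or> a < b \<and> b < 0 \<or> b < 0 \<and> 0 < a)"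
    if H: "a \<noteq> 0" "b \<noteq> 0" for a b :: real
  proof -
    consider "a > 0" "b > 0" | "a > 0" "b < 0" | "a < 0" "b > 0" | "a < 0" "b < 0"
      using H by linarith
    then show ?thesis
    proof cases
      case 1 then show ?thesis by (auto simp: inverse_less_iff_less)
    next
      case 2
      then have "inverse b < 0" "inverse a > 0" by auto
      then show ?thesis using 2 by linarith
    next
      case 3
      then have "inverse a < 0" "inverse b > 0" by auto
      then show ?thesis using 3 by linarith
    next
      case 4 then show ?thesis by (auto simp: inverse_less_iff_less_neg)
    qed
  qed
  have "key p - key x \<noteq> 0" "key q - key x \<noteq> 0" using assms by auto
  from *[OF this] show ?thesis unfolding rank_def after_def by auto
qed

lemma rank_inject:
  assumes "p \<noteq> x" "q \<noteq> x" "rank x p = rank x q" shows "p = q"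
  using assms by (auto simp: rank_def)

lemma after_crossing: "after x p y \<Longrightarrow> after x y q \<Longrightarrow> crossing x y p q"
  unfolding after_def crossing_def Let_def min_def max_def by (smt (verit))

text \<open>A chord that crosses the side p q of the triangle x p q has one end strictly between p
  and q; on the other side it ends at x or crosses x p or x q.\<close>

lemma crossing_after:
  assumes "after x p q" "crossing p q r s"
  shows "(after x p r \<and> after x r q \<and> (s = x \<or> crossing x p r s \<or> crossing x q r s)) \<or>
    (after x p s \<and> after x s q \<and> (r = x \<or> crossing x p r s \<or> crossing x q r s))"
proof -
  have "s = x \<longleftrightarrow> key s = key x" "r = x \<longleftrightarrow> key r = key x" by auto
  then show ?thesis
    using assms unfolding after_def crossing_def Let_def min_def max_def by (smt (verit))
qed

text \<open>Adding a new largest element x creates exactly one successive pair, formed by the former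
  maximum and x. Applied to the neighbours of a vertex it counts triangles.\<close>

lemma card_successive_pairs:
  fixes f :: "'a \<Rightarrow> 'b::linorder"
  assumes "finite A" "inj_on f A" "A \<noteq> {}"
  shows "card {(a, b). a \<in> A \<and> b \<in> A \<and> f a < f b \<and> \<not> (\<exists>c\<in>A. f a < f c \<and> f c < f b)} + 1 = card A"
  using assms
proof (induction A rule: finite_ranking_induct[where f = f])
  case empty then show ?case by simp
next
  case (insert x A)
  let ?C = "\<lambda>A. {(a, b). a \<in> A \<and> b \<in> A \<and> f a < f b \<and> \<not> (\<exists>c\<in>A. f a < f c \<and> f c < f b)}"
  show ?case
  proof (cases "x \<in> A")
    case True
    then show ?thesis using insert.IH insert.prems by (auto simp: insert_absorb)
  next
    case x: False
    have mx: "f y < f x" if "y \<in> A" for y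
      using insert.hyps(2)[of y] insert.prems(1) that x by (metis inj_on_eq_iff insertCI order_le_less)
    show ?thesis
    proof (cases "A = {}")
      case True
      have "?C {x} = {}" by auto
      then have "card (?C {x}) = 0" by (simp only: card.empty)
      then show ?thesis unfolding True by simp
    next
      case False
      have "Max (f ` A) \<in> f ` A" using insert.hyps(1) False by (intro Max_in) auto
      then obtain m where "m \<in> A" "Max (f ` A) = f m" by blast
      then have m: "m \<in> A" "\<And>y. y \<in> A \<Longrightarrow> f y \<le> f m"
        using insert.hyps(1) by (auto simp flip: \<open>Max (f ` A) = f m\<close>)
      have "?C (insert x A) = insert (m, x) (?C A)"
      proof (intro set_eqI iffI)
        fix z assume "z \<in> ?C (insert x A)"
        then obtain a b where z: "z = (a, b)" "a \<in> insert x A" "b \<in> insert x A" "f a < f b"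
          "\<And>c. c \<in> insert x A \<Longrightarrow> \<not> (f a < f c \<and> f c < f b)" by auto
        have "a \<noteq> x" using z(3,4) mx[of b] by auto
        then have "a \<in> A" using z(2) by simp
        show "z \<in> insert (m, x) (?C A)"
        proof (cases "b = x")
          case True
          have "f m \<le> f a" using z(5)[of m] m(1) mx[OF m(1)] True by auto
          then have "f a = f m" using m(2)[OF \<open>a \<in> A\<close>] by simp
          then have "a = m" using m(1) \<open>a \<in> A\<close> insert.prems(1) by (simp add: inj_on_eq_iff)
          then show ?thesis using z True by simp
        next
          case False then show ?thesis using z \<open>a \<in> A\<close> by auto
        qed
      next
        fix z assume "z \<in> insert (m, x) (?C A)"
        then consider "z = (m, x)" | "z \<in> ?C A" by blast
        then show "z \<in> ?C (insert x A)"
        proof cases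
          case 1 then show ?thesis using m mx by force
        next
          case 2
          then obtain a b where z: "z = (a, b)" "a \<in> A" "b \<in> A" "f a < f b"
            "\<And>c. c \<in> A \<Longrightarrow> \<not> (f a < f c \<and> f c < f b)" by auto
          have "\<not> (f x < f b)" using mx[OF z(3)] by simp
          then show ?thesis using z by auto
        qed
      qed
      moreover have "(m, x) \<notin> ?C A" using mx by auto
      moreover have "finite (?C A)"
        by (rule finite_subset[of _ "A \<times> A"]) (use insert.hyps in auto)
      ultimately have "card (?C (insert x A)) = card (?C A) + 1" by simp
      then show ?thesis using insert.IH insert.prems False insert.hyps(1) x by (simp add: inj_on_def)
    qed
  qed
qed

section \<open>Arcs and boundary segments of a triangulation, and its triangles\<close>

lemma consecutive_between:
  assumes "consecutive M p q" "r \<in> marked M"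
  shows "\<not> (key p < key r \<and> key r < key q)" "\<not> (key q < key r \<and> key r < key p)"
proof -
  have "\<not> (key p < key r \<and> key r < key q) \<and> \<not> (key q < key r \<and> key r < key p)"
  proof (cases r)
    case (Lower m)
    then show ?thesis using assms(1) unfolding consecutive_def by (auto simp del: key.simps)
  next
    case (Upper w)
    then have "w \<in> M" using assms(2) by (auto simp: marked_def)
    then show ?thesis using assms(1) Upper unfolding consecutive_def by (auto simp del: key.simps)
  qed
  then show "\<not> (key p < key r \<and> key r < key q)" "\<not> (key q < key r \<and> key r < key p)" by auto
qed

lemma consecutive_not_crossing:
  assumes "consecutive M p q" "r \<in> marked M" "s \<in> marked M"
  shows "\<not> crossing p q r s"
  using consecutive_between[OF assms(1,2)] consecutive_between[OF assms(1,3)]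
  unfolding crossing_def Let_def min_def max_def by (auto split: if_splits)

lemma consecutive_marked: "consecutive M p q \<Longrightarrow> p \<in> marked M \<and> q \<in> marked M \<and> p \<noteq> q"
  by (auto simp: consecutive_def marked_def)

lemma joined_iff: "joined M T p q \<longleftrightarrow> consecutive M p q \<or> consecutive M q p \<or> conn T p q"
  by (simp add: joined_def conn_def)

lemma conn_commute: "conn T p q \<longleftrightarrow> conn T q p"
  by (simp add: conn_def insert_commute)

lemma joined_commute: "joined M T p q \<longleftrightarrow> joined M T q p"
  using conn_commute by (auto simp: joined_iff)

locale strip_triangulation =
  fixes M :: "int set" and T :: "strip_arc set"
  assumes triang: "triangulation M T"
begin

lemma conn_chord: assumes "conn T p q" shows "chord M p q"
proof -
  obtain \<alpha> where \<alpha>: "\<alpha> \<in> T" "ends \<alpha> = {p, q}" using assms by (auto simp: conn_def)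
  then have "\<alpha> \<in> arcs M" using triang by (auto simp: triangulation_def)
  then obtain p' q' where "chord M p' q'" "ends \<alpha> = {p', q'}" using arc_ends by metis
  then show ?thesis using \<alpha> by (auto simp: chord_def doubleton_eq_iff)
qed

lemma joined_marked: "joined M T p q \<Longrightarrow> p \<in> marked M \<and> q \<in> marked M \<and> p \<noteq> q"
  unfolding joined_iff using conn_chord consecutive_marked unfolding chord_def by blast

lemma conn_not_crossing:
  assumes "conn T p q" "conn T r s" shows "\<not> crossing p q r s"
proof -
  obtain \<alpha> \<beta> where ab: "\<alpha> \<in> T" "ends \<alpha> = {p, q}" "\<beta> \<in> T" "ends \<beta> = {r, s}"
    using assms by (auto simp: conn_def)
  show ?thesis
  proof (cases "\<alpha> = \<beta>")
    case True then show ?thesis using ab crossing_distinct[of p q r s] by auto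
  next
    case False
    have "T \<subseteq> arcs M" "pairwise compatible T" using triang by (simp_all add: triangulation_def)
    then have "\<alpha> \<in> arcs M" "\<beta> \<in> arcs M" "compatible \<alpha> \<beta>"
      using ab(1,3) False by (auto dest: pairwiseD)
    then show ?thesis using compatible_iff[OF _ _ ab(2,4) False] by simp
  qed
qed

lemma joined_not_crossing:
  assumes "joined M T p q" "joined M T r s" shows "\<not> crossing p q r s"
proof -
  have m: "p \<in> marked M" "q \<in> marked M" "r \<in> marked M" "s \<in> marked M"
    using joined_marked[OF assms(1)] joined_marked[OF assms(2)] by simp_all
  have "\<not> crossing q p r s" if "consecutive M q p"
    using consecutive_not_crossing that m by blast
  moreover have "\<not> crossing r s p q" if "consecutive M r s"
    using consecutive_not_crossing that m by blast
  moreover have "\<not> crossing s r p q" if "consecutive M s r"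
    using consecutive_not_crossing that m by blast
  ultimately show ?thesis
    using assms consecutive_not_crossing[OF _ m(3,4), of p q] conn_not_crossing[of p q r s]
    unfolding joined_iff crossing_commute[of r s p q] crossing_commute[of s r p q]
      crossing_swap(1)[of q p] crossing_swap(2)[of p q s r] by blast
qed

text \<open>Otherwise the arc with these ends could be added to \<open>T\<close>. This is the
  combinatorial form in which maximality is used.\<close>

lemma conn_maximal:
  assumes "chord M p q" "\<And>r s. conn T r s \<Longrightarrow> \<not> crossing p q r s"
  shows "conn T p q"
proof -
  obtain \<alpha> where \<alpha>: "\<alpha> \<in> arcs M" "ends \<alpha> = {p, q}" using arc_exists[OF assms(1)] by metis
  have T: "T \<subseteq> arcs M" "pairwise compatible T"
    "\<And>T'. T \<subseteq> T' \<and> T' \<subseteq> arcs M \<and> pairwise compatible T' \<Longrightarrow> T' = T"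
    using triang unfolding triangulation_def by blast+
  have "compatible \<alpha> \<beta> \<and> compatible \<beta> \<alpha>" if "\<beta> \<in> T" "\<alpha> \<noteq> \<beta>" for \<beta>
  proof -
    have \<beta>: "\<beta> \<in> arcs M" using that T by blast
    obtain r s where rs: "ends \<beta> = {r, s}" using arc_ends[OF \<beta>] by metis
    then have "\<not> crossing p q r s" using assms(2) that by (auto simp: conn_def)
    then show ?thesis
      using compatible_iff[OF \<alpha>(1) \<beta> \<alpha>(2) rs] compatible_iff[OF \<beta> \<alpha>(1) rs \<alpha>(2)] that
      by (auto simp: crossing_commute)
  qed
  then have "pairwise compatible (insert \<alpha> T)" using T(2) by (auto simp: pairwise_insert)
  then have "insert \<alpha> T = T" using T \<alpha> by blast
  then show ?thesis using \<alpha> by (auto simp: conn_def)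
qed

lemma joined_maximal:
  assumes "p \<in> marked M" "q \<in> marked M" "p \<noteq> q" "\<And>r s. joined M T r s \<Longrightarrow> \<not> crossing p q r s"
  shows "joined M T p q"
  using assms conn_maximal[of p q] unfolding joined_iff chord_def by blast

text \<open>Neighbouring edges at x close up to a triangle: by \<open>crossing_after\<close> an edge
  crossing p q would end at x, giving a neighbour strictly between p and q, or would cross one of
  the edges x p and x q.\<close>

lemma joined_successive:
  assumes p: "joined M T x p" and q: "joined M T x q" and "after x p q"
    and none: "\<And>y. joined M T x y \<Longrightarrow> \<not> (after x p y \<and> after x y q)"
  shows "joined M T p q"
proof (rule joined_maximal)
  show "p \<in> marked M" "q \<in> marked M" using joined_marked[OF p] joined_marked[OF q] by simp_all
  show "p \<noteq> q" using assms(3) by (auto simp: after_def)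
  fix r s assume rs: "joined M T r s"
  show "\<not> crossing p q r s"
  proof
    assume "crossing p q r s"
    from crossing_after[OF assms(3) this] show False
      using none[of r] none[of s] rs joined_not_crossing[OF p rs] joined_not_crossing[OF q rs]
        joined_commute[of M T r s] by blast
  qed
qed

text \<open>Triangles at x correspond to successive pairs of neighbours of x in the order given by
  \<open>rank x\<close>. A successive pair is joined by \<open>joined_successive\<close>; conversely
  a neighbour between two vertices of a triangle would send an edge from x across the opposite side
  (\<open>after_crossing\<close>).\<close>

lemma card_triangles_joined:
  assumes fin: "finite {p. joined M T x p}" and ne: "{p. joined M T x p} \<noteq> {}"
  shows "card {S \<in> triangles M T. x \<in> S} + 1 = card {p. joined M T x p}"
proof -
  define N where "N = {p. joined M T x p}"
  have Nx: "p \<noteq> x" "p \<in> marked M" "x \<in> marked M" if "p \<in> N" for p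
    using that joined_marked[of x p] by (auto simp: N_def)
  define C where "C = {(a, b). a \<in> N \<and> b \<in> N \<and> rank x a < rank x b \<and>
     \<not> (\<exists>c\<in>N. rank x a < rank x c \<and> rank x c < rank x b)}"
  have C: "(p, q) \<in> C \<longleftrightarrow> p \<in> N \<and> q \<in> N \<and> after x p q \<and> \<not> (\<exists>c\<in>N. after x p c \<and> after x c q)" for p q
    unfolding C_def using Nx(1) rank_less_iff[of _ x] by (auto simp: Ball_def)
  have "bij_betw (\<lambda>(p, q). {x, p, q}) C {S \<in> triangles M T. x \<in> S}"
  proof (rule bij_betwI')
    fix y z assume yz: "y \<in> C" "z \<in> C"
    obtain p q p' q' where e: "y = (p, q)" "z = (p', q')" by fastforce
    have a: "after x p q" "after x p' q'" and n: "p \<in> N" "q \<in> N" "p' \<in> N" "q' \<in> N"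
      using yz C e by auto
    show "((case y of (p, q) \<Rightarrow> {x, p, q}) = (case z of (p, q) \<Rightarrow> {x, p, q})) = (y = z)"
    proof
      assume "(case y of (p, q) \<Rightarrow> {x, p, q}) = (case z of (p, q) \<Rightarrow> {x, p, q})"
      then have "{x, p, q} - {x} = {x, p', q'} - {x}" using e by simp
      then have "{p, q} = {p', q'}" using Nx(1) n by blast
      then consider "p = p'" "q = q'" | "p = q'" "q = p'" by (auto simp: doubleton_eq_iff)
      then show "y = z" using e a by cases (auto simp: after_def)
    qed simp
  next
    fix y assume "y \<in> C"
    then obtain p q where y: "y = (p, q)" "(p, q) \<in> C" by (cases y) auto
    then have pq: "p \<in> N" "q \<in> N" "after x p q" "\<And>c. c \<in> N \<Longrightarrow> \<not> (after x p c \<and> after x c q)"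
      using C by auto
    have "joined M T p q" using joined_successive[of x p q] pq by (auto simp: N_def)
    moreover have "p \<noteq> q" using pq(3) by (auto simp: after_def)
    ultimately show "(case y of (p, q) \<Rightarrow> {x, p, q}) \<in> {S \<in> triangles M T. x \<in> S}"
      using Nx[OF pq(1)] Nx[OF pq(2)] pq(1,2) joined_commute[of M T]
      by (auto simp: y(1) triangles_def N_def)
  next
    fix S assume "S \<in> {S \<in> triangles M T. x \<in> S}"
    then have S: "card S = 3" "x \<in> S" "\<And>p q. p \<in> S \<Longrightarrow> q \<in> S \<Longrightarrow> p \<noteq> q \<Longrightarrow> joined M T p q"
      by (auto simp: triangles_def)
    have "card (S - {x}) = 2" using S by simp
    then obtain a b where ab: "S - {x} = {a, b}" "a \<noteq> b" by (auto simp: card_2_iff)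
    then have abx: "a \<in> S" "b \<in> S" "a \<noteq> x" "b \<noteq> x" "S = {x, a, b}" using S(2) by blast+
    have main: "\<exists>y\<in>C. S = (case y of (p, q) \<Rightarrow> {x, p, q})"
      if H: "after x p q" "S = {x, p, q}" "p \<noteq> x" "q \<noteq> x" "p \<noteq> q" for p q
    proof -
      have j: "joined M T x p" "joined M T x q" "joined M T p q" using S(3) H by auto
      have "\<not> (after x p c \<and> after x c q)" if "c \<in> N" for c
        using after_crossing[of x p c q] joined_not_crossing[of x c p q] j that by (auto simp: N_def)
      then have "(p, q) \<in> C" using C j H by (auto simp: N_def)
      then show ?thesis using H by (intro bexI[of _ "(p, q)"]) auto
    qed
    have "rank x a < rank x b \<or> rank x b < rank x a"
      using rank_inject[of a x b] abx ab by (meson linorder_neqE)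
    then have "after x a b \<or> after x b a" using rank_less_iff abx by blast
    then show "\<exists>y\<in>C. S = (case y of (p, q) \<Rightarrow> {x, p, q})"
      using main[of a b] main[of b a] abx ab by (auto simp: insert_commute)
  qed
  then have "card {S \<in> triangles M T. x \<in> S} = card C" by (rule bij_betw_same_card[symmetric])
  also have "inj_on (rank x) N" using rank_inject Nx by (meson inj_onI)
  then have "card C + 1 = card N"
    unfolding C_def using fin ne by (intro card_successive_pairs) (auto simp: N_def)
  finally show ?thesis unfolding N_def by simp
qed

end

subsection \<open>Admissible triangulations\<close>

definition lower_arc :: "strip_arc set \<Rightarrow> int \<Rightarrow> int \<Rightarrow> bool" where
  "lower_arc T i j \<longleftrightarrow> i < j \<and> conn T (Lower i) (Lower j)"

definition bridge :: "strip_arc set \<Rightarrow> int \<Rightarrow> int \<Rightarrow> bool" where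
  "bridge T u k \<longleftrightarrow> conn T (Upper u) (Lower k)"

lemma Lower_marked [simp]: "Lower i \<in> marked M"
  by (simp add: marked_def)

lemma Upper_marked [simp]: "Upper u \<in> marked M \<longleftrightarrow> u \<in> M"
  by (auto simp: marked_def)

lemma crossing_lower [simp]:
  assumes "i < j" "k < l"
  shows "crossing (Lower i) (Lower j) (Lower k) (Lower l) \<longleftrightarrow> i < k \<and> k < j \<and> j < l \<or> k < i \<and> i < l \<and> l < j"
  using assms by (auto simp: crossing_def Let_def min_def max_def simp del: key.simps)

lemma after_simps [simp]:
  "after (Lower i) (Lower a) (Lower b) \<longleftrightarrow> i < a \<and> a < b \<or> a < b \<and> b < i \<or> b < i \<and> i < a"
  "after (Lower i) (Lower a) (Upper u) \<longleftrightarrow> i < a"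
  "after (Lower i) (Upper u) (Lower b) \<longleftrightarrow> b < i"
  "after (Lower i) (Upper u) (Upper v) \<longleftrightarrow> v < u"
  by (auto simp: after_def simp del: key.simps)

lemma crossing_lower_bridge:
  assumes "i < j"
  shows "crossing (Lower i) (Lower j) (Upper u) (Lower k) \<longleftrightarrow> i < k \<and> k < j"
  using assms by (auto simp: crossing_def Let_def min_def max_def simp del: key.simps)

lemma crossing_bridges:
  "crossing (Upper u) (Lower k) (Upper v) (Lower l) \<longleftrightarrow> u < v \<and> l < k \<or> v < u \<and> k < l"
  by (auto simp: crossing_def Let_def min_def max_def simp del: key.simps)

lemma crossing_upper_bridge:
  assumes "u < v"
  shows "crossing (Upper u) (Upper v) (Upper w) (Lower k) \<longleftrightarrow> u < w \<and> w < v"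
  using assms by (auto simp: crossing_def Let_def min_def max_def simp del: key.simps)

lemma crossing_upper:
  assumes "u < v" "w < z"
  shows "crossing (Upper u) (Upper v) (Upper w) (Upper z) \<longleftrightarrow> u < w \<and> w < v \<and> v < z \<or> w < u \<and> u < z \<and> z < v"
  using assms by (auto simp: crossing_def Let_def min_def max_def simp del: key.simps)

lemma chord_lower: "i < j \<Longrightarrow> chord M (Lower i) (Lower j) \<longleftrightarrow> i + 2 \<le> j"
  by (auto simp: chord_def consecutive_def)

lemma chord_bridge: "chord M (Upper u) (Lower k) \<longleftrightarrow> u \<in> M"
  by (auto simp: chord_def consecutive_def)

locale Tri_member = strip_triangulation +
  assumes admissible: "admissible T" and not_special: "u \<in> M \<Longrightarrow> \<not> special T (Upper u)"
begin

lemma upper_conn: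
  assumes "u \<in> M" obtains p where "conn T (Upper u) p"
proof -
  obtain \<alpha> where \<alpha>: "\<alpha> \<in> T" "Upper u \<in> ends \<alpha>" using not_special[OF assms] by (auto simp: special_def)
  then obtain p q where "ends \<alpha> = {p, q}" using triang arc_ends unfolding triangulation_def by (metis subsetD)
  then have "ends \<alpha> = {Upper u, p} \<or> ends \<alpha> = {Upper u, q}" using \<alpha>(2) by auto
  then show ?thesis using that \<alpha>(1) unfolding conn_def by blast
qed

text \<open>An upper peripheral arc encloses some upper marked point w. As w is not special it
  carries an arc, which can neither reach the lower boundary nor leave the enclosed interval, and so
  is a shorter upper arc.\<close>

lemma no_upper_less: "u < v \<Longrightarrow> \<not> conn T (Upper u) (Upper v)"
proof (induction "nat (v - u)" arbitrary: u v rule: less_induct)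
  case less
  show ?case
  proof
    assume uv: "conn T (Upper u) (Upper v)"
    then have "chord M (Upper u) (Upper v)" by (rule conn_chord)
    then obtain w where w: "w \<in> M" "u < w" "w < v"
      using less.prems by (auto simp: chord_def consecutive_def)
    obtain p where p: "conn T (Upper w) p" using upper_conn[OF w(1)] .
    show False
    proof (cases p)
      case (Lower k)
      then show False
        using conn_not_crossing[OF uv p] crossing_upper_bridge[OF less.prems] w by simp
    next
      case (Upper z)
      have "w \<noteq> z" using conn_chord[OF p] Upper by (auto simp: chord_def)
      moreover have "conn T (Upper z) (Upper w)" using p Upper conn_commute by blast
      moreover have "u \<le> z \<and> z \<le> v"
        using conn_not_crossing[OF uv p] conn_not_crossing[OF uv \<open>conn T (Upper z) (Upper w)\<close>] Upper
          crossing_upper[OF less.prems, of w z] crossing_upper[OF less.prems, of z w] w by force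
      ultimately show False
        using less.hyps[of w z] less.hyps[of z w] w p Upper by (cases w z rule: linorder_cases) auto
    qed
  qed
qed

lemma no_upper: "\<not> conn T (Upper u) (Upper v)"
proof
  assume c: "conn T (Upper u) (Upper v)"
  then have "u \<noteq> v" using conn_chord by (auto simp: chord_def)
  moreover have "conn T (Upper v) (Upper u)" using c by (simp add: conn_commute)
  ultimately show False
    using no_upper_less[of u v] no_upper_less[of v u] c by (cases u v rule: linorder_cases) auto
qed

lemma finite_conn: "finite {p. conn T (Lower k) p}"
proof -
  have sub: "{p. conn T (Lower k) p} \<subseteq> \<Union> (ends ` {\<alpha> \<in> T. Lower k \<in> ends \<alpha>})"
    unfolding conn_def by auto
  have fin: "finite (ends \<alpha>)" if "\<alpha> \<in> T" for \<alpha>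
  proof -
    have "\<alpha> \<in> arcs M" using triang that by (auto simp: triangulation_def)
    then show ?thesis by (rule arc_ends) simp
  qed
  have "finite {\<alpha> \<in> T. Lower k \<in> ends \<alpha>}" using admissible by (simp add: admissible_def)
  then have "finite (\<Union> (ends ` {\<alpha> \<in> T. Lower k \<in> ends \<alpha>}))" using fin by (intro finite_UN_I) auto
  then show ?thesis by (rule finite_subset[OF sub])
qed

lemma finite_bridge: "finite {u. bridge T u k}"
proof -
  have "Upper ` {u. bridge T u k} \<subseteq> {p. conn T (Lower k) p}"
    using conn_commute by (auto simp: bridge_def)
  then have "finite (Upper ` {u. bridge T u k})" by (rule finite_subset[OF _ finite_conn])
  then show ?thesis by (rule finite_imageD) (simp add: inj_on_def)
qed

lemma joined_lower_iff:
  "i < j \<Longrightarrow> joined M T (Lower i) (Lower j) \<longleftrightarrow> lower_arc T i j \<or> j = i + 1"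
  by (auto simp: joined_iff lower_arc_def consecutive_def)

lemma joined_bridge_iff:
  "joined M T (Lower k) (Upper u) \<longleftrightarrow> bridge T u k"
  by (auto simp: joined_iff bridge_def consecutive_def conn_commute)

sublocale lower: lamination "lower_arc T"
proof
  fix i j assume "lower_arc T i j"
  then show "i + 2 \<le> j" using conn_chord chord_lower unfolding lower_arc_def by blast
next
  fix i j k l assume "lower_arc T i k" "lower_arc T j l" "i < j" "j < k" "k < l"
  then show False using conn_not_crossing[of "Lower i" "Lower k" "Lower j" "Lower l"]
    by (auto simp: lower_arc_def)
next
  fix i
  have "Lower ` {j. lower_arc T i j} \<subseteq> {p. conn T (Lower i) p}"
    by (auto simp: lower_arc_def)
  then have "finite (Lower ` {j. lower_arc T i j})" by (rule finite_subset[OF _ finite_conn])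
  then show "finite {j. lower_arc T i j}" by (rule finite_imageD) (simp add: inj_on_def)
  have "Lower ` {j. lower_arc T j i} \<subseteq> {p. conn T (Lower i) p}"
    using conn_commute by (auto simp: lower_arc_def)
  then have "finite (Lower ` {j. lower_arc T j i})" by (rule finite_subset[OF _ finite_conn])
  then show "finite {j. lower_arc T j i}" by (rule finite_imageD) (simp add: inj_on_def)
next
  fix i j assume ij: "lower_arc T i j"
  then have ij2: "i + 2 \<le> j" using conn_chord chord_lower unfolding lower_arc_def by blast
  \<comment> \<open>The apex is the neighbour of i immediately before j, with i + 1 as the fallback;
    then k and j are successive neighbours of i.\<close>
  define A where "A = {m \<in> {i+1..<j}. lower_arc T i m \<or> m = i + 1}"
  have "A \<subseteq> {i+1..<j}" by (auto simp: A_def)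
  then have A: "finite A" "i + 1 \<in> A" using ij2 finite_subset by (auto simp: A_def)
  define k where "k = Max A"
  have "k \<in> A" using A by (auto simp: k_def intro: Max_in)
  then have k: "i < k" "k < j" "lower_arc T i k \<or> k = i + 1" by (auto simp: A_def)
  have "joined M T (Lower k) (Lower j)"
  proof (rule joined_successive)
    show "joined M T (Lower i) (Lower k)" "joined M T (Lower i) (Lower j)"
      using joined_lower_iff k ij ij2 by auto
    show "after (Lower i) (Lower k) (Lower j)" using k by simp
    fix y assume y: "joined M T (Lower i) y"
    show "\<not> (after (Lower i) (Lower k) y \<and> after (Lower i) y (Lower j))"
    proof (cases y)
      case (Lower m)
      have False if "k < m" "m < j"
      proof -
        have "m \<in> A" using that k(1) y Lower joined_lower_iff[of i m] by (auto simp: A_def)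
        then have "m \<le> k" using A by (simp add: k_def)
        then show False using that by simp
      qed
      then show ?thesis using Lower k by force
    next
      case (Upper u) then show ?thesis using k by simp
    qed
  qed
  then show "\<exists>k. i < k \<and> k < j \<and> (lower_arc T i k \<or> k = i + 1) \<and> (lower_arc T k j \<or> j = k + 1)"
    using k joined_lower_iff by blast
qed

lemma bridge_in: "bridge T u k \<Longrightarrow> u \<in> M"
  using conn_chord chord_bridge unfolding bridge_def by blast

lemma ex_bridge: assumes "u \<in> M" shows "\<exists>k. bridge T u k"
proof -
  obtain p where p: "conn T (Upper u) p" using upper_conn[OF assms] .
  then show ?thesis using no_upper by (cases p) (auto simp: bridge_def)
qed

lemma bridge_outer: assumes "bridge T u k" shows "lower.outer k"
  unfolding lower.outer_def
proof (intro allI impI)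
  fix i j assume "lower_arc T i j"
  then show "\<not> (i < k \<and> k < j)"
    using conn_not_crossing[of "Lower i" "Lower j" "Upper u" "Lower k"] assms
    by (auto simp: lower_arc_def bridge_def crossing_lower_bridge)
qed

lemma bridge_mono: "bridge T u k \<Longrightarrow> bridge T v l \<Longrightarrow> k < l \<Longrightarrow> u \<le> v"
  using conn_not_crossing[of "Upper u" "Lower k" "Upper v" "Lower l"]
  by (auto simp: bridge_def crossing_bridges)

text \<open>The point v has a bridge to some l; if l differs from k, monotonicity squeezes v onto u
  or onto w.\<close>

lemma bridge_convex:
  assumes "bridge T u k" "bridge T w k" "u \<le> v" "v \<le> w" "v \<in> M"
  shows "bridge T v k"
proof -
  obtain l where l: "bridge T v l" using ex_bridge assms(5) by blast
  show ?thesis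
    using bridge_mono[OF l assms(1)] bridge_mono[OF assms(2) l] l assms
    by (cases l k rule: linorder_cases) auto
qed

text \<open>Seen from k, the longest side to the right and the rightmost bridge are successive
  neighbours, so their ends are joined. This is the upper point shared by the fans at k and nxt
  k.\<close>

lemma bridge_Max_nxt:
  assumes "bridge T u k"
  shows "bridge T (Max {u. bridge T u k}) (lower.nxt k)"
proof -
  let ?N = "{u. bridge T u k}"
  have mx: "bridge T (Max ?N) k" using Max_in[OF finite_bridge, of k] assms by blast
  have "joined M T (Lower (lower.nxt k)) (Upper (Max ?N))"
  proof (rule joined_successive)
    show "joined M T (Lower k) (Lower (lower.nxt k))"
      using lower.side_nxt[of k] lower.nxt_gt[of k] joined_lower_iff by (auto simp: lower.side_def)
    show "joined M T (Lower k) (Upper (Max ?N))" using mx joined_bridge_iff by blast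
    show "after (Lower k) (Lower (lower.nxt k)) (Upper (Max ?N))" using lower.nxt_gt by simp
    fix y assume y: "joined M T (Lower k) y"
    show "\<not> (after (Lower k) (Lower (lower.nxt k)) y \<and> after (Lower k) y (Upper (Max ?N)))"
    proof (cases y)
      case (Lower m)
      have "m \<le> lower.nxt k" if "k < m"
        using lower.le_nxt[of k m] y Lower that joined_lower_iff by (auto simp: lower.side_def)
      then show ?thesis using Lower lower.nxt_gt[of k] by auto
    next
      case (Upper v)
      then have "v \<le> Max ?N" using y joined_bridge_iff finite_bridge by (intro Max_ge) auto
      then show ?thesis using Upper by simp
    qed
  qed
  then show ?thesis using joined_bridge_iff by blast
qed

lemma bridge_Min_prv:
  assumes "bridge T u k"
  shows "bridge T (Min {u. bridge T u k}) (lower.prv k)"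
proof -
  let ?N = "{u. bridge T u k}"
  have mn: "bridge T (Min ?N) k" using Min_in[OF finite_bridge, of k] assms by blast
  have "joined M T (Upper (Min ?N)) (Lower (lower.prv k))"
  proof (rule joined_successive)
    have "joined M T (Lower (lower.prv k)) (Lower k)"
      using lower.side_prv[of k] lower.prv_lt[of k] joined_lower_iff by (auto simp: lower.side_def)
    then show "joined M T (Lower k) (Lower (lower.prv k))" by (rule joined_commute[THEN iffD1])
    show "joined M T (Lower k) (Upper (Min ?N))" using mn joined_bridge_iff by blast
    show "after (Lower k) (Upper (Min ?N)) (Lower (lower.prv k))" using lower.prv_lt by simp
    fix y assume y: "joined M T (Lower k) y"
    show "\<not> (after (Lower k) (Upper (Min ?N)) y \<and> after (Lower k) y (Lower (lower.prv k)))"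
    proof (cases y)
      case (Lower m)
      have "joined M T (Lower m) (Lower k)" using y Lower joined_commute by blast
      then have "lower.prv k \<le> m" if "m < k"
        using lower.prv_le[of m k] that joined_lower_iff by (auto simp: lower.side_def)
      then show ?thesis using Lower lower.prv_lt[of k] by auto
    next
      case (Upper v)
      then have "Min ?N \<le> v" using y joined_bridge_iff finite_bridge by (intro Min_le) auto
      then show ?thesis using Upper by simp
    qed
  qed
  then show ?thesis using joined_bridge_iff joined_commute by blast
qed

lemma outer_bridged:
  assumes "M \<noteq> {}" "lower.outer k"
  shows "\<exists>u. bridge T u k"
proof -
  obtain u0 k0 where "bridge T u0 k0" using assms ex_bridge by blast
  then show ?thesis
    using bridge_outer bridge_Max_nxt bridge_Min_prv
    by (intro lower.outer_induct[OF assms(2), of k0 "\<lambda>k. \<exists>u. bridge T u k"]) blast+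
qed

text \<open>Without upper points nothing crosses the chord from prv k to nxt k around an outer k, so
  maximality makes it an arc, and this arc covers k.\<close>

lemma outer_imp_upper:
  assumes "lower.outer k" shows "M \<noteq> {}"
proof
  assume M: "M = {}"
  let ?i = "lower.prv k" and ?j = "lower.nxt k"
  have lt: "?i < k" "k < ?j" using lower.prv_lt lower.nxt_gt by auto
  have "conn T (Lower ?i) (Lower ?j)"
  proof (rule conn_maximal)
    show "chord M (Lower ?i) (Lower ?j)" using lt by (subst chord_lower) auto
    fix r s assume rs: "conn T r s"
    have "r \<in> marked {}" "s \<in> marked {}" using conn_chord[OF rs] M by (auto simp: chord_def)
    then obtain a b where ab: "r = Lower a" "s = Lower b" by (auto simp: marked_def)
    then have "a \<noteq> b" using conn_chord[OF rs] by (auto simp: chord_def)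
    have main: "\<not> crossing (Lower ?i) (Lower ?j) (Lower a) (Lower b)" if "lower_arc T a b" for a b
    proof -
      have "a < b" using that by (simp add: lower_arc_def)
      moreover have "\<not> (a < ?i \<and> ?i < b)" "\<not> (a < ?j \<and> ?j < b)" "\<not> (a < k \<and> k < b)"
        using lower.outer_prv[OF assms] lower.outer_nxt[OF assms] assms that
        unfolding lower.outer_def by blast+
      ultimately show ?thesis using lt
        by (simp; metis dual_order.strict_trans linorder_neqE_linordered_idom lower.outer_not_inside
          lower.le_nxt lower.prv_le lower.side_def that leD)
    qed
    show "\<not> crossing (Lower ?i) (Lower ?j) r s"
      using main[of a b] main[of b a] \<open>a \<noteq> b\<close> rs ab conn_commute[of T r s]
      by (cases a b rule: linorder_cases) (auto simp: lower_arc_def crossing_swap)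
  qed
  then have "lower_arc T ?i ?j" using lt by (simp add: lower_arc_def)
  then show False using assms lt by (auto simp: lower.outer_def)
qed

definition count :: "int \<Rightarrow> int" where
  "count k = int (card {S \<in> triangles M T. Lower k \<in> S})"

lemma card_conn: "int (card {p. conn T (Lower k) p}) = lower.deg k + int (card {u. bridge T u k})"
proof -
  have eq: "{p. conn T (Lower k) p} =
      Lower ` ({j. lower_arc T k j} \<union> {i. lower_arc T i k}) \<union> Upper ` {u. bridge T u k}"
  proof (intro set_eqI)
    fix p
    show "p \<in> {p. conn T (Lower k) p} \<longleftrightarrow> p \<in> Lower ` ({j. lower_arc T k j} \<union> {i. lower_arc T i k}) \<union> Upper ` {u. bridge T u k}"
    proof (cases p)
      case (Lower m)
      have "k \<noteq> m" if "conn T (Lower k) (Lower m)" using conn_chord[OF that] by (auto simp: chord_def)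
      then show ?thesis using Lower conn_commute[of T "Lower k" "Lower m"] by (auto simp: lower_arc_def)
    next
      case (Upper u)
      then show ?thesis using conn_commute[of T "Lower k" "Upper u"] by (auto simp: bridge_def)
    qed
  qed
  have "card {p. conn T (Lower k) p} =
      card (Lower ` ({j. lower_arc T k j} \<union> {i. lower_arc T i k})) + card (Upper ` {u. bridge T u k})"
    unfolding eq using lower.finite_right lower.finite_left finite_bridge by (intro card_Un_disjoint) auto
  also have "card (Lower ` ({j. lower_arc T k j} \<union> {i. lower_arc T i k})) = card ({j. lower_arc T k j} \<union> {i. lower_arc T i k})"
    by (intro card_image) (simp add: inj_on_def)
  also have "\<dots> = card {j. lower_arc T k j} + card {i. lower_arc T i k}"
    using lower.finite_right lower.finite_left by (intro card_Un_disjoint) (auto simp: lower_arc_def)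
  also have "card (Upper ` {u. bridge T u k}) = card {u. bridge T u k}"
    by (intro card_image) (simp add: inj_on_def)
  finally show ?thesis by (simp add: lower.deg_def)
qed

text \<open>The two boundary neighbours of k raise the number of neighbours by 2, and triangles are
  one fewer than neighbours.\<close>

lemma count_conn: "count k = int (card {p. conn T (Lower k) p}) + 1"
proof -
  let ?N = "{p. joined M T (Lower k) p}"
  have eq: "?N = {Lower (k + 1), Lower (k - 1)} \<union> {p. conn T (Lower k) p}"
    by (auto simp: joined_iff consecutive_def)
  have "\<not> conn T (Lower k) (Lower (k + 1))" "\<not> conn T (Lower k) (Lower (k - 1))"
    using conn_chord[of "Lower k" "Lower (k + 1)"] conn_chord[of "Lower k" "Lower (k - 1)"]
    by (auto simp: chord_def consecutive_def)
  then have "card ?N = card {p. conn T (Lower k) p} + 2"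
    unfolding eq using finite_conn by simp
  moreover have "finite ?N" unfolding eq using finite_conn by simp
  moreover have "?N \<noteq> {}" unfolding eq by simp
  ultimately show ?thesis using card_triangles_joined[of "Lower k"] by (simp add: count_def)
qed

lemma count_eq: "count k = lower.deg k + int (card {u. bridge T u k}) + 1"
  using count_conn card_conn by simp

lemma count_not_outer: "\<not> lower.outer k \<Longrightarrow> count k = lower.deg k + 1"
proof -
  assume "\<not> lower.outer k"
  then have "{u. bridge T u k} = {}" using bridge_outer by blast
  then show ?thesis using count_eq by simp
qed

lemma count_outer: assumes "lower.outer k" shows "count k \<ge> lower.deg k + 2"
proof -
  have "{u. bridge T u k} \<noteq> {}" using outer_bridged outer_imp_upper assms by blast
  then have "card {u. bridge T u k} > 0" using finite_bridge by (simp add: card_gt_0_iff)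
  then show ?thesis using count_eq[of k] by simp
qed

text \<open>The array with quiddity \<open>count\<close> exists by \<open>pluecker_exists\<close>
  and is 1 on the lower arcs by \<open>side_from_quiddity\<close>. What remains is positivity and
  the absence of further entries 1.\<close>

lemma frieze_exists:
  obtains t where "infinite_frieze t" "quiddity t = count"
    "\<And>i j. lower_arc T i j \<longleftrightarrow> i + 2 \<le> j \<and> t i j = 1"
proof -
  obtain t where t: "pluecker t" "\<And>k. quiddity t k = count k" using pluecker_exists[of count] by blast
  have one: "t i j = 1" if "lower_arc T i j" for i j
    using lower.side_from_quiddity[OF t(1), of i j] t(2) count_not_outer that by (auto simp: lower.side_def)
  have pos: "t i j \<ge> 1" if ij: "i < j" for i j
  proof (cases "\<exists>k. lower.outer k")
    case True
    then obtain p0 where "lower.outer p0" by blast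
    then obtain F where "\<And>k. F k \<ge> 1" "\<And>k. F (k - 1) + F (k + 1) \<le> quiddity t k * F k"
      using lower.outer_supersolution[OF t(1) one] count_outer t(2) by metis
    then show ?thesis using supersolution_pos[OF t(1)] ij by blast
  next
    case False
    \<comment> \<open>Without outer points the right end q of an arc lies below another arc, whose
      left end is at most p by noncrossing. So the covered interval around i grows by at least one
      to the right each time.\<close>
    have "\<exists>p q. lower_arc T p q \<and> p \<le> i \<and> i + int n \<le> q" for n
    proof (induction n)
      case 0
      obtain p q where "lower_arc T p q" "p < i" "i < q" using False unfolding lower.outer_def by blast
      then show ?case by force
    next
      case (Suc n)
      then obtain p q where pq: "lower_arc T p q" "p \<le> i" "i + int n \<le> q" by blast
      obtain p' q' where pq': "lower_arc T p' q'" "p' < q" "q < q'" using False unfolding lower.outer_def by blast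
      have "p' \<le> p" using lower.noncrossing[OF pq(1) pq'(1)] pq' by force
      then show ?case using pq pq' by (intro exI[of _ p'] exI[of _ q']) auto
    qed
    from this[of "nat (j - i)"] obtain p q where "lower_arc T p q" "p \<le> i" "j \<le> q" using ij by auto
    then show ?thesis using lower.side_positive[OF t(1) one, of p q i j] ij by (auto simp: lower.side_def)
  qed
  have frieze: "infinite_frieze t" by (rule infinite_friezeI[OF t(1) pos])
  have conv: "lower_arc T i j" if ij: "i + 2 \<le> j" "t i j = 1" for i j
  proof -
    have "conn T (Lower i) (Lower j)"
    proof (rule conn_maximal)
      show "chord M (Lower i) (Lower j)" using ij by (subst chord_lower) auto
      have low: "\<not> crossing (Lower i) (Lower j) (Lower a) (Lower b)" if ab: "lower_arc T a b" for a b
      proof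
        assume cr: "crossing (Lower i) (Lower j) (Lower a) (Lower b)"
        \<comment> \<open>Two crossing entries 1 contradict the Pluecker relation: their product 1
          would be a sum of two products that are at least 1.\<close>
        have no: False if "t i k = 1" "t j l = 1" "i < j" "j < k" "k < l" for i j k l
        proof -
          have "t i j * t k l \<ge> 1 * 1" "t j k * t i l \<ge> 1 * 1"
            using that pos by (intro mult_mono; force)+
          then show False using plueckerD(5)[OF t(1), of i k j l] that by simp
        qed
        have "a < b" using ab by (simp add: lower_arc_def)
        then have "i < a \<and> a < j \<and> j < b \<or> a < i \<and> i < b \<and> b < j" using cr ij by simp
        then show False using no[of i j a b] no[of a b i j] one[OF ab] ij by blast
      qed
      have bri: "\<not> crossing (Lower i) (Lower j) (Upper u) (Lower k)" if br: "bridge T u k" for u k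
      proof
        assume "crossing (Lower i) (Lower j) (Upper u) (Lower k)"
        then have k: "i < k" "k < j" using crossing_lower_bridge ij by auto
        have ko: "lower.outer k" using bridge_outer br by blast
        \<comment> \<open>The lower end of a bridge is outer, so F is 1 there and
          \<open>supersolution_gt_1\<close> forces t i j >= 2.\<close>
        obtain F where F: "\<And>k. F k \<ge> 1" "\<And>k. F (k - 1) + F (k + 1) \<le> quiddity t k * F k"
          "\<And>k. lower.outer k \<Longrightarrow> F k = 1"
          using lower.outer_supersolution[OF t(1) one ko] count_outer t(2) by metis
        show False using supersolution_gt_1[OF t(1) F(1,2) k F(3)[OF ko]] ij by simp
      qed
      fix r s assume rs: "conn T r s"
      then have "conn T s r" by (simp add: conn_commute)
      have ne: "r \<noteq> s" using conn_chord[OF rs] by (simp add: chord_def)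
      show "\<not> crossing (Lower i) (Lower j) r s"
      proof (cases r; cases s)
        fix a b assume [simp]: "r = Lower a" "s = Lower b"
        show ?thesis using low[of a b] low[of b a] rs \<open>conn T s r\<close> ne
          by (cases a b rule: linorder_cases) (auto simp: lower_arc_def crossing_swap)
      next
        fix a u assume [simp]: "r = Lower a" "s = Upper u"
        show ?thesis using bri[of u a] \<open>conn T s r\<close> by (simp add: bridge_def crossing_swap)
      next
        fix a u assume [simp]: "r = Upper u" "s = Lower a"
        show ?thesis using bri[of u a] rs by (simp add: bridge_def)
      next
        fix u v assume "r = Upper u" "s = Upper v"
        then show ?thesis using rs no_upper by simp
      qed
    qed
    then show ?thesis using ij by (simp add: lower_arc_def)
  qed
  show ?thesis
  proof (rule that[OF frieze])
    show "quiddity t = count" using t(2) by auto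
    show "lower_arc T i j \<longleftrightarrow> i + 2 \<le> j \<and> t i j = 1" for i j
      using conv one lower.arc_ge by blast
  qed
qed

end

lemma Tri_iff: "(M, T) \<in> Tri \<longleftrightarrow> Tri_member M T"
  by (auto simp: Tri_def Tri_member_def strip_triangulation_def Tri_member_axioms_def)

context Tri_member
begin

lemma
  shows infinite_frieze_Phi: "infinite_frieze (Phi (M, T))"
    and quiddity_Phi: "quiddity (Phi (M, T)) = count"
    and lower_arc_iff_Phi: "lower_arc T i j \<longleftrightarrow> i + 2 \<le> j \<and> Phi (M, T) i j = 1"
    and Phi_eqI: "infinite_frieze t \<Longrightarrow> quiddity t = count \<Longrightarrow> Phi (M, T) = t"
proof -
  obtain t where t: "infinite_frieze t" "quiddity t = count"
    "\<And>i j. lower_arc T i j \<longleftrightarrow> i + 2 \<le> j \<and> t i j = 1"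
    using frieze_exists by blast
  have Phi: "Phi (M, T) = t'" if "infinite_frieze t'" "quiddity t' = count" for t'
    unfolding Phi_def case_prod_conv
  proof (rule the_equality)
    show "infinite_frieze t' \<and> (\<forall>i. quiddity t' i = int (card {S \<in> triangles M T. Lower i \<in> S}))"
      using that by (simp add: count_def)
    fix s assume s: "infinite_frieze s \<and> (\<forall>i. quiddity s i = int (card {S \<in> triangles M T. Lower i \<in> S}))"
    then show "s = t'"
      using that by (intro pluecker_unique infinite_frieze_pluecker) (auto simp: count_def)
  qed
  show "infinite_frieze (Phi (M, T))" "quiddity (Phi (M, T)) = count"
    "lower_arc T i j \<longleftrightarrow> i + 2 \<le> j \<and> Phi (M, T) i j = 1"
    using t Phi[OF t(1,2)] by auto
  show "infinite_frieze t \<Longrightarrow> quiddity t = count \<Longrightarrow> Phi (M, T) = t" for t by (rule Phi)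
qed

end

subsection \<open>Invariance under the identifications\<close>

lemma inj_on_relabel: "inj_on f M \<Longrightarrow> inj_on (relabel f) (marked M)"
  by (rule inj_onI) (auto simp: marked_def dest: inj_onD)

lemma relabel_eq_Lower [simp]: "relabel f p = Lower k \<longleftrightarrow> p = Lower k"
  by (cases p) auto

lemma chord_relabel:
  assumes f: "bij_betw f M M'" "mono_on M f" and c: "chord M p q"
  shows "chord M' (relabel f p) (relabel f q)"
proof -
  have inj: "inj_on f M" and im: "f ` M = M'" using f(1) by (auto simp: bij_betw_def)
  have less: "u < v" if "f u < f v" "u \<in> M" "v \<in> M" for u v
    using that f(2) by (metis mono_onD not_le)
  have less': "f u < f v" if "u < v" "u \<in> M" "v \<in> M" for u v
    using that mono_onD[OF f(2), of u v] inj_onD[OF inj, of u v] by force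
  have cons: "consecutive M p q" if cc: "consecutive M' (relabel f p) (relabel f q)"
    and m: "p \<in> marked M" "q \<in> marked M" for p q
  proof (cases p; cases q)
    fix i j assume "p = Lower i" "q = Lower j"
    then show ?thesis using cc by (auto simp: consecutive_def)
  next
    fix u v assume pq: "p = Upper u" "q = Upper v"
    have uv: "u \<in> M" "v \<in> M" using m pq by auto
    have "f u < f v" "\<not> (\<exists>w\<in>M'. f u < w \<and> w < f v)" using cc pq by (auto simp: consecutive_def)
    then have "u < v" "\<not> (\<exists>w\<in>M. u < w \<and> w < v)" using less less' uv im by blast+
    then show ?thesis using pq uv by (auto simp: consecutive_def)
  qed (use cc in \<open>auto simp: consecutive_def\<close>)
  have pq: "p \<in> marked M" "q \<in> marked M" "p \<noteq> q" "\<not> consecutive M p q" "\<not> consecutive M q p"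
    using c by (auto simp: chord_def)
  have "relabel f p \<in> marked M'" if "p \<in> marked M" for p
    using that im by (cases p) auto
  then show ?thesis
    using pq cons inj_onD[OF inj_on_relabel[OF inj]] unfolding chord_def by blast
qed

text \<open>Relabelling fixes lower points and maps the neighbours of each lower point bijectively;
  by \<open>count_conn\<close> the quiddity depends only on their number.\<close>

lemma order_iso_Phi:
  assumes "(M, T) \<in> Tri" "(M', T') \<in> Tri" "order_iso (M, T) (M', T')"
  shows "Phi (M, T) = Phi (M', T')"
proof -
  interpret A: Tri_member M T using assms(1) by (simp add: Tri_iff)
  interpret B: Tri_member M' T' using assms(2) by (simp add: Tri_iff)
  obtain f where f: "bij_betw f M M'" "mono_on M f"
    and T': "T' = {\<beta> \<in> arcs M'. \<exists>\<alpha>\<in>T. ends \<beta> = relabel f ` ends \<alpha>}"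
    using assms(3) by (auto simp: order_iso_def)
  have "{p. conn T' (Lower k) p} = relabel f ` {p. conn T (Lower k) p}" for k
  proof (intro set_eqI iffI)
    fix p' assume "p' \<in> {p. conn T' (Lower k) p}"
    then obtain \<alpha> where \<alpha>: "\<alpha> \<in> T" "{Lower k, p'} = relabel f ` ends \<alpha>"
      by (auto simp: conn_def T')
    have "\<alpha> \<in> arcs M" using \<alpha> A.triang by (auto simp: triangulation_def)
    then obtain p q where pq: "ends \<alpha> = {p, q}" by (rule arc_ends)
    have "{Lower k, p'} = {relabel f p, relabel f q}" using \<alpha> pq by simp
    then consider "p = Lower k" "p' = relabel f q" | "q = Lower k" "p' = relabel f p"
      by (auto simp: doubleton_eq_iff eq_commute[of "Lower k"])
    then show "p' \<in> relabel f ` {p. conn T (Lower k) p}"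
    proof cases
      case 1 then show ?thesis using \<alpha>(1) pq by (auto simp: conn_def)
    next
      case 2
      then have "ends \<alpha> = {Lower k, p}" using pq by auto
      then show ?thesis using \<alpha>(1) 2 by (auto simp: conn_def)
    qed
  next
    fix p' assume "p' \<in> relabel f ` {p. conn T (Lower k) p}"
    then obtain p where p: "conn T (Lower k) p" "p' = relabel f p" by blast
    then have "chord M' (Lower k) p'" using chord_relabel[OF f A.conn_chord[OF p(1)]] by simp
    then obtain \<beta> where \<beta>: "\<beta> \<in> arcs M'" "ends \<beta> = {Lower k, p'}" using arc_exists by metis
    moreover obtain \<alpha> where "\<alpha> \<in> T" "ends \<alpha> = {Lower k, p}" using p by (auto simp: conn_def)
    ultimately have "\<beta> \<in> T'" using p(2) by (auto simp: T' intro!: bexI[of _ \<alpha>])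
    then show "p' \<in> {p. conn T' (Lower k) p}" using \<beta> by (auto simp: conn_def)
  qed
  moreover have "inj_on (relabel f) {p. conn T (Lower k) p}" for k
  proof (rule inj_on_subset[OF inj_on_relabel])
    show "inj_on f M" using f by (simp add: bij_betw_def)
    show "{p. conn T (Lower k) p} \<subseteq> marked M" using A.conn_chord by (auto simp: chord_def)
  qed
  ultimately have "A.count = B.count"
    by (intro ext) (simp add: A.count_conn B.count_conn card_image)
  then show ?thesis
    using A.Phi_eqI[OF B.infinite_frieze_Phi] B.quiddity_Phi by simp
qed

text \<open>The image of \<open>S\<close> in the sense of \<open>order_iso\<close> under translation
  of the upper points by \<open>k\<close>; the Dehn twist is brought into this form.\<close>

definition shifted :: "int \<Rightarrow> strip_arc set \<Rightarrow> strip_arc set" where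
  "shifted k S = {\<beta> \<in> arcs UNIV. \<exists>\<alpha>\<in>S. ends \<beta> = relabel (\<lambda>u. u + k) ` ends \<alpha>}"

lemma relabel_shift: "relabel (\<lambda>u. u + k) (relabel (\<lambda>u. u + l) p) = relabel (\<lambda>u. u + (l + k)) p"
  by (cases p) auto

lemma shifted_shifted:
  assumes S: "S \<subseteq> arcs UNIV" shows "shifted k (shifted l S) = shifted (l + k) S"
proof (intro set_eqI iffI)
  fix \<gamma> assume "\<gamma> \<in> shifted k (shifted l S)"
  then show "\<gamma> \<in> shifted (l + k) S"
    by (auto simp: shifted_def image_image relabel_shift)
next
  fix \<gamma> assume "\<gamma> \<in> shifted (l + k) S"
  then obtain \<alpha> where \<alpha>: "\<gamma> \<in> arcs UNIV" "\<alpha> \<in> S" "ends \<gamma> = relabel (\<lambda>u. u + (l + k)) ` ends \<alpha>"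
    by (auto simp: shifted_def)
  obtain p q where pq: "chord UNIV p q" "ends \<alpha> = {p, q}" using S \<alpha>(2) arc_ends by blast
  have "bij_betw (\<lambda>u. u + l) UNIV UNIV" by (rule bij_betwI[of _ _ _ "\<lambda>u. u - l"]) auto
  then have "chord UNIV (relabel (\<lambda>u. u + l) p) (relabel (\<lambda>u. u + l) q)"
    using chord_relabel[OF _ _ pq(1)] by (simp add: mono_on_def)
  then obtain \<beta> where \<beta>: "\<beta> \<in> arcs UNIV" "ends \<beta> = relabel (\<lambda>u. u + l) ` ends \<alpha>"
    using arc_exists pq(2) by (metis image_insert image_empty)
  then have "\<beta> \<in> shifted l S" using \<alpha> by (auto simp: shifted_def)
  moreover have "ends \<gamma> = relabel (\<lambda>u. u + k) ` ends \<beta>"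
    by (simp add: \<alpha> \<beta> image_image relabel_shift)
  ultimately show "\<gamma> \<in> shifted k (shifted l S)"
    using \<alpha>(1) unfolding shifted_def[of k] by blast
qed

lemma shifted_zero:
  assumes S: "S \<subseteq> arcs UNIV" shows "shifted 0 S = S"
proof -
  have "relabel (\<lambda>u. u + 0) p = p" for p by (cases p) auto
  then have "shifted 0 S = {\<beta> \<in> arcs UNIV. \<exists>\<alpha>\<in>S. ends \<beta> = ends \<alpha>}" by (simp add: shifted_def)
  then show ?thesis using S arc_eqI by blast
qed

text \<open>When no arc is peripheral on the upper boundary, every arc is a bridge, moved by both
  operations, or a lower arc, fixed by both.\<close>

lemma shift_bridging_eq:
  assumes S: "S \<subseteq> arcs UNIV" "\<And>u v. \<not> conn S (Upper u) (Upper v)"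
  shows "shift_bridging k S = shifted k S"
proof (intro set_eqI iffI)
  fix \<beta> assume "\<beta> \<in> shift_bridging k S"
  then consider \<alpha> u j where "\<beta> \<in> arcs UNIV" "\<alpha> \<in> S" "ends \<alpha> = {Upper u, Lower j}" "ends \<beta> = {Upper (u + k), Lower j}"
    | "\<beta> \<in> S" "ends \<beta> \<subseteq> range Lower" by (auto simp: shift_bridging_def)
  then show "\<beta> \<in> shifted k S"
  proof cases
    case 1 then show ?thesis by (auto simp: shifted_def intro!: bexI[of _ \<alpha>])
  next
    case 2
    have "relabel (\<lambda>u. u + k) ` ends \<beta> = (\<lambda>p. p) ` ends \<beta>" using 2 by (intro image_cong) auto
    then show ?thesis using 2 S unfolding shifted_def by (auto intro!: bexI[of _ \<beta>])
  qed
next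
  fix \<beta> assume "\<beta> \<in> shifted k S"
  then obtain \<alpha> where \<alpha>: "\<beta> \<in> arcs UNIV" "\<alpha> \<in> S" "ends \<beta> = relabel (\<lambda>u. u + k) ` ends \<alpha>"
    by (auto simp: shifted_def)
  obtain p q where pq: "chord UNIV p q" "ends \<alpha> = {p, q}" using S \<alpha>(2) arc_ends by blast
  then have c: "conn S p q" using \<alpha> by (auto simp: conn_def)
  show "\<beta> \<in> shift_bridging k S"
  proof (cases p; cases q)
    fix i j assume ij: "p = Lower i" "q = Lower j"
    then have "ends \<beta> = ends \<alpha>" using \<alpha> pq by simp
    then have "\<beta> = \<alpha>" using arc_eqI[OF \<alpha>(1)] S(1) \<alpha>(2) by blast
    then show ?thesis using \<alpha> pq ij by (auto simp: shift_bridging_def)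
  next
    fix i u assume "p = Lower i" "q = Upper u"
    then have "ends \<alpha> = {Upper u, Lower i}" "ends \<beta> = {Upper (u + k), Lower i}" using \<alpha> pq by auto
    then show ?thesis using \<alpha> unfolding shift_bridging_def by blast
  next
    fix i u assume "p = Upper u" "q = Lower i"
    then have "ends \<alpha> = {Upper u, Lower i}" "ends \<beta> = {Upper (u + k), Lower i}" using \<alpha> pq by auto
    then show ?thesis using \<alpha> unfolding shift_bridging_def by blast
  next
    fix u v assume "p = Upper u" "q = Upper v"
    then show ?thesis using c S(2) by simp
  qed
qed

lemma shifted_no_upper:
  assumes "\<And>u v. \<not> conn S (Upper u) (Upper v)" "S \<subseteq> arcs UNIV"
  shows "\<not> conn (shifted k S) (Upper u) (Upper v)"
proof
  assume "conn (shifted k S) (Upper u) (Upper v)"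
  then obtain \<alpha> where \<alpha>: "\<alpha> \<in> S" "{Upper u, Upper v} = relabel (\<lambda>u. u + k) ` ends \<alpha>"
    by (auto simp: conn_def shifted_def)
  obtain p q where pq: "ends \<alpha> = {p, q}" using assms(2) \<alpha>(1) arc_ends by blast
  then have "relabel (\<lambda>u. u + k) p \<in> {Upper u, Upper v}" "relabel (\<lambda>u. u + k) q \<in> {Upper u, Upper v}"
    using \<alpha> by auto
  then obtain u' v' where "p = Upper u'" "q = Upper v'" by (cases p; cases q) auto
  then show False using assms(1) \<alpha> pq by (auto simp: conn_def)
qed

lemma shift_bridging_funpow:
  assumes S: "S \<subseteq> arcs UNIV" "\<And>u v. \<not> conn S (Upper u) (Upper v)"
  shows "(shift_bridging k ^^ n) S = shifted (int n * k) S"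
proof (induction n)
  case 0 then show ?case using shifted_zero[OF S(1)] by simp
next
  case (Suc n)
  have "shift_bridging k (shifted (int n * k) S) = shifted k (shifted (int n * k) S)"
    using shifted_no_upper[OF S(2,1)] by (intro shift_bridging_eq) (auto simp: shifted_def)
  then show ?case using Suc shifted_shifted[OF S(1)] by (simp add: algebra_simps)
qed

text \<open>The n-th power of the twist is the translation by n, an order-preserving bijection of
  the integers.\<close>

lemma dehn_equiv_order_iso:
  assumes "x \<in> Tri" "dehn_equiv x y" shows "order_iso x y"
proof -
  obtain T T' n where xy: "x = (UNIV, T)" "y = (UNIV, T')" "T' = dehn_power n T"
    using assms(2) by (auto simp: dehn_equiv_def split: prod.splits)
  interpret Tri_member UNIV T using assms(1) xy by (simp add: Tri_iff)
  have "T \<subseteq> arcs UNIV" using triang by (simp add: triangulation_def)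
  then have "T' = shifted n T"
    unfolding xy dehn_power_def using shift_bridging_funpow[OF _ no_upper] by simp
  moreover have "bij_betw (\<lambda>u. u + n) UNIV UNIV" by (rule bij_betwI[of _ _ _ "\<lambda>u. u - n"]) auto
  ultimately show ?thesis
    unfolding xy order_iso_def shifted_def by (auto simp: mono_on_def intro!: exI[of _ "\<lambda>u. u + n"])
qed

lemma Phi_respects: "Phi respects Tri_equiv"
proof (rule congruentI)
  fix x y assume "(x, y) \<in> Tri_equiv"
  then have "equivclp (\<lambda>x y. x \<in> Tri \<and> y \<in> Tri \<and> (order_iso x y \<or> dehn_equiv x y)) x y"
    by (simp add: Tri_equiv_def)
  then show "Phi x = Phi y"
  proof (induction rule: equivclp_induct)
    case base then show ?case by simp
  next
    case (step y z)
    have "Phi a = Phi b" if "a \<in> Tri" "b \<in> Tri" "order_iso a b \<or> dehn_equiv a b" for a b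
      using that dehn_equiv_order_iso order_iso_Phi by (cases a; cases b) blast
    then show ?case using step by metis
  qed
qed

subsection \<open>The triangulation of a frieze\<close>

text \<open>Discrete antiderivative of \<open>c\<close> with value 0 at 0. At most one of the two
  sums has a nonempty range, the second one for negative \<open>k\<close>.\<close>

definition cumul :: "(int \<Rightarrow> int) \<Rightarrow> int \<Rightarrow> int" where
  "cumul c k = sum c {0..<k} - sum c {k..<0}"

lemma cumul_succ: "cumul c (k + 1) = cumul c k + c k"
proof (cases "0 \<le> k")
  case True
  then have "{0..<k + 1} = insert k {0..<k}" by auto
  then show ?thesis using True by (simp add: cumul_def)
next
  case False
  then have "{k..<0} = insert k {k + 1..<0}" "{0..<k+1} = {}" "{0..<k} = {}" by auto
  then show ?thesis by (simp add: cumul_def)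
qed

lemma cumul_add: "i \<le> j \<Longrightarrow> cumul c j = cumul c i + sum c {i..<j}"
proof (induction rule: int_ge_induct)
  case base then show ?case by simp
next
  case (step j)
  then have "{i..<j + 1} = insert j {i..<j}" by auto
  then show ?case using step cumul_succ[of c j] by simp
qed

lemma cumul_mono: "(\<And>k. c k \<ge> 0) \<Longrightarrow> i \<le> j \<Longrightarrow> cumul c i \<le> cumul c j"
  using cumul_add[of i j c] sum_nonneg[of "{i..<j}" c] by simp

definition ones :: "(int \<Rightarrow> int \<Rightarrow> int) \<Rightarrow> int \<Rightarrow> int \<Rightarrow> bool" where
  "ones t i j \<longleftrightarrow> i + 2 \<le> j \<and> t i j = 1"

locale frieze =
  fixes t :: "int \<Rightarrow> int \<Rightarrow> int"
  assumes frieze: "infinite_frieze t"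
begin

lemma pl: "pluecker t"
  by (rule infinite_frieze_pluecker[OF frieze])

lemma pos: "i < j \<Longrightarrow> t i j \<ge> 1"
  by (rule infinite_friezeD(2)[OF frieze])

lemma nonneg: "i \<le> j \<Longrightarrow> t i j \<ge> 0"
  using pos[of i j] plueckerD(3)[OF pl, of i] by (cases "i = j") auto

text \<open>The relation for k - 1, k, i, j reads t (k - 1) i = t i j + t (k - 1) j. It yields local
  finiteness of the entries 1.\<close>

lemma fan_right: "t k i = 1 \<Longrightarrow> t k j = 1 \<Longrightarrow> i < j \<Longrightarrow> t (k - 1) j < t (k - 1) i"
  using plueckerD(5)[OF pl, of "k - 1" i k j] plueckerD(4)[OF pl, of k] pos[of i j] by simp

lemma fan_left: "t i k = 1 \<Longrightarrow> t j k = 1 \<Longrightarrow> i < j \<Longrightarrow> t i (k + 1) < t j (k + 1)"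
  using plueckerD(5)[OF pl, of i k j "k + 1"] plueckerD(2)[OF pl, of k] pos[of i j] by simp

text \<open>As k moves from i to j, t i k starts at 0 and t k j ends at 0; the apex is the last k
  with t i k <= t k j. Since t i (k + 1) * t k j - t i k * t (k + 1) j = 1 by the Pluecker relation
  and t i j = 1, the reversed inequality at k + 1 forces t k j = 1, and then t i k = 1.\<close>

lemma frieze_apex:
  assumes "ones t i j"
  shows "\<exists>k. i < k \<and> k < j \<and> (ones t i k \<or> k = i + 1) \<and> (ones t k j \<or> j = k + 1)"
proof -
  have ij: "i + 2 \<le> j" "t i j = 1" using assms by (auto simp: ones_def)
  define A where "A = {k \<in> {i..<j}. t i k \<le> t k j}"
  have "A \<subseteq> {i..<j}" by (auto simp: A_def)
  then have A: "finite A" "i \<in> A"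
    using ij finite_subset plueckerD(3)[OF pl, of i] by (auto simp: A_def)
  define k where "k = Max A"
  have "k \<in> A" using A by (auto simp: k_def intro: Max_in)
  then have k: "i \<le> k" "k < j" "t i k \<le> t k j" by (auto simp: A_def)
  have gt: "t (k + 1) j < t i (k + 1)"
  proof (cases "k + 1 = j")
    case True then show ?thesis using ij plueckerD(3)[OF pl, of j] by simp
  next
    case False
    have "k + 1 \<notin> A" using A k_def by (metis Max_ge not_less zless_add1_eq)
    then show ?thesis using False k by (auto simp: A_def)
  qed
  have det: "t i (k + 1) * t k j = t i k * t (k + 1) j + 1"
    using plueckerD(5)[OF pl, of i "k + 1" k j] plueckerD(2)[OF pl, of k] ij by simp
  have kj: "t k j \<ge> 1" using pos k by simp
  have nn: "t (k + 1) j \<ge> 0" using nonneg k by simp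
  have "(t (k + 1) j + 1) * t k j \<le> t i (k + 1) * t k j" using gt kj by (intro mult_right_mono) auto
  moreover have "t i k * t (k + 1) j \<le> t k j * t (k + 1) j" using k nn by (intro mult_right_mono) auto
  ultimately have "t k j \<le> 1" using det by (simp add: algebra_simps)
  then have one: "t k j = 1" using kj by simp
  have "i \<noteq> k"
  proof
    assume [simp]: "i = k"
    have "t (k + 1) j = 0" using gt nn plueckerD(2)[OF pl, of k] by simp
    then show False using pos[of "k + 1" j] ij by simp
  qed
  then have "i < k" using k by simp
  then have "t i k = 1" using pos[of i k] k one by simp
  then show ?thesis using \<open>i < k\<close> k one by (intro exI[of _ k]) (auto simp: ones_def)
qed

sublocale lamination "ones t"
proof
  show "ones t i j \<Longrightarrow> i + 2 \<le> j" for i j by (simp add: ones_def)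
next
  fix i j k l assume H: "ones t i k" "ones t j l" "i < j" "j < k" "k < l"
  have "t i j * t k l \<ge> 1 * 1" "t j k * t i l \<ge> 1 * 1"
    using H pos by (intro mult_mono; force)+
  then show False using plueckerD(5)[OF pl, of i k j l] H by (simp add: ones_def)
next
  fix k
  \<comment> \<open>By \<open>fan_right\<close>, row k - 1 strictly decreases along the entries 1 of
    row k, starting below its value at k + 1; nonnegativity leaves only finitely many.\<close>
  have "inj_on (t (k - 1)) {j. ones t k j}"
    using fan_right[of k] by (intro linorder_inj_onI) (force simp: ones_def)+
  moreover have "t (k - 1) ` {j. ones t k j} \<subseteq> {0..t (k - 1) (k + 1)}"
    using fan_right[of k "k + 1"] plueckerD(2)[OF pl, of k] nonneg by (force simp: ones_def)
  ultimately show "finite {j. ones t k j}" using inj_on_finite by blast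
  have "inj_on (\<lambda>i. t i (k + 1)) {i. ones t i k}"
    using fan_left[of _ k] by (intro linorder_inj_onI) (force simp: ones_def)+
  moreover have "(\<lambda>i. t i (k + 1)) ` {i. ones t i k} \<subseteq> {0..t (k - 1) (k + 1)}"
    using fan_left[of _ k "k - 1"] plueckerD(4)[OF pl, of k] nonneg by (force simp: ones_def)
  ultimately show "finite {i. ones t i k}" using inj_on_finite by blast
next
  show "ones t i j \<Longrightarrow> \<exists>k. i < k \<and> k < j \<and> (ones t i k \<or> k = i + 1) \<and> (ones t k j \<or> j = k + 1)" for i j
    by (rule frieze_apex)
qed

text \<open>The fan of bridging arcs at an outer point \<open>k\<close> has \<open>excess k + 1\<close> arcs. They end at the upper points
  \<open>level k, \<dots>, level (k + 1)\<close>, so that neighbouring fans share one upper point.\<close>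

definition excess :: "int \<Rightarrow> int" where
  "excess k = (if outer k then quiddity t k - deg k - 2 else 0)"

definition level :: "int \<Rightarrow> int" where
  "level = cumul excess"

definition canonical_bridge :: "int \<Rightarrow> int \<Rightarrow> bool" where
  "canonical_bridge u k \<longleftrightarrow> outer k \<and> level k \<le> u \<and> u \<le> level (k + 1)"

text \<open>The intervals of neighbouring fans share an endpoint, so the union is an interval of
  integers. It is empty when no point is outer and may be finite or unbounded on either
  side.\<close>

definition canonical_upper :: "int set" where
  "canonical_upper = {u. \<exists>k. canonical_bridge u k}"

definition canonical_arcs :: "strip_arc set" where
  "canonical_arcs = {\<alpha> \<in> arcs canonical_upper.
     (\<exists>i j. ones t i j \<and> ends \<alpha> = {Lower i, Lower j}) \<or>
     (\<exists>u k. canonical_bridge u k \<and> ends \<alpha> = {Upper u, Lower k})}"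

lemma one_if_ones: "ones t i j \<Longrightarrow> t i j = 1"
  by (simp add: ones_def)

text \<open>The pair prv k, nxt k covers the outer point k, so its entry is not 1 and hence at least
  2; by \<open>quiddity_outer\<close> this entry is quiddity t k - deg k.\<close>

lemma excess_nonneg: "excess k \<ge> 0"
proof (cases "outer k")
  case True
  have lt: "prv k < k" "k < nxt k" using prv_lt nxt_gt by auto
  have "\<not> ones t (prv k) (nxt k)" using True lt by (auto simp: outer_def)
  then have "t (prv k) (nxt k) \<noteq> 1" using lt by (auto simp: ones_def)
  then have "t (prv k) (nxt k) \<ge> 2" using pos[of "prv k" "nxt k"] lt by simp
  then show ?thesis using quiddity_outer[OF pl one_if_ones, of k] True by (simp add: excess_def)
qed (simp add: excess_def)

lemma level_mono: "i \<le> j \<Longrightarrow> level i \<le> level j"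
  unfolding level_def by (intro cumul_mono excess_nonneg)

lemma level_succ: "level (k + 1) = level k + excess k"
  unfolding level_def by (rule cumul_succ)

lemma level_const:
  assumes "i \<le> j" "\<And>k. i \<le> k \<Longrightarrow> k < j \<Longrightarrow> \<not> outer k" shows "level j = level i"
proof -
  have "sum excess {i..<j} = 0" using assms(2) by (intro sum.neutral) (auto simp: excess_def)
  then show ?thesis unfolding level_def using cumul_add[OF assms(1), of excess] by simp
qed

lemma level_nxt: "level (nxt k) = level (k + 1)"
proof (rule level_const)
  show "k + 1 \<le> nxt k" using nxt_gt[of k] by simp
  show "\<not> outer m" if "k + 1 \<le> m" "m < nxt k" for m
    using outer_not_inside[OF _ side_nxt[of k], of m] that by auto
qed

lemma level_prv: assumes "outer k" shows "level (prv k + 1) = level k"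
  using level_nxt[of "prv k"] nxt_prv[OF assms] by simp

lemma canonical_bridge_nxt: "outer k \<Longrightarrow> canonical_bridge (level (k + 1)) (nxt k)"
  using outer_nxt level_nxt level_mono[of "nxt k" "nxt k + 1"] by (simp add: canonical_bridge_def)

lemma canonical_bridge_prv: "outer k \<Longrightarrow> canonical_bridge (level k) (prv k)"
  using outer_prv level_prv level_mono[of "prv k" "prv k + 1"] by (simp add: canonical_bridge_def)

lemma canonical_bridge_mono:
  "canonical_bridge u k \<Longrightarrow> canonical_bridge v l \<Longrightarrow> k < l \<Longrightarrow> u \<le> v"
  using level_mono[of "k + 1" l] by (auto simp: canonical_bridge_def)

section \<open>The canonical arcs form a maximal noncrossing family\<close>

lemma canonical_conn_lower:
  assumes "i < j" shows "conn canonical_arcs (Lower i) (Lower j) \<longleftrightarrow> ones t i j"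
proof
  assume "conn canonical_arcs (Lower i) (Lower j)"
  then show "ones t i j"
    using assms arc_ge unfolding conn_def canonical_arcs_def by (force simp: doubleton_eq_iff)
next
  assume o: "ones t i j"
  then have "chord canonical_upper (Lower i) (Lower j)"
    using arc_ge assms chord_lower by blast
  then obtain \<alpha> where "\<alpha> \<in> arcs canonical_upper" "ends \<alpha> = {Lower i, Lower j}" using arc_exists by metis
  then show "conn canonical_arcs (Lower i) (Lower j)"
    using o unfolding conn_def canonical_arcs_def by blast
qed

lemma canonical_conn_bridge: "conn canonical_arcs (Upper u) (Lower k) \<longleftrightarrow> canonical_bridge u k"
proof
  assume "conn canonical_arcs (Upper u) (Lower k)"
  then show "canonical_bridge u k"
    unfolding conn_def canonical_arcs_def by (auto simp: doubleton_eq_iff)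
next
  assume o: "canonical_bridge u k"
  then have "chord canonical_upper (Upper u) (Lower k)"
    by (auto simp: chord_bridge canonical_upper_def)
  then obtain \<alpha> where "\<alpha> \<in> arcs canonical_upper" "ends \<alpha> = {Upper u, Lower k}" using arc_exists by metis
  then show "conn canonical_arcs (Upper u) (Lower k)"
    using o unfolding conn_def canonical_arcs_def by blast
qed

lemma canonical_cases:
  assumes "\<alpha> \<in> canonical_arcs"
  obtains i j where "i < j" "ones t i j" "ends \<alpha> = {Lower i, Lower j}"
  | u k where "canonical_bridge u k" "ends \<alpha> = {Upper u, Lower k}"
proof -
  have lt: "i < j" if "ones t i j" for i j using arc_ge[OF that] by simp
  have "(\<exists>i j. ones t i j \<and> ends \<alpha> = {Lower i, Lower j}) \<or>
     (\<exists>u k. canonical_bridge u k \<and> ends \<alpha> = {Upper u, Lower k})"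
    using assms by (simp add: canonical_arcs_def)
  then show ?thesis using that lt by blast
qed

lemma ones_bridge_not_crossing:
  "ones t i j \<Longrightarrow> canonical_bridge u k \<Longrightarrow> \<not> crossing (Lower i) (Lower j) (Upper u) (Lower k)"
  using arc_ge[of i j] by (auto simp: canonical_bridge_def crossing_lower_bridge outer_def)

lemma canonical_not_crossing:
  assumes "\<alpha> \<in> canonical_arcs" "\<beta> \<in> canonical_arcs" "ends \<alpha> = {p, q}" "ends \<beta> = {r, s}"
  shows "\<not> crossing p q r s"
proof -
  have reduce: "\<not> crossing p q r s"
    if "ends \<alpha> = {p', q'}" "ends \<beta> = {r', s'}" "\<not> crossing p' q' r' s'" for p' q' r' s'
  proof -
    have "{p, q} = {p', q'}" "{r, s} = {r', s'}" using that assms(3,4) by simp_all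
    then have "(p = p' \<and> q = q' \<or> p = q' \<and> q = p') \<and> (r = r' \<and> s = s' \<or> r = s' \<and> s = r')"
      by (simp add: doubleton_eq_iff)
    then show ?thesis using that(3) crossing_swap(1)[of p' q'] crossing_swap(2)[of p' q' r' s'] by auto
  qed
  from assms(1) show ?thesis
  proof (cases rule: canonical_cases)
    case (1 i j)
    note a = this
    from assms(2) show ?thesis
    proof (cases rule: canonical_cases)
      case (1 i' j')
      have "\<not> crossing (Lower i) (Lower j) (Lower i') (Lower j')"
        using a 1 noncrossing[of i j i' j'] noncrossing[of i' j' i j] by auto
      then show ?thesis by (rule reduce[OF a(3) 1(3)])
    next
      case (2 u k)
      show ?thesis by (rule reduce[OF a(3) 2(2) ones_bridge_not_crossing[OF a(2) 2(1)]])
    qed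
  next
    case (2 u k)
    note a = this
    from assms(2) show ?thesis
    proof (cases rule: canonical_cases)
      case (1 i j)
      have "\<not> crossing (Upper u) (Lower k) (Lower i) (Lower j)"
        using ones_bridge_not_crossing[OF 1(2) a(1)] crossing_commute by blast
      then show ?thesis by (rule reduce[OF a(2) 1(3)])
    next
      case (2 v l)
      have "\<not> crossing (Upper u) (Lower k) (Upper v) (Lower l)"
        using canonical_bridge_mono[OF a(1) 2(1)] canonical_bridge_mono[OF 2(1) a(1)]
        by (auto simp: crossing_bridges)
      then show ?thesis by (rule reduce[OF a(2) 2(2)])
    qed
  qed
qed

text \<open>First some entry 1 spans the whole of i, j; then descent through apexes shrinks it until
  it is (i, j) itself.\<close>

lemma ones_maximal:
  assumes ij: "i + 2 \<le> j" and out: "\<And>k. i < k \<Longrightarrow> k < j \<Longrightarrow> \<not> outer k"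
    and nc: "\<And>a b. ones t a b \<Longrightarrow> \<not> (i < a \<and> a < j \<and> j < b) \<and> \<not> (a < i \<and> i < b \<and> b < j)"
  shows "ones t i j"
proof -
  have cover: "\<exists>p q. ones t p q \<and> p < k \<and> k < q" if "i < k" "k < j" for k
    using out[OF that] by (auto simp: outer_def)
  \<comment> \<open>If the apex k lies strictly between i and j, a spanning pair longer than (i, j)
    would have a side at k crossing (i, j); otherwise one side at k still spans i, j.\<close>
  have inner: "ones t i j" if "ones t p q" "p \<le> i" "j \<le> q" for p q
    using that
  proof (induction "nat (q - p)" arbitrary: p q rule: less_induct)
    case less
    obtain k where k: "p < k" "k < q" "side p k" "side k q" using side_apex[OF less.prems(1)] by blast
    consider "k \<le> i" | "j \<le> k" | "i < k" "k < j" by linarith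
    then show ?case
    proof cases
      case 1
      then have "ones t k q" using k less.prems ij by (auto simp: side_def)
      then show ?thesis using less.hyps[of q k] 1 k less.prems by simp
    next
      case 2
      then have "ones t p k" using k less.prems ij by (auto simp: side_def)
      then show ?thesis using less.hyps[of k p] 2 k less.prems by simp
    next
      case 3
      have "p = i"
      proof (rule ccontr)
        assume "p \<noteq> i"
        then have "p < i" using less.prems by simp
        then have "ones t p k" using k 3 by (auto simp: side_def)
        then show False using nc 3 \<open>p < i\<close> by blast
      qed
      moreover have "q = j"
      proof (rule ccontr)
        assume "q \<noteq> j"
        then have "j < q" using less.prems by simp
        then have "ones t k q" using k 3 by (auto simp: side_def)
        then show False using nc 3 \<open>j < q\<close> by blast
      qed
      ultimately show ?thesis using less.prems by simp
    qed
  qed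
  have "\<exists>p q. ones t p q \<and> p \<le> i \<and> j \<le> q"
  proof (rule ccontr)
    assume neg: "\<not> ?thesis"
    \<comment> \<open>If nothing spans i, j, an arc over a point of the interval that reaches to i
      or beyond must start exactly at i and end before j. The longest such arc, ending at m, is
      beaten by the arc covering m.\<close>
    have reach: "ones t i q'" "q < q'" "q' < j" if H: "ones t p q'" "p < q" "q < q'" "p \<le> i" "i < q" "q < j" for p q q'
    proof -
      show "q' < j" using neg H by force
      have "p = i" using nc[OF H(1)] H \<open>q' < j\<close> by force
      then show "ones t i q'" using H by simp
      show "q < q'" by (fact H)
    qed
    define A where "A = {q. ones t i q \<and> q < j}"
    have finA: "finite A" by (rule finite_subset[OF _ finite_right[of i]]) (auto simp: A_def)
    obtain p q where pq: "ones t p q" "p < i + 1" "i + 1 < q" using cover[of "i + 1"] ij by auto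
    then have "q \<in> A" using reach[of p q "i + 1"] ij by (auto simp: A_def)
    define m where "m = Max A"
    have "m \<in> A" using finA \<open>q \<in> A\<close> by (auto simp: m_def intro: Max_in)
    then have m: "ones t i m" "m < j" "i + 2 \<le> m" by (auto simp: A_def ones_def)
    obtain p' q' where pq': "ones t p' q'" "p' < m" "m < q'" using cover[of m] m by auto
    have "p' \<le> i" using noncrossing[OF m(1) pq'(1)] pq' by force
    then have "q' \<in> A" using reach[of p' q' m] pq' m by (auto simp: A_def)
    then have "q' \<le> m" using finA by (simp add: m_def)
    then show False using pq' by simp
  qed
  then show ?thesis using inner by blast
qed

lemma outer_bridge: "outer k \<Longrightarrow> canonical_bridge (level k) k"
  using level_mono[of k "k + 1"] by (simp add: canonical_bridge_def)

text \<open>Three kinds of chord: a lower one avoids all fans, so \<open>ones_maximal\<close>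
  applies; a bridging one is confined by the neighbouring fans; an upper one would enclose an upper
  point, which carries a bridge.\<close>

lemma canonical_maximal:
  assumes c: "chord canonical_upper p q"
    and nc: "\<And>r s. conn canonical_arcs r s \<Longrightarrow> \<not> crossing p q r s"
  shows "conn canonical_arcs p q"
proof -
  have lower: "conn canonical_arcs (Lower i) (Lower j)" if ij: "i < j" "chord canonical_upper (Lower i) (Lower j)"
    and nc: "\<And>r s. conn canonical_arcs r s \<Longrightarrow> \<not> crossing (Lower i) (Lower j) r s" for i j
  proof -
    have "ones t i j"
    proof (rule ones_maximal)
      show "i + 2 \<le> j" using ij chord_lower by blast
      show "\<not> outer k" if "i < k" "k < j" for k
        using nc[of "Upper (level k)" "Lower k"] outer_bridge[of k] that
        by (auto simp: canonical_conn_bridge crossing_lower_bridge)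
      fix a b assume ab: "ones t a b"
      then have "a < b" using arc_ge by force
      then show "\<not> (i < a \<and> a < j \<and> j < b) \<and> \<not> (a < i \<and> i < b \<and> b < j)"
        using nc[of "Lower a" "Lower b"] ab ij(1) canonical_conn_lower[OF \<open>a < b\<close>] by auto
    qed
    then show ?thesis using canonical_conn_lower[OF ij(1)] by simp
  qed
  have bridge: "conn canonical_arcs (Upper u) (Lower k)" if c: "chord canonical_upper (Upper u) (Lower k)"
    and nc: "\<And>r s. conn canonical_arcs r s \<Longrightarrow> \<not> crossing (Upper u) (Lower k) r s" for u k
  proof -
    have ncb: "\<not> (u < v \<and> l < k \<or> v < u \<and> k < l)" if "canonical_bridge v l" for v l
      using nc[of "Upper v" "Lower l"] that by (simp add: canonical_conn_bridge crossing_bridges)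
    have "outer k"
      unfolding outer_def
    proof (intro allI impI)
      fix i j assume ij: "ones t i j"
      then have "i < j" using arc_ge by force
      then show "\<not> (i < k \<and> k < j)"
        using nc[of "Lower i" "Lower j"] canonical_conn_lower[OF \<open>i < j\<close>] ij
          crossing_lower_bridge[OF \<open>i < j\<close>, of u k] crossing_commute by blast
    qed
    \<comment> \<open>The bridge from level (k + 1) to nxt k bounds u from above, the bridge from
      level k to prv k bounds it from below.\<close>
    then have "canonical_bridge u k"
      using ncb[OF canonical_bridge_nxt, of k] ncb[OF canonical_bridge_prv, of k] nxt_gt[of k] prv_lt[of k]
      by (auto simp: canonical_bridge_def not_less)
    then show ?thesis by (simp add: canonical_conn_bridge)
  qed
  have upper: False if uv: "u < v" "chord canonical_upper (Upper u) (Upper v)"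
    and nc: "\<And>r s. conn canonical_arcs r s \<Longrightarrow> \<not> crossing (Upper u) (Upper v) r s" for u v
  proof -
    obtain w where w: "w \<in> canonical_upper" "u < w" "w < v"
      using uv by (auto simp: chord_def consecutive_def)
    then obtain k where "canonical_bridge w k" by (auto simp: canonical_upper_def)
    then show False using nc[of "Upper w" "Lower k"] w crossing_upper_bridge[OF uv(1)]
      by (simp add: canonical_conn_bridge)
  qed
  have c': "chord canonical_upper q p" using c by (auto simp: chord_def)
  have nc': "\<not> crossing q p r s" if "conn canonical_arcs r s" for r s
    using nc[OF that] by (simp add: crossing_swap)
  have ne: "p \<noteq> q" using c by (simp add: chord_def)
  show ?thesis
  proof (cases p; cases q)
    fix i j assume [simp]: "p = Lower i" "q = Lower j"
    consider "i < j" | "j < i" using ne by (cases i j rule: linorder_cases) auto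
    then show ?thesis
    proof cases
      case 1 then show ?thesis using lower[of i j] c nc by simp
    next
      case 2
      have "conn canonical_arcs (Lower j) (Lower i)" using lower[of j i] 2 c' nc' by simp
      then show ?thesis using conn_commute by simp
    qed
  next
    fix i u assume [simp]: "p = Lower i" "q = Upper u"
    have "conn canonical_arcs (Upper u) (Lower i)" using bridge[of u i] c' nc' by simp
    then show ?thesis using conn_commute by simp
  next
    fix i u assume [simp]: "p = Upper u" "q = Lower i"
    show ?thesis using bridge[of u i] c nc by simp
  next
    fix u v assume [simp]: "p = Upper u" "q = Upper v"
    consider "u < v" | "v < u" using ne by (cases u v rule: linorder_cases) auto
    then show ?thesis
    proof cases
      case 1 then show ?thesis using upper[of u v] c nc by simp
    next
      case 2 then show ?thesis using upper[of v u] c' nc' by simp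
    qed
  qed
qed

end

context frieze
begin

lemma Tri_member_canonical: "Tri_member canonical_upper canonical_arcs"
proof
  have arcs: "canonical_arcs \<subseteq> arcs canonical_upper" by (auto simp: canonical_arcs_def)
  have "pairwise compatible canonical_arcs"
  proof (rule pairwiseI)
    fix \<alpha> \<beta> assume ab: "\<alpha> \<in> canonical_arcs" "\<beta> \<in> canonical_arcs" "\<alpha> \<noteq> \<beta>"
    have ab': "\<alpha> \<in> arcs canonical_upper" "\<beta> \<in> arcs canonical_upper" using ab arcs by auto
    obtain p q where pq: "ends \<alpha> = {p, q}" using arc_ends[OF ab'(1)] .
    obtain r s where rs: "ends \<beta> = {r, s}" using arc_ends[OF ab'(2)] .
    show "compatible \<alpha> \<beta>"
      using compatible_iff[OF ab' pq rs ab(3)] canonical_not_crossing[OF ab(1,2) pq rs] by simp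
  qed
  moreover have "T' = canonical_arcs"
    if T': "canonical_arcs \<subseteq> T'" "T' \<subseteq> arcs canonical_upper" "pairwise compatible T'" for T'
  proof -
    have "\<beta> \<in> canonical_arcs" if \<beta>: "\<beta> \<in> T'" for \<beta>
    proof -
      have \<beta>': "\<beta> \<in> arcs canonical_upper" using \<beta> T' by auto
      obtain p q where pq: "chord canonical_upper p q" "ends \<beta> = {p, q}" using arc_ends[OF \<beta>'] .
      have "conn canonical_arcs p q"
      proof (rule canonical_maximal[OF pq(1)])
        fix r s assume "conn canonical_arcs r s"
        then obtain \<gamma> where \<gamma>: "\<gamma> \<in> canonical_arcs" "ends \<gamma> = {r, s}" by (auto simp: conn_def)
        show "\<not> crossing p q r s"
        proof (cases "\<beta> = \<gamma>")
          case True then show ?thesis using pq \<gamma> crossing_distinct[of p q r s] by auto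
        next
          case False
          have "\<gamma> \<in> T'" "\<gamma> \<in> arcs canonical_upper" using \<gamma> T' arcs by auto
          moreover from this have "compatible \<beta> \<gamma>" using pairwiseD[OF T'(3) \<beta>] False by simp
          ultimately show ?thesis using compatible_iff[OF \<beta>' _ pq(2) \<gamma>(2) False] by simp
        qed
      qed
      then obtain \<alpha> where \<alpha>: "\<alpha> \<in> canonical_arcs" "ends \<alpha> = {p, q}" by (auto simp: conn_def)
      then have "\<alpha> = \<beta>" using arc_eqI[of \<alpha> canonical_upper \<beta> canonical_upper] arcs \<beta>' pq by auto
      then show ?thesis using \<alpha> by simp
    qed
    then show ?thesis using T'(1) by blast
  qed
  ultimately show "triangulation canonical_upper canonical_arcs"
    using arcs unfolding triangulation_def by blast
  show "admissible canonical_arcs"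
    unfolding admissible_def
  proof
    fix k
    let ?A = "{\<alpha> \<in> canonical_arcs. Lower k \<in> ends \<alpha>}"
    let ?E = "Lower ` ({j. ones t k j} \<union> {i. ones t i k}) \<union> Upper ` {level k..level (k + 1)}"
    have "ends \<alpha> \<in> (\<lambda>p. {Lower k, p}) ` ?E" if "\<alpha> \<in> ?A" for \<alpha>
    proof -
      have "\<alpha> \<in> canonical_arcs" "Lower k \<in> ends \<alpha>" using that by auto
      then show ?thesis
      proof (cases rule: canonical_cases)
        case (1 i j)
        then consider "k = i" | "k = j" using \<open>Lower k \<in> ends \<alpha>\<close> by auto
        then show ?thesis
        proof cases
          case 1 then show ?thesis using \<open>ones t i j\<close> \<open>ends \<alpha> = {Lower i, Lower j}\<close> by auto
        next
          case 2
          then have "ends \<alpha> = {Lower k, Lower i}" using \<open>ends \<alpha> = {Lower i, Lower j}\<close> by auto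
          then show ?thesis using \<open>ones t i j\<close> 2 by auto
        qed
      next
        case (2 u l)
        then have "l = k" using \<open>Lower k \<in> ends \<alpha>\<close> by auto
        then have "ends \<alpha> = {Lower k, Upper u}" "u \<in> {level k..level (k + 1)}"
          using 2 by (auto simp: canonical_bridge_def)
        then show ?thesis by auto
      qed
    qed
    then have sub: "ends ` ?A \<subseteq> (\<lambda>p. {Lower k, p}) ` ?E" by (rule image_subsetI)
    have "finite ?E" using finite_right finite_left by simp
    then have "finite ((\<lambda>p. {Lower k, p}) ` ?E)" by (rule finite_imageI)
    with sub have "finite (ends ` ?A)" by (rule finite_subset)
    moreover have "inj_on ends ?A"
      by (rule inj_onI, rule arc_eqI[of _ canonical_upper _ canonical_upper]) (use arcs in auto)
    ultimately show "finite ?A" by (rule finite_imageD)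
  qed
  fix u assume "u \<in> canonical_upper"
  then obtain k where "canonical_bridge u k" by (auto simp: canonical_upper_def)
  then have "conn canonical_arcs (Upper u) (Lower k)" by (simp add: canonical_conn_bridge)
  then show "\<not> special canonical_arcs (Upper u)" by (auto simp: conn_def special_def)
qed

text \<open>The fan at an outer k has level (k + 1) - level k + 1 = excess k + 1 bridges, so the
  count deg k + excess k + 2 is the quiddity by definition of \<open>excess\<close>.\<close>

lemma Phi_canonical: "Phi (canonical_upper, canonical_arcs) = t"
proof -
  interpret C: Tri_member canonical_upper canonical_arcs by (rule Tri_member_canonical)
  have eq: "lower_arc canonical_arcs = ones t"
  proof (intro ext)
    fix i j
    show "lower_arc canonical_arcs i j = ones t i j"
      using canonical_conn_lower[of i j] arc_ge[of i j] by (auto simp: lower_arc_def)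
  qed
  have "quiddity t k = C.count k" for k
  proof (cases "outer k")
    case True
    have "{u. bridge canonical_arcs u k} = {level k..level (k + 1)}"
      using True by (auto simp: bridge_def canonical_conn_bridge canonical_bridge_def)
    then have "int (card {u. bridge canonical_arcs u k}) = excess k + 1"
      using level_succ[of k] excess_nonneg[of k] by simp
    then show ?thesis using C.count_eq[of k] True by (simp add: excess_def eq)
  next
    case False
    then show ?thesis
      using C.count_not_outer[of k] quiddity_not_outer[OF pl one_if_ones False] by (simp add: eq)
  qed
  then show ?thesis using C.Phi_eqI[OF frieze] by auto
qed

end

subsection \<open>Uniqueness of the triangulation\<close>

context Tri_member
begin

lemma order_iso_canonical:
  "order_iso (M, T) (frieze.canonical_upper (Phi (M, T)), frieze.canonical_arcs (Phi (M, T)))"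
proof -
  interpret F: frieze "Phi (M, T)" by unfold_locales (rule infinite_frieze_Phi)
  have eq: "lower_arc T = ones (Phi (M, T))"
    by (intro ext) (simp add: lower_arc_iff_Phi ones_def)
  have bridge_outer': "F.outer k" if "bridge T u k" for u k using bridge_outer[OF that] by (simp add: eq)
  have bridged: "\<exists>u. bridge T u k" if "F.outer k" for k
    using that outer_bridged[of k] outer_imp_upper[of k] by (simp add: eq)
  let ?N = "\<lambda>k. {u. bridge T u k}"
  have excess: "F.excess k = int (card (?N k)) - 1" if "F.outer k" for k
    using that count_eq[of k] quiddity_Phi by (simp add: F.excess_def eq)
  have Min_bridge: "bridge T (Min (?N k)) k" and Max_bridge: "bridge T (Max (?N k)) k"
    if "F.outer k" for k
    using Min_in[OF finite_bridge, of k] Max_in[OF finite_bridge, of k] bridged[OF that] by blast+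
  have Max_eq: "Max (?N k) = Min (?N (F.nxt k))" if "F.outer k" for k
  proof (rule antisym)
    show "Max (?N k) \<le> Min (?N (F.nxt k))"
      using bridge_mono[OF Max_bridge[OF that] Min_bridge[OF F.outer_nxt[OF that]] F.nxt_gt] .
    have "bridge T (Max (?N k)) (F.nxt k)" using bridge_Max_nxt[OF Max_bridge[OF that]] by (simp add: eq)
    then show "Min (?N (F.nxt k)) \<le> Max (?N k)" using finite_bridge by (intro Min_le) auto
  qed
  \<comment> \<open>The function \<open>\<iota>\<close> counts the points of M from 0 on, and so
    numbers M by consecutive integers in order.\<close>
  define c where "c u = (if u \<in> M then 1 else 0 :: int)" for u
  define \<iota> where "\<iota> = cumul c"
  have \<iota>_mono: "\<iota> u \<le> \<iota> v" if "u \<le> v" for u v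
    unfolding \<iota>_def by (rule cumul_mono[OF _ that]) (simp add: c_def)
  have \<iota>_strict: "\<iota> u < \<iota> v" if "u < v" "u \<in> M" for u v
  proof -
    have "\<iota> (u + 1) = \<iota> u + 1" using that unfolding \<iota>_def by (simp add: cumul_succ c_def)
    then show ?thesis using \<iota>_mono[of "u + 1" v] that by simp
  qed
  \<comment> \<open>By \<open>bridge_convex\<close> every point of M between the extremes of the fan
    belongs to it, so \<open>\<iota>\<close> grows by the size of the fan minus 1.\<close>
  have gap: "\<iota> (Max (?N k)) = \<iota> (Min (?N k)) + F.excess k" if "F.outer k" for k
  proof -
    let ?a = "Min (?N k)" and ?b = "Max (?N k)"
    have le: "?a \<le> ?b" using Max_bridge[OF that] finite_bridge by (intro Min_le) auto
    have "{u \<in> {?a..<?b}. u \<in> M} = ?N k - {?b}"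
    proof (intro set_eqI iffI)
      fix u assume "u \<in> {u \<in> {?a..<?b}. u \<in> M}"
      then show "u \<in> ?N k - {?b}"
        using bridge_convex[OF Min_bridge[OF that] Max_bridge[OF that], of u] by auto
    next
      fix u assume u: "u \<in> ?N k - {?b}"
      then have "?a \<le> u" "u \<le> ?b" using finite_bridge by (auto intro: Min_le Max_ge)
      then show "u \<in> {u \<in> {?a..<?b}. u \<in> M}" using u bridge_in by auto
    qed
    then have "sum c {?a..<?b} = int (card (?N k - {?b}))"
      by (simp add: c_def sum.If_cases Int_def)
    also have "\<dots> = int (card (?N k)) - 1"
    proof -
      have "card (?N k) > 0" using finite_bridge bridged[OF that] by (auto simp: card_gt_0_iff)
      then show ?thesis using Max_bridge[OF that] by (simp add: of_nat_diff)
    qed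
    finally show ?thesis unfolding \<iota>_def using cumul_add[OF le, of c] excess[OF that] by simp
  qed
  \<comment> \<open>Both numberings grow by excess k from one fan to the next, but
    \<open>\<iota>\<close> and \<open>level\<close> are normalised at unrelated places; C is their
    constant difference along the chain of outer points.\<close>
  obtain C where C: "\<And>k. F.outer k \<Longrightarrow> \<iota> (Min (?N k)) = F.level k + C"
  proof (cases "\<exists>k. F.outer k")
    case True
    then obtain k0 where k0: "F.outer k0" by blast
    have step: "\<iota> (Min (?N (F.nxt k))) - F.level (F.nxt k) = \<iota> (Min (?N k)) - F.level k"
      if "F.outer k" for k
      using gap[OF that] Max_eq[OF that] F.level_nxt[of k] F.level_succ[of k] by simp
    have "\<iota> (Min (?N k)) - F.level k = \<iota> (Min (?N k0)) - F.level k0" if "F.outer k" for k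
      using that k0
    proof (induction rule: F.outer_induct)
      case base then show ?case by simp
    next
      case (nxt k) then show ?case using step[of k] by simp
    next
      case (prv k)
      then show ?case using step[OF F.outer_prv[of k]] F.nxt_prv[of k] by simp
    qed
    then show ?thesis using that[of "\<iota> (Min (?N k0)) - F.level k0"] by force
  next
    case False then show ?thesis using that by blast
  qed
  define f where "f u = \<iota> u - C" for u
  have f_less: "f u < f v" if "u < v" "u \<in> M" for u v using \<iota>_strict[OF that] by (simp add: f_def)
  have inj: "inj_on f M" using f_less by (intro linorder_inj_onI) (auto simp: less_imp_neq)
  have mono: "mono_on M f" using \<iota>_mono by (auto simp: mono_on_def f_def)
  \<comment> \<open>Only inclusion and equality of cardinalities are checked: f is injective on M
    and both sets have excess k + 1 elements.\<close>
  have image: "f ` ?N k = {F.level k..F.level (k + 1)}" if k: "F.outer k" for k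
  proof (rule card_subset_eq)
    show "f ` ?N k \<subseteq> {F.level k..F.level (k + 1)}"
    proof (rule image_subsetI)
      fix u assume "u \<in> ?N k"
      then have "Min (?N k) \<le> u" "u \<le> Max (?N k)" using finite_bridge by auto
      then have "\<iota> (Min (?N k)) \<le> \<iota> u" "\<iota> u \<le> \<iota> (Max (?N k))" using \<iota>_mono by auto
      then show "f u \<in> {F.level k..F.level (k + 1)}"
        using C[OF k] gap[OF k] F.level_succ[of k] by (simp add: f_def)
    qed
    have "inj_on f (?N k)" using inj bridge_in by (auto intro: inj_on_subset)
    then have "card (f ` ?N k) = card (?N k)" by (rule card_image)
    moreover have "card (?N k) > 0" using finite_bridge bridged[OF k] by (auto simp: card_gt_0_iff)
    ultimately show "card (f ` ?N k) = card {F.level k..F.level (k + 1)}"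
      using excess[OF k] F.level_succ[of k] by simp
  qed simp
  have bridge_iff: "bridge T u k \<longleftrightarrow> F.canonical_bridge (f u) k" if "u \<in> M" for u k
  proof
    assume "bridge T u k"
    then show "F.canonical_bridge (f u) k"
      using image[OF bridge_outer'] bridge_outer' unfolding F.canonical_bridge_def by fastforce
  next
    assume "F.canonical_bridge (f u) k"
    then have "f u \<in> f ` ?N k" using image unfolding F.canonical_bridge_def by force
    then obtain v where "bridge T v k" "f u = f v" by blast
    then show "bridge T u k" using inj_onD[OF inj _ that bridge_in] by metis
  qed
  have img: "f ` M = F.canonical_upper"
  proof (intro set_eqI iffI)
    fix w assume "w \<in> f ` M"
    then obtain u where u: "w = f u" "u \<in> M" by blast
    then show "w \<in> F.canonical_upper" using ex_bridge[OF u(2)] bridge_iff by (auto simp: F.canonical_upper_def)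
  next
    fix w assume "w \<in> F.canonical_upper"
    then obtain k where "F.outer k" "w \<in> {F.level k..F.level (k + 1)}"
      by (auto simp: F.canonical_upper_def F.canonical_bridge_def)
    then have "w \<in> f ` ?N k" using image by blast
    then show "w \<in> f ` M" using bridge_in by blast
  qed
  have bij: "bij_betw f M F.canonical_upper" using inj img by (simp add: bij_betw_def)
  have "F.canonical_arcs = {\<beta> \<in> arcs F.canonical_upper. \<exists>\<alpha>\<in>T. ends \<beta> = relabel f ` ends \<alpha>}"
  proof (intro set_eqI iffI)
    fix \<beta> assume \<beta>: "\<beta> \<in> F.canonical_arcs"
    then have "\<beta> \<in> arcs F.canonical_upper" by (simp add: F.canonical_arcs_def)
    moreover from \<beta> have "\<exists>\<alpha>\<in>T. ends \<beta> = relabel f ` ends \<alpha>"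
    proof (cases rule: F.canonical_cases)
      case (1 i j)
      then have "lower_arc T i j" by (simp add: eq)
      then obtain \<alpha> where "\<alpha> \<in> T" "ends \<alpha> = {Lower i, Lower j}" by (auto simp: lower_arc_def conn_def)
      then show ?thesis using 1 by (intro bexI[of _ \<alpha>]) auto
    next
      case (2 w k)
      then have "w \<in> F.canonical_upper" by (auto simp: F.canonical_upper_def)
      then obtain u where u: "u \<in> M" "w = f u" using img by blast
      then have "bridge T u k" using 2 bridge_iff by simp
      then obtain \<alpha> where "\<alpha> \<in> T" "ends \<alpha> = {Upper u, Lower k}" by (auto simp: bridge_def conn_def)
      then show ?thesis using 2 u by (intro bexI[of _ \<alpha>]) auto
    qed
    ultimately show "\<beta> \<in> {\<beta> \<in> arcs F.canonical_upper. \<exists>\<alpha>\<in>T. ends \<beta> = relabel f ` ends \<alpha>}" by simp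
  next
    fix \<beta> assume "\<beta> \<in> {\<beta> \<in> arcs F.canonical_upper. \<exists>\<alpha>\<in>T. ends \<beta> = relabel f ` ends \<alpha>}"
    then obtain \<alpha> where \<alpha>: "\<beta> \<in> arcs F.canonical_upper" "\<alpha> \<in> T" "ends \<beta> = relabel f ` ends \<alpha>" by blast
    have "\<alpha> \<in> arcs M" using \<alpha>(2) triang by (auto simp: triangulation_def)
    then obtain p q where pq: "chord M p q" "ends \<alpha> = {p, q}" by (rule arc_ends)
    have cpq: "conn T p q" "conn T q p" using \<alpha>(2) pq by (auto simp: conn_def)
    have lower: "\<beta> \<in> F.canonical_arcs" if "conn T (Lower i) (Lower j)" "i < j" "ends \<alpha> = {Lower i, Lower j}" for i j
    proof -
      have "ones (Phi (M, T)) i j" using that by (simp add: lower_arc_def flip: eq)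
      then show ?thesis using \<alpha> that by (auto simp: F.canonical_arcs_def)
    qed
    have bri: "\<beta> \<in> F.canonical_arcs" if "conn T (Upper u) (Lower k)" "ends \<alpha> = {Upper u, Lower k}" for u k
    proof -
      have "bridge T u k" using that by (simp add: bridge_def)
      then have "F.canonical_bridge (f u) k" using bridge_iff bridge_in by blast
      then show ?thesis using \<alpha> that by (auto simp: F.canonical_arcs_def)
    qed
    show "\<beta> \<in> F.canonical_arcs"
    proof (cases p; cases q)
      fix i j assume "p = Lower i" "q = Lower j"
      moreover from this have "i \<noteq> j" using pq by (auto simp: chord_def)
      ultimately show ?thesis using lower[of i j] lower[of j i] cpq pq(2)
        by (cases i j rule: linorder_cases) (auto simp: insert_commute)
    next
      fix i u assume "p = Lower i" "q = Upper u"
      then show ?thesis using bri[of u i] cpq pq(2) by (simp add: insert_commute)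
    next
      fix i u assume "p = Upper u" "q = Lower i"
      then show ?thesis using bri[of u i] cpq pq(2) by simp
    next
      fix u v assume "p = Upper u" "q = Upper v"
      then show ?thesis using no_upper cpq by simp
    qed
  qed
  then show ?thesis unfolding order_iso_def using bij mono by blast
qed

end

lemma Tri_equiv_order_iso:
  assumes "x \<in> Tri" "y \<in> Tri" "order_iso x y" shows "(x, y) \<in> Tri_equiv"
proof -
  let ?R = "\<lambda>x y. x \<in> Tri \<and> y \<in> Tri \<and> (order_iso x y \<or> dehn_equiv x y)"
  have "equivclp ?R x y" by (rule r_into_equivclp) (use assms in simp)
  then show ?thesis using assms by (simp add: Tri_equiv_def)
qed

text \<open>Both triangulations are order isomorphic to the canonical one, which depends only on the
  common frieze; symmetry and transitivity of \<open>Tri_equiv\<close> connect them.\<close>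

lemma Phi_eq_imp_Tri_equiv:
  assumes x: "x \<in> Tri" and y: "y \<in> Tri" and "Phi x = Phi y"
  shows "(x, y) \<in> Tri_equiv"
proof -
  define z where "z = (frieze.canonical_upper (Phi x), frieze.canonical_arcs (Phi x))"
  have z: "infinite_frieze (Phi w) \<and> order_iso w z" if "w \<in> Tri" "Phi w = Phi x" for w
  proof -
    obtain M T where w: "w = (M, T)" by (cases w)
    interpret Tri_member M T using that w by (simp add: Tri_iff)
    show ?thesis using order_iso_canonical infinite_frieze_Phi that(2) by (simp add: w z_def)
  qed
  interpret frieze "Phi x" using z[OF x] by unfold_locales simp
  have "z \<in> Tri" using Tri_member_canonical by (simp add: z_def Tri_iff)
  then have "(x, z) \<in> Tri_equiv" "(y, z) \<in> Tri_equiv"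
    using z[OF x] z[OF y] x y assms(3) by (auto intro: Tri_equiv_order_iso)
  moreover have "sym Tri_equiv" "trans Tri_equiv" using equiv_Tri by (auto simp: equiv_def)
  ultimately show ?thesis by (meson symD transD)
qed

theorem theorem3p1:
  "Phi respects Tri_equiv \<and>
   bij_betw (\<lambda>C. the_elem (Phi ` C)) (Tri // Tri_equiv) {t. infinite_frieze t}"
proof
  show resp: "Phi respects Tri_equiv" by (rule Phi_respects)
  have val: "the_elem (Phi ` (Tri_equiv `` {x})) = Phi x" if "x \<in> Tri" for x
  proof -
    have "Phi ` (Tri_equiv `` {x}) = {Phi x}"
      using resp equiv_class_self[OF equiv_Tri that] by (force simp: congruent_def)
    then show ?thesis by simp
  qed
  show "bij_betw (\<lambda>C. the_elem (Phi ` C)) (Tri // Tri_equiv) {t. infinite_frieze t}"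
  proof (rule bij_betw_imageI)
    show "inj_on (\<lambda>C. the_elem (Phi ` C)) (Tri // Tri_equiv)"
    proof (rule inj_onI)
      fix C D assume CD: "C \<in> Tri // Tri_equiv" "D \<in> Tri // Tri_equiv"
        "the_elem (Phi ` C) = the_elem (Phi ` D)"
      obtain x y where xy: "x \<in> Tri" "C = Tri_equiv `` {x}" "y \<in> Tri" "D = Tri_equiv `` {y}"
        using CD(1,2) by (auto elim!: quotientE)
      then have "(x, y) \<in> Tri_equiv" using CD(3) val Phi_eq_imp_Tri_equiv by simp
      then show "C = D" using xy equiv_class_eq[OF equiv_Tri] by simp
    qed
    show "(\<lambda>C. the_elem (Phi ` C)) ` (Tri // Tri_equiv) = {t. infinite_frieze t}"
    proof (intro set_eqI iffI)
      fix t assume "t \<in> (\<lambda>C. the_elem (Phi ` C)) ` (Tri // Tri_equiv)"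
      then obtain M T where x: "(M, T) \<in> Tri" "t = Phi (M, T)"
        using val by (fastforce elim!: quotientE)
      then show "t \<in> {t. infinite_frieze t}" using Tri_member.infinite_frieze_Phi by (simp add: Tri_iff)
    next
      fix t assume "t \<in> {t. infinite_frieze t}"
      then interpret frieze t by unfold_locales simp
      define x where "x = (canonical_upper, canonical_arcs)"
      have "x \<in> Tri" "Phi x = t"
        using Tri_member_canonical Phi_canonical by (auto simp: x_def Tri_iff)
      then show "t \<in> (\<lambda>C. the_elem (Phi ` C)) ` (Tri // Tri_equiv)"
        using val[of x] quotientI[of x Tri Tri_equiv] by force
    qed
  qed
qed

end
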